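(* Satisfiability of ND-LTL is undecidable over finite data words and also over infinite data words. Satisfiability of $\mathrm{ND\text{-}LTL}^-$ is undecidable over infinite data words.
   Context: Fix an infinite data domain $\Delta$, a finite set $AP$ of atomic propositions, and a finite attribute set $A$ with a tree order $\le$ (a partial order such that for every $x$, $x^\downarrow=\{y:y\le x\}$ is linearly ordered). Data words are finite or infinite sequences $w=(a_0,\vec d_0)(a_1,\vec d_1)\cdots$ with $a_i\in 2^{AP}$, $\vec d_i:A\to\Delta$. Syntax: position formulae $\varphi ::= p\mid\varphi\wedge\varphi\mid\neg\varphi\mid\mathrm X\varphi\mid\mathrm Y\varphi\mid\varphi\mathrm U\varphi\mid\varphi\mathrm S\varphi\mid\mathrm C^r_x\psi$; class formulae $\psi::=@x\mid\psi\wedge\psi\mid\neg\psi\mid\mathrm X^=\psi\mid\mathrm Y^=\psi\mid\psi\mathrm U^=\psi\mid\psi\mathrm S^=\psi\mid\varphi$ ($p\in AP$, $x\in A$, $r\in\mathbb Z$). For $x\in A$ with $x^\downarrow=\{x_1<\dots<x_n\}$ and $\vec d\in\Delta^{x^\downarrow}$ associate the vector $(\vec d(x_1),\dots,\vec d(x_n))$; $\vec d\simeq\vec d'$ if they have the same vector. Let $\mathrm{pos}_{\vec d}(w)=\{i:\exists y\in A,\ \vec d\simeq\vec d_i|_{y^\downarrow}\}$. Position formulae at $(w,i)$: $p$ iff $p\in a_i$; Boolean and LTL operators as usual; $(w,i)\models\mathrm C^r_x\psi$ iff $0\le i+r<|w|$ and $(w,i+r,\vec d_i|_{x^\downarrow})\models\psi$.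 Class formulae at $(w,i,\vec d)$: $\varphi$ iff $(w,i)\models\varphi$; $@x$ iff $\vec d_i|_{x^\downarrow}\simeq\vec d$; $\mathrm X^=\psi$ iff some $j\in\mathrm{pos}_{\vec d}(w)$ has $j>i$ and for the smallest such $j$, $(w,j,\vec d)\models\psi$; $\psi_1\mathrm U^=\psi_2$ iff some $j\in\mathrm{pos}_{\vec d}(w)$, $j\ge i$, satisfies $\psi_2$ and all $j'\in\mathrm{pos}_{\vec d}(w)$ with $i\le j'<j$ satisfy $\psi_1$; $\mathrm Y^=,\mathrm S^=$ are the symmetric past versions. A formula is satisfiable over finite (infinite) data words if $(w,0)\models\varphi$ for some finite (infinite) $w$. $\mathrm{ND\text{-}LTL}^-$ is the fragment without $\mathrm X^=$ and $\mathrm U^=$. *)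

theory Defs
  imports "HOL-Library.Nat_Bijection" "HOL-Library.Extended_Nat"
begin

section \<open>Attribute sets with a tree order\<close>

text \<open>An order is the set \<open>R\<close> of the pairs \<open>(y, x)\<close> with \<open>y \<le> x\<close>, so the downward closure
  of \<open>x\<close> is \<open>under R x\<close>.\<close>

definition tree_order_on :: "'a set \<Rightarrow> 'a rel \<Rightarrow> bool" where
  "tree_order_on A R \<longleftrightarrow>
     partial_order_on A R \<and> (\<forall>x\<in>A. linear_order_on (under R x) (Restr R (under R x)))"

text \<open>The increasing enumeration of a finite chain.\<close>

definition enum_chain :: "'a rel \<Rightarrow> 'a set \<Rightarrow> 'a list" where
  "enum_chain R S = (THE xs. set xs = S \<and> sorted_wrt (\<lambda>x y. (x, y) \<in> R \<and> x \<noteq> y) xs)"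


section \<open>Data words\<close>

type_synonym ('p, 'a, 'd) letter = "'p set \<times> ('a \<Rightarrow> 'd)"

datatype ('p, 'a, 'd) data_word =
  Finite_Word "('p, 'a, 'd) letter list"
| Infinite_Word "nat \<Rightarrow> ('p, 'a, 'd) letter"

fun wlen :: "('p, 'a, 'd) data_word \<Rightarrow> enat" where
  "wlen (Finite_Word xs) = enat (length xs)"
| "wlen (Infinite_Word f) = \<infinity>"

fun wnth :: "('p, 'a, 'd) data_word \<Rightarrow> nat \<Rightarrow> ('p, 'a, 'd) letter" where
  "wnth (Finite_Word xs) i = xs ! i"
| "wnth (Infinite_Word f) i = f i"

abbreviation props_at :: "('p, 'a, 'd) data_word \<Rightarrow> nat \<Rightarrow> 'p set" where
  "props_at w i \<equiv> fst (wnth w i)"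

abbreviation data_at :: "('p, 'a, 'd) data_word \<Rightarrow> nat \<Rightarrow> 'a \<Rightarrow> 'd" where
  "data_at w i \<equiv> snd (wnth w i)"

text \<open>Attribute valuations are total functions, of which only the values on \<open>A\<close> matter.\<close>

definition data_word_over ::
  "'p set \<Rightarrow> 'a set \<Rightarrow> 'd set \<Rightarrow> ('p, 'a, 'd) data_word \<Rightarrow> bool" where
  "data_word_over P A \<Delta> w \<longleftrightarrow>
     (\<forall>i. enat i < wlen w \<longrightarrow> props_at w i \<subseteq> P \<and> data_at w i ` A \<subseteq> \<Delta>)"


section \<open>Partial data valuations\<close>

text \<open>An element of \<open>\<Delta>\<close> to the power of the downward closure of \<open>x\<close> is a map with domain
  \<open>under R x\<close>.\<close>

definition restr :: "'a rel \<Rightarrow> ('a \<Rightarrow> 'd) \<Rightarrow> 'a \<Rightarrow> ('a \<rightharpoonup> 'd)" where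
  "restr R d x = (Some \<circ> d) |` under R x"

definition vec :: "'a rel \<Rightarrow> ('a \<rightharpoonup> 'd) \<Rightarrow> 'd list" where
  "vec R v = map (the \<circ> v) (enum_chain R (dom v))"

definition val_equiv :: "'a rel \<Rightarrow> ('a \<rightharpoonup> 'd) \<Rightarrow> ('a \<rightharpoonup> 'd) \<Rightarrow> bool" where
  "val_equiv R v v' \<longleftrightarrow> vec R v = vec R v'"

definition class_pos ::
  "'a set \<Rightarrow> 'a rel \<Rightarrow> ('p, 'a, 'd) data_word \<Rightarrow> ('a \<rightharpoonup> 'd) \<Rightarrow> nat set" where
  "class_pos A R w v =
     {i. enat i < wlen w \<and> (\<exists>y\<in>A. val_equiv R v (restr R (data_at w i) y))}"


section \<open>Syntax\<close>

datatype ('p, 'a) pform =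
  Prop 'p
| PAnd "('p, 'a) pform" "('p, 'a) pform"
| PNot "('p, 'a) pform"
| Next "('p, 'a) pform"
| Prev "('p, 'a) pform"
| Until "('p, 'a) pform" "('p, 'a) pform"
| Since "('p, 'a) pform" "('p, 'a) pform"
| Class int 'a "('p, 'a) cform" \<comment> \<open>\<open>Class r x \<psi>\<close> is the operator C with subscript \<open>x\<close> and shift \<open>r\<close>\<close>
and ('p, 'a) cform =
  At 'a
| CAnd "('p, 'a) cform" "('p, 'a) cform"
| CNot "('p, 'a) cform"
| NextEq "('p, 'a) cform"
| PrevEq "('p, 'a) cform"
| UntilEq "('p, 'a) cform" "('p, 'a) cform"
| SinceEq "('p, 'a) cform" "('p, 'a) cform"
| Pos "('p, 'a) pform"

text \<open>The formulae over propositions \<open>P\<close> and attributes \<open>A\<close>.\<close>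

primrec pform_over :: "'p set \<Rightarrow> 'a set \<Rightarrow> ('p, 'a) pform \<Rightarrow> bool"
  and cform_over :: "'p set \<Rightarrow> 'a set \<Rightarrow> ('p, 'a) cform \<Rightarrow> bool"
where
  "pform_over P A (Prop p) = (p \<in> P)"
| "pform_over P A (PAnd \<phi> \<phi>') = (pform_over P A \<phi> \<and> pform_over P A \<phi>')"
| "pform_over P A (PNot \<phi>) = pform_over P A \<phi>"
| "pform_over P A (Next \<phi>) = pform_over P A \<phi>"
| "pform_over P A (Prev \<phi>) = pform_over P A \<phi>"
| "pform_over P A (Until \<phi> \<phi>') = (pform_over P A \<phi> \<and> pform_over P A \<phi>')"
| "pform_over P A (Since \<phi> \<phi>') = (pform_over P A \<phi> \<and> pform_over P A \<phi>')"
| "pform_over P A (Class r x \<psi>) = (x \<in> A \<and> cform_over P A \<psi>)"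
| "cform_over P A (At x) = (x \<in> A)"
| "cform_over P A (CAnd \<psi> \<psi>') = (cform_over P A \<psi> \<and> cform_over P A \<psi>')"
| "cform_over P A (CNot \<psi>) = cform_over P A \<psi>"
| "cform_over P A (NextEq \<psi>) = cform_over P A \<psi>"
| "cform_over P A (PrevEq \<psi>) = cform_over P A \<psi>"
| "cform_over P A (UntilEq \<psi> \<psi>') = (cform_over P A \<psi> \<and> cform_over P A \<psi>')"
| "cform_over P A (SinceEq \<psi> \<psi>') = (cform_over P A \<psi> \<and> cform_over P A \<psi>')"
| "cform_over P A (Pos \<phi>) = pform_over P A \<phi>"

text \<open>The fragment without \<^const>\<open>NextEq\<close> and \<^const>\<open>UntilEq\<close>.\<close>

primrec past_pform :: "('p, 'a) pform \<Rightarrow> bool"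
  and past_cform :: "('p, 'a) cform \<Rightarrow> bool"
where
  "past_pform (Prop p) = True"
| "past_pform (PAnd \<phi> \<phi>') = (past_pform \<phi> \<and> past_pform \<phi>')"
| "past_pform (PNot \<phi>) = past_pform \<phi>"
| "past_pform (Next \<phi>) = past_pform \<phi>"
| "past_pform (Prev \<phi>) = past_pform \<phi>"
| "past_pform (Until \<phi> \<phi>') = (past_pform \<phi> \<and> past_pform \<phi>')"
| "past_pform (Since \<phi> \<phi>') = (past_pform \<phi> \<and> past_pform \<phi>')"
| "past_pform (Class r x \<psi>) = past_cform \<psi>"
| "past_cform (At x) = True"
| "past_cform (CAnd \<psi> \<psi>') = (past_cform \<psi> \<and> past_cform \<psi>')"
| "past_cform (CNot \<psi>) = past_cform \<psi>"
| "past_cform (NextEq \<psi>) = False"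
| "past_cform (PrevEq \<psi>) = past_cform \<psi>"
| "past_cform (UntilEq \<psi> \<psi>') = False"
| "past_cform (SinceEq \<psi> \<psi>') = (past_cform \<psi> \<and> past_cform \<psi>')"
| "past_cform (Pos \<phi>) = past_pform \<phi>"


section \<open>Semantics\<close>

primrec psat ::
    "'a set \<Rightarrow> 'a rel \<Rightarrow> ('p, 'a, 'd) data_word \<Rightarrow> ('p, 'a) pform \<Rightarrow> nat \<Rightarrow> bool"
  and csat ::
    "'a set \<Rightarrow> 'a rel \<Rightarrow> ('p, 'a, 'd) data_word \<Rightarrow> ('p, 'a) cform \<Rightarrow> nat \<Rightarrow> ('a \<rightharpoonup> 'd) \<Rightarrow> bool"
where
  "psat A R w (Prop p) i = (p \<in> props_at w i)"
| "psat A R w (PAnd \<phi> \<phi>') i = (psat A R w \<phi> i \<and> psat A R w \<phi>' i)"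
| "psat A R w (PNot \<phi>) i = (\<not> psat A R w \<phi> i)"
| "psat A R w (Next \<phi>) i = (enat (i + 1) < wlen w \<and> psat A R w \<phi> (i + 1))"
| "psat A R w (Prev \<phi>) i = (i > 0 \<and> psat A R w \<phi> (i - 1))"
| "psat A R w (Until \<phi> \<phi>') i =
     (\<exists>j\<ge>i. enat j < wlen w \<and> psat A R w \<phi>' j \<and> (\<forall>k. i \<le> k \<and> k < j \<longrightarrow> psat A R w \<phi> k))"
| "psat A R w (Since \<phi> \<phi>') i =
     (\<exists>j\<le>i. psat A R w \<phi>' j \<and> (\<forall>k. j < k \<and> k \<le> i \<longrightarrow> psat A R w \<phi> k))"
| "psat A R w (Class r x \<psi>) i =
     (0 \<le> int i + r \<and> enat (nat (int i + r)) < wlen w \<and>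
      csat A R w \<psi> (nat (int i + r)) (restr R (data_at w i) x))"
| "csat A R w (At x) i v = val_equiv R (restr R (data_at w i) x) v"
| "csat A R w (CAnd \<psi> \<psi>') i v = (csat A R w \<psi> i v \<and> csat A R w \<psi>' i v)"
| "csat A R w (CNot \<psi>) i v = (\<not> csat A R w \<psi> i v)"
| "csat A R w (NextEq \<psi>) i v =
     (\<exists>j\<in>class_pos A R w v. j > i \<and> (\<forall>k\<in>class_pos A R w v. k > i \<longrightarrow> j \<le> k) \<and> csat A R w \<psi> j v)"
| "csat A R w (PrevEq \<psi>) i v =
     (\<exists>j\<in>class_pos A R w v. j < i \<and> (\<forall>k\<in>class_pos A R w v. k < i \<longrightarrow> k \<le> j) \<and> csat A R w \<psi> j v)"
| "csat A R w (UntilEq \<psi> \<psi>') i v =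
     (\<exists>j\<in>class_pos A R w v. j \<ge> i \<and> csat A R w \<psi>' j v \<and>
        (\<forall>k\<in>class_pos A R w v. i \<le> k \<and> k < j \<longrightarrow> csat A R w \<psi> k v))"
| "csat A R w (SinceEq \<psi> \<psi>') i v =
     (\<exists>j\<in>class_pos A R w v. j \<le> i \<and> csat A R w \<psi>' j v \<and>
        (\<forall>k\<in>class_pos A R w v. j < k \<and> k \<le> i \<longrightarrow> csat A R w \<psi> k v))"
| "csat A R w (Pos \<phi>) i v = psat A R w \<phi> i"


section \<open>The satisfiability problems\<close>

text \<open>An instance \<open>(m, n, rs, \<phi>)\<close> consists of a formula \<open>\<phi>\<close> together with its signature:
  propositions \<open>{..<m}\<close>, attributes \<open>{..<n}\<close>, and the tree order given by the list \<open>rs\<close> of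
  all its pairs. Up to renaming, every finite signature is of this form.\<close>

type_synonym nd_instance = "nat \<times> nat \<times> (nat \<times> nat) list \<times> (nat, nat) pform"

definition nd_ltl :: "nd_instance set" where
  "nd_ltl = {(m, n, rs, \<phi>). tree_order_on {..<n} (set rs) \<and> pform_over {..<m} {..<n} \<phi>}"

definition nd_ltl_minus :: "nd_instance set" where
  "nd_ltl_minus = {(m, n, rs, \<phi>). (m, n, rs, \<phi>) \<in> nd_ltl \<and> past_pform \<phi>}"

text \<open>The conjunct \<open>0 < wlen w\<close> says that \<open>0\<close> is a position of \<open>w\<close>: it excludes the empty word.\<close>

definition sat_finite :: "'d set \<Rightarrow> nd_instance \<Rightarrow> bool" where
  "sat_finite \<Delta> = (\<lambda>(m, n, rs, \<phi>).
     \<exists>w. data_word_over {..<m} {..<n} \<Delta> w \<and> wlen w \<noteq> \<infinity> \<and> 0 < wlen w \<and>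
         psat {..<n} (set rs) w \<phi> 0)"

definition sat_infinite :: "'d set \<Rightarrow> nd_instance \<Rightarrow> bool" where
  "sat_infinite \<Delta> = (\<lambda>(m, n, rs, \<phi>).
     \<exists>w. data_word_over {..<m} {..<n} \<Delta> w \<and> wlen w = \<infinity> \<and>
         psat {..<n} (set rs) w \<phi> 0)"


section \<open>Partial recursive functions\<close>

datatype recf =
  Zero
| Successor
| Proj nat
| Comp recf "recf list"
| PrimRec recf recf
| Mu recf

text \<open>\<open>rec_eval f xs y\<close> means that \<open>f\<close> is defined on the arguments \<open>xs\<close> with value \<open>y\<close>. Arities
  are not tracked in the syntax: on an argument list of unsuitable length \<open>f\<close> is undefined
  or ignores the surplus arguments.\<close>

inductive rec_eval :: "recf \<Rightarrow> nat list \<Rightarrow> nat \<Rightarrow> bool" where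
  zero: "rec_eval Zero xs 0"
| successor: "rec_eval Successor [x] (Suc x)"
| proj: "i < length xs \<Longrightarrow> rec_eval (Proj i) xs (xs ! i)"
| comp: "list_all2 (\<lambda>g y. rec_eval g xs y) gs ys \<Longrightarrow> rec_eval f ys z \<Longrightarrow> rec_eval (Comp f gs) xs z"
| primrec_0: "rec_eval f xs y \<Longrightarrow> rec_eval (PrimRec f g) (0 # xs) y"
| primrec_Suc: "rec_eval (PrimRec f g) (n # xs) y \<Longrightarrow> rec_eval g (n # y # xs) z \<Longrightarrow>
    rec_eval (PrimRec f g) (Suc n # xs) z"
| mu: "rec_eval f (n # xs) 0 \<Longrightarrow> (\<forall>k<n. \<exists>y. rec_eval f (k # xs) (Suc y)) \<Longrightarrow>
    rec_eval (Mu f) xs n"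


lemma rec_eval_deterministic: "rec_eval f xs y \<Longrightarrow> rec_eval f xs y' \<Longrightarrow> y' = y"
proof (induction arbitrary: y' rule: rec_eval.induct)
  case (comp xs gs ys f z)
  from comp.prems obtain ys' where
    *: "list_all2 (\<lambda>g y. rec_eval g xs y) gs ys'" "rec_eval f ys' y'"
    by cases
  have "ys' = ys"
    using comp.IH(1) *(1) by (auto simp: list_all2_conv_all_nth intro!: nth_equalityI)
  with *(2) comp.IH(2) show ?case by blast
next
  case (primrec_0 f xs y g)
  from primrec_0.prems show ?case by cases (fact primrec_0.IH)
next
  case (primrec_Suc f g n xs y z)
  from primrec_Suc.prems obtain u where "rec_eval (PrimRec f g) (n # xs) u" "rec_eval g (n # u # xs) y'"
    by cases
  with primrec_Suc.IH show ?case by blast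
next
  case (mu f n xs)
  from mu.prems have "rec_eval f (y' # xs) 0 \<and> (\<forall>k<y'. \<exists>y. rec_eval f (k # xs) (Suc y))"
    by cases blast
  then have *: "rec_eval f (y' # xs) 0" "\<forall>k<y'. \<exists>y. rec_eval f (k # xs) (Suc y)"
    by blast+
  show ?case
  proof (rule linorder_cases[of y' n])
    assume "y' < n"
    then obtain u where "\<forall>v. rec_eval f (y' # xs) v \<longrightarrow> v = Suc u" using mu.IH(2) by blast
    with *(1) show ?thesis by blast
  next
    assume "n < y'"
    then obtain u where "rec_eval f (n # xs) (Suc u)" using *(2) by blast
    with mu.IH(1) show ?thesis by blast
  qed
next
  case (zero xs)
  then show ?case by cases simp
next
  case (successor x)
  then show ?case by cases simp
next
  case (proj i xs)
  from proj.prems show ?case by cases simp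
qed


section \<open>Decidability\<close>

primrec encode_pform :: "(nat, nat) pform \<Rightarrow> nat"
  and encode_cform :: "(nat, nat) cform \<Rightarrow> nat"
where
  "encode_pform (Prop p) = prod_encode (0, p)"
| "encode_pform (PAnd \<phi> \<phi>') = prod_encode (1, prod_encode (encode_pform \<phi>, encode_pform \<phi>'))"
| "encode_pform (PNot \<phi>) = prod_encode (2, encode_pform \<phi>)"
| "encode_pform (Next \<phi>) = prod_encode (3, encode_pform \<phi>)"
| "encode_pform (Prev \<phi>) = prod_encode (4, encode_pform \<phi>)"
| "encode_pform (Until \<phi> \<phi>') = prod_encode (5, prod_encode (encode_pform \<phi>, encode_pform \<phi>'))"
| "encode_pform (Since \<phi> \<phi>') = prod_encode (6, prod_encode (encode_pform \<phi>, encode_pform \<phi>'))"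
| "encode_pform (Class r x \<psi>) =
     prod_encode (7, prod_encode (int_encode r, prod_encode (x, encode_cform \<psi>)))"
| "encode_cform (At x) = prod_encode (0, x)"
| "encode_cform (CAnd \<psi> \<psi>') = prod_encode (1, prod_encode (encode_cform \<psi>, encode_cform \<psi>'))"
| "encode_cform (CNot \<psi>) = prod_encode (2, encode_cform \<psi>)"
| "encode_cform (NextEq \<psi>) = prod_encode (3, encode_cform \<psi>)"
| "encode_cform (PrevEq \<psi>) = prod_encode (4, encode_cform \<psi>)"
| "encode_cform (UntilEq \<psi> \<psi>') = prod_encode (5, prod_encode (encode_cform \<psi>, encode_cform \<psi>'))"
| "encode_cform (SinceEq \<psi> \<psi>') = prod_encode (6, prod_encode (encode_cform \<psi>, encode_cform \<psi>'))"
| "encode_cform (Pos \<phi>) = prod_encode (7, encode_pform \<phi>)"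

fun encode_instance :: "nd_instance \<Rightarrow> nat" where
  "encode_instance (m, n, rs, \<phi>) =
     prod_encode (m, prod_encode (n, prod_encode (list_encode (map prod_encode rs), encode_pform \<phi>)))"

lemma encode_pform_inj: "encode_pform \<phi> = encode_pform \<phi>' \<Longrightarrow> \<phi> = \<phi>'"
  and encode_cform_inj: "encode_cform \<psi> = encode_cform \<psi>' \<Longrightarrow> \<psi> = \<psi>'"
proof (induction \<phi> and \<psi> arbitrary: \<phi>' and \<psi>')
  case (Prop _)
  then show ?case by (cases \<phi>') (auto simp: int_encode_eq)
next
  case (PAnd _ _)
  then show ?case by (cases \<phi>') (auto simp: int_encode_eq)
next
  case (PNot _)
  then show ?case by (cases \<phi>') (auto simp: int_encode_eq)
next
  case (Next _)
  then show ?case by (cases \<phi>') (auto simp: int_encode_eq)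
next
  case (Prev _)
  then show ?case by (cases \<phi>') (auto simp: int_encode_eq)
next
  case (Until _ _)
  then show ?case by (cases \<phi>') (auto simp: int_encode_eq)
next
  case (Since _ _)
  then show ?case by (cases \<phi>') (auto simp: int_encode_eq)
next
  case (Class _ _ _)
  then show ?case by (cases \<phi>') (auto simp: int_encode_eq)
next
  case (At _)
  then show ?case by (cases \<psi>') (auto simp: int_encode_eq)
next
  case (CAnd _ _)
  then show ?case by (cases \<psi>') (auto simp: int_encode_eq)
next
  case (CNot _)
  then show ?case by (cases \<psi>') (auto simp: int_encode_eq)
next
  case (NextEq _)
  then show ?case by (cases \<psi>') (auto simp: int_encode_eq)
next
  case (PrevEq _)
  then show ?case by (cases \<psi>') (auto simp: int_encode_eq)
next
  case (UntilEq _ _)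
  then show ?case by (cases \<psi>') (auto simp: int_encode_eq)
next
  case (SinceEq _ _)
  then show ?case by (cases \<psi>') (auto simp: int_encode_eq)
next
  case (Pos _)
  then show ?case by (cases \<psi>') (auto simp: int_encode_eq)
qed

lemma inj_encode_instance: "inj encode_instance"
proof (rule injI)
  fix x y :: nd_instance
  assume "encode_instance x = encode_instance y"
  then show "x = y"
    by (cases x, cases y)
      (auto simp: list_encode_eq inj_map_eq_map[OF inj_prod_encode] dest: encode_pform_inj)
qed


text \<open>The set \<open>I\<close> of admissible instances restricts the inputs: a decision procedure for \<open>Q\<close> on \<open>I\<close>
  must terminate with the correct answer (1 for yes, 0 for no) on every instance in \<open>I\<close>, and
  is not constrained on other inputs.\<close>

definition decidable_on :: "nd_instance set \<Rightarrow> (nd_instance \<Rightarrow> bool) \<Rightarrow> bool" where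
  "decidable_on I Q \<longleftrightarrow>
     (\<exists>f. \<forall>x\<in>I. rec_eval f [encode_instance x] (if Q x then 1 else 0))"

end

theory Submission
  imports Defs
begin

text \<open>
  Diagonalization over formulae. For every partial recursive function \<open>f\<close> there is a formula
  that, in conjunction with a fixed formula describing the number \<open>n\<close>, is satisfiable iff
  \<open>f n = 0\<close>. Given a decision procedure \<open>d\<close>, let \<open>f\<close> map the code \<open>e\<close> of a formula to the answer
  of \<open>d\<close> on the conjunction of that formula with the description of \<open>e\<close>. The formula for this
  \<open>f\<close>, conjoined with the description of its own code, refutes \<open>d\<close>.

  To express \<open>f\<close>, compile it to a nondeterministic counter program and let the positions of a word
  carry the steps of a run. Each counter has two nested attributes: the coarse one changes
  exactly when the counter is tested for zero, the fine one names a unit of the counter. Past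
  operators ensure that every decrement consumes a unit that was produced since the last test, so
  that a test of a nonzero counter can only lose units. With future operators one also demands
  that every unit is consumed before the next test, which makes the tests exact. Over infinite
  words this is replaced by a budget: increments draw on an extra counter, so the sum of all
  counters never increases, and the computation is repeated forever. As every wrong test lowers
  the sum, almost all repetitions are correct.
\<close>

section \<open>Counter programs for partial recursive functions\<close>

text \<open>Diagonalizing over formulae avoids a universal function and any coding of programs: all
  that must be computable is the map from the code of a formula to the code of an instance. This
  shapes the formulae. The description of the number must be the same for all programs and is built
  by recursion on the number. The signature of the instance is read off the code of the formula, so
  the equivalence with \<open>f\<close> has to hold over every suitable signature in which the
  formula is well-formed. The fine attribute lies above the coarse one because a class of the fine
  attribute then fixes both values. A unit is thereby tied to the period in which it was produced,
  and a change of the coarse value puts all older units out of reach without any look ahead. Both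
  satisfiability problems share the same runs. The size of the budget need not be known in advance:
  the filling may have any finite length, and the word chooses it.\<close>

text \<open>\<open>Fill\<close>, \<open>Start\<close> and \<open>Load\<close> do not occur in programs; they label the steps of a run that lead
  up to an execution of the program.\<close>

datatype op = Nop | Inc nat | Dec nat | Test nat | Fill | Start | Load

fun op_step :: "op \<Rightarrow> (nat \<Rightarrow> nat) \<Rightarrow> (nat \<Rightarrow> nat) \<Rightarrow> bool" where
  "op_step Nop \<sigma> \<sigma>' = (\<sigma>' = \<sigma>)"
| "op_step (Inc r) \<sigma> \<sigma>' = (\<sigma>' = \<sigma>(r := Suc (\<sigma> r)))"
| "op_step (Dec r) \<sigma> \<sigma>' = (0 < \<sigma> r \<and> \<sigma>' = \<sigma>(r := \<sigma> r - 1))"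
| "op_step (Test r) \<sigma> \<sigma>' = (\<sigma> r = 0 \<and> \<sigma>' = \<sigma>)"
| "op_step _ \<sigma> \<sigma>' = False"

datatype prog = Skip | Op op | Seq prog prog | Star prog

primrec sem :: "prog \<Rightarrow> (nat \<Rightarrow> nat) \<Rightarrow> (nat \<Rightarrow> nat) \<Rightarrow> bool" where
  "sem Skip = (=)"
| "sem (Op p) = op_step p"
| "sem (Seq a b) = sem a OO sem b"
| "sem (Star a) = (sem a)\<^sup>*\<^sup>*"

definition clean :: "nat \<Rightarrow> (nat \<Rightarrow> nat) \<Rightarrow> bool" where
  "clean b \<sigma> \<longleftrightarrow> (\<forall>r\<ge>b. \<sigma> r = 0)"

text \<open>The registers from \<open>b\<close> on are scratch space, empty before and after. The
  program must match the relation exactly, because both the existence of a run and the correctness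
  of every run are used later.\<close>

definition realizable :: "nat \<Rightarrow> ((nat \<Rightarrow> nat) \<Rightarrow> (nat \<Rightarrow> nat) \<Rightarrow> bool) \<Rightarrow> bool" where
  "realizable b Q \<longleftrightarrow>
     (\<exists>c. \<forall>\<sigma> \<sigma>'. clean b \<sigma> \<longrightarrow> (sem c \<sigma> \<sigma>' \<longleftrightarrow> Q \<sigma> \<sigma>')) \<and>
     (\<forall>\<sigma> \<sigma>'. clean b \<sigma> \<longrightarrow> Q \<sigma> \<sigma>' \<longrightarrow> clean b \<sigma>')"

section \<open>Closure properties of realizable relations\<close>

lemma realizableI:
  assumes "\<And>\<sigma> \<sigma>'. clean b \<sigma> \<Longrightarrow> sem c \<sigma> \<sigma>' \<longleftrightarrow> Q \<sigma> \<sigma>'"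
    and "\<And>\<sigma> \<sigma>'. clean b \<sigma> \<Longrightarrow> Q \<sigma> \<sigma>' \<Longrightarrow> clean b \<sigma>'"
  shows "realizable b Q"
  unfolding realizable_def using assms by blast

lemma realizable_cong:
  assumes "realizable b P" and "\<And>\<sigma> \<sigma>'. clean b \<sigma> \<Longrightarrow> P \<sigma> \<sigma>' \<longleftrightarrow> Q \<sigma> \<sigma>'"
  shows "realizable b Q"
  using assms unfolding realizable_def by metis

lemma realizable_seq:
  assumes "realizable b P" and "realizable b Q"
  shows "realizable b (P OO Q)"
proof -
  from assms obtain p q where p: "\<And>\<sigma> \<sigma>'. clean b \<sigma> \<Longrightarrow> sem p \<sigma> \<sigma>' \<longleftrightarrow> P \<sigma> \<sigma>'"
    and q: "\<And>\<sigma> \<sigma>'. clean b \<sigma> \<Longrightarrow> sem q \<sigma> \<sigma>' \<longleftrightarrow> Q \<sigma> \<sigma>'"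
    and P: "\<And>\<sigma> \<sigma>'. clean b \<sigma> \<Longrightarrow> P \<sigma> \<sigma>' \<Longrightarrow> clean b \<sigma>'"
    and Q: "\<And>\<sigma> \<sigma>'. clean b \<sigma> \<Longrightarrow> Q \<sigma> \<sigma>' \<Longrightarrow> clean b \<sigma>'"
    unfolding realizable_def by blast
  show ?thesis
    by (rule realizableI[of b "Seq p q"]; simp add: relcompp_apply) (use p q P Q in blast)+
qed

lemma relcompp_choice:
  "((\<lambda>\<sigma> \<sigma>'. \<exists>y. P \<sigma> y \<and> \<sigma>' = f \<sigma> y) OO Q) \<sigma> \<sigma>' \<longleftrightarrow> (\<exists>y. P \<sigma> y \<and> Q (f \<sigma> y) \<sigma>')"
  by (auto simp: relcompp_apply)

lemma relcompp_guard: "((\<lambda>\<sigma> \<sigma>'. P \<sigma> \<and> \<sigma>' = f \<sigma>) OO Q) \<sigma> \<sigma>' \<longleftrightarrow> P \<sigma> \<and> Q (f \<sigma>) \<sigma>'"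
  by (auto simp: relcompp_apply)

lemma relcompp_fun: "((\<lambda>\<sigma> \<sigma>'. \<sigma>' = f \<sigma>) OO Q) \<sigma> \<sigma>' \<longleftrightarrow> Q (f \<sigma>) \<sigma>'"
  by (auto simp: relcompp_apply)

lemma ex_flatten:
  "(\<exists>s. (\<exists>t. A t \<and> (\<exists>y. B t y \<and> C t y \<and> s = g t y)) \<and> u = h s) \<longleftrightarrow>
   (\<exists>t y. A t \<and> B t y \<and> C t y \<and> u = h (g t y))"
  by blast

lemma realizable_seq_fun:
  assumes "realizable b (\<lambda>\<sigma> \<sigma>'. \<sigma>' = f \<sigma>)" and "realizable b (\<lambda>\<sigma> \<sigma>'. \<sigma>' = g \<sigma>)"
    and "\<And>\<sigma>. clean b \<sigma> \<Longrightarrow> g (f \<sigma>) = h \<sigma>"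
  shows "realizable b (\<lambda>\<sigma> \<sigma>'. \<sigma>' = h \<sigma>)"
  by (rule realizable_cong[OF realizable_seq[OF assms(1,2)]]) (simp add: relcompp_apply assms(3))

lemma realizable_star:
  assumes "realizable b P"
  shows "realizable b P\<^sup>*\<^sup>*"
proof -
  from assms obtain p where p: "\<And>\<sigma> \<sigma>'. clean b \<sigma> \<Longrightarrow> sem p \<sigma> \<sigma>' \<longleftrightarrow> P \<sigma> \<sigma>'"
    and P: "\<And>\<sigma> \<sigma>'. clean b \<sigma> \<Longrightarrow> P \<sigma> \<sigma>' \<Longrightarrow> clean b \<sigma>'"
    unfolding realizable_def by blast
  have *: "P\<^sup>*\<^sup>* \<sigma> \<sigma>' \<Longrightarrow> clean b \<sigma> \<Longrightarrow> clean b \<sigma>' \<and> (sem p)\<^sup>*\<^sup>* \<sigma> \<sigma>'" for \<sigma> \<sigma>'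
    by (induction rule: rtranclp_induct) (auto simp: p dest: P intro: rtranclp.rtrancl_into_rtrancl)
  have **: "(sem p)\<^sup>*\<^sup>* \<sigma> \<sigma>' \<Longrightarrow> clean b \<sigma> \<Longrightarrow> clean b \<sigma>' \<and> P\<^sup>*\<^sup>* \<sigma> \<sigma>'" for \<sigma> \<sigma>'
    by (induction rule: rtranclp_induct) (auto simp: p dest: P intro: rtranclp.rtrancl_into_rtrancl)
  show ?thesis by (rule realizableI[of b "Star p"]) (use * ** in auto)
qed

lemma realizable_op:
  assumes "\<And>\<sigma> \<sigma>'. clean b \<sigma> \<Longrightarrow> op_step p \<sigma> \<sigma>' \<Longrightarrow> clean b \<sigma>'"
  shows "realizable b (op_step p)"
  by (rule realizableI[of b "Op p"]) (use assms in auto)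

lemma realizable_inc: "r < b \<Longrightarrow> realizable b (\<lambda>\<sigma> \<sigma>'. \<sigma>' = \<sigma>(r := Suc (\<sigma> r)))"
  by (rule realizable_cong[OF realizable_op[of b "Inc r"]]) (auto simp: clean_def)

lemma realizable_dec: "r < b \<Longrightarrow> realizable b (\<lambda>\<sigma> \<sigma>'. 0 < \<sigma> r \<and> \<sigma>' = \<sigma>(r := \<sigma> r - 1))"
  by (rule realizable_cong[OF realizable_op[of b "Dec r"]]) (auto simp: clean_def)

lemma realizable_test: "realizable b (\<lambda>\<sigma> \<sigma>'. \<sigma> r = 0 \<and> \<sigma>' = \<sigma>)"
  by (rule realizable_cong[OF realizable_op[of b "Test r"]]) (auto simp: clean_def)

lemma realizable_id: "realizable b (\<lambda>\<sigma> \<sigma>'. \<sigma>' = \<sigma>)"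
  by (rule realizable_cong[OF realizable_op[of b Nop]]) (auto simp: clean_def)

lemma realizable_fail: "realizable b (\<lambda>\<sigma> \<sigma>'. False)"
  by (rule realizable_cong[OF realizable_op[of b Fill]]) (auto simp: clean_def)

lemma rtranclp_guarded_fun:
  "(\<lambda>\<sigma> \<sigma>'. g \<sigma> \<and> \<sigma>' = h \<sigma>)\<^sup>*\<^sup>* \<sigma> \<sigma>' \<longleftrightarrow> (\<exists>k. \<sigma>' = (h ^^ k) \<sigma> \<and> (\<forall>i<k. g ((h ^^ i) \<sigma>)))"
  (is "?R\<^sup>*\<^sup>* \<sigma> \<sigma>' \<longleftrightarrow> ?K \<sigma>'")
proof
  assume "?R\<^sup>*\<^sup>* \<sigma> \<sigma>'"
  then show "?K \<sigma>'"
  proof (induction rule: rtranclp_induct)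
    case (step y z)
    then obtain k where "y = (h ^^ k) \<sigma>" "\<forall>i<k. g ((h ^^ i) \<sigma>)" by blast
    with step.hyps(2) show ?case by (intro exI[of _ "Suc k"]) (auto simp: less_Suc_eq)
  qed (auto intro: exI[of _ 0])
next
  assume "?K \<sigma>'"
  then obtain k where k: "\<sigma>' = (h ^^ k) \<sigma>" "\<forall>i<k. g ((h ^^ i) \<sigma>)" by blast
  then show "?R\<^sup>*\<^sup>* \<sigma> \<sigma>'"
  proof (induction k arbitrary: \<sigma>')
    case (Suc k)
    then have "?R\<^sup>*\<^sup>* \<sigma> ((h ^^ k) \<sigma>)" by auto
    moreover have "?R ((h ^^ k) \<sigma>) \<sigma>'" using Suc.prems by auto
    ultimately show ?case by (rule rtranclp.rtrancl_into_rtrancl)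
  qed simp
qed

text \<open>\<open>Star\<close> leaves the number of rounds open. The guard of each round bounds it
  by \<open>\<sigma> r\<close>, and the test behind the loop demands at least that many, so the
  nondeterminism disappears.\<close>

lemma realizable_while:
  assumes "realizable b (\<lambda>\<sigma> \<sigma>'. 0 < \<sigma> r \<and> \<sigma>' = h \<sigma>)"
    and h: "\<And>k \<sigma>. (h ^^ k) \<sigma> r = \<sigma> r - k"
  shows "realizable b (\<lambda>\<sigma> \<sigma>'. \<sigma>' = (h ^^ \<sigma> r) \<sigma>)"
proof (rule realizable_cong[OF realizable_seq[OF realizable_star[OF assms(1)] realizable_test[of b r]]])
  fix \<sigma> \<sigma>'
  show "((\<lambda>\<sigma> \<sigma>'. 0 < \<sigma> r \<and> \<sigma>' = h \<sigma>)\<^sup>*\<^sup>* OO (\<lambda>\<sigma> \<sigma>'. \<sigma> r = 0 \<and> \<sigma>' = \<sigma>)) \<sigma> \<sigma>' \<longleftrightarrow> \<sigma>' = (h ^^ \<sigma> r) \<sigma>"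
    (is "?L \<longleftrightarrow> ?R")
  proof
    assume ?L
    then obtain k where k: "\<sigma>' = (h ^^ k) \<sigma>" "\<forall>i<k. 0 < (h ^^ i) \<sigma> r" "(h ^^ k) \<sigma> r = 0"
      by (auto simp: relcompp_apply rtranclp_guarded_fun)
    from k(3) have "\<sigma> r \<le> k" by (simp add: h)
    moreover have "\<not> \<sigma> r < k" using k(2) by (auto simp: h)
    ultimately show ?R using k(1) by (simp add: le_antisym)
  next
    assume ?R
    then show ?L by (auto simp: relcompp_apply rtranclp_guarded_fun h intro!: exI[of _ "\<sigma> r"])
  qed
qed

lemma realizable_clear:
  assumes "r < b"
  shows "realizable b (\<lambda>\<sigma> \<sigma>'. \<sigma>' = \<sigma>(r := 0))"
proof -
  define h :: "(nat \<Rightarrow> nat) \<Rightarrow> nat \<Rightarrow> nat" where "h \<sigma> = \<sigma>(r := \<sigma> r - 1)" for \<sigma>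
  have h: "(h ^^ k) \<sigma> = \<sigma>(r := \<sigma> r - k)" for k \<sigma>
    by (induction k) (auto simp: h_def)
  have "realizable b (\<lambda>\<sigma> \<sigma>'. \<sigma>' = (h ^^ \<sigma> r) \<sigma>)"
    by (rule realizable_while) (use realizable_dec[OF assms] in \<open>auto simp: h h_def\<close>)
  then show ?thesis by (simp add: h)
qed

text \<open>This is how a program borrows \<open>k\<close> registers: they are empty on entry
  because the state is clean, and clearing them at the end makes it clean again.\<close>

lemma realizable_local:
  assumes "realizable (b + k) P"
  shows "realizable b (\<lambda>\<sigma> \<sigma>'. \<exists>\<sigma>''. P \<sigma> \<sigma>'' \<and> \<sigma>' = (\<lambda>r. if r < b then \<sigma>'' r else 0))"
proof -
  have clear: "realizable (b + k) (\<lambda>\<sigma> \<sigma>'. \<sigma>' = (\<lambda>r. if r < b + j then \<sigma> r else 0))" if "j \<le> k" for j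
    using that
  proof (induction "k - j" arbitrary: j)
    case 0
    then have "j = k" by simp
    then show ?case
      by (intro realizable_cong[OF realizable_id]) (auto simp: clean_def fun_eq_iff not_less, metis not_le)
  next
    case (Suc d)
    then have "d = k - Suc j" "Suc j \<le> k" "b + j < b + k" by auto
    then show ?case
      by (intro realizable_seq_fun[OF Suc.hyps(1) realizable_clear[of "b + j"]]) auto
  qed
  have "realizable (b + k) (P OO (\<lambda>\<sigma> \<sigma>'. \<sigma>' = (\<lambda>r. if r < b then \<sigma> r else 0)))"
    using realizable_seq[OF assms clear[of 0]] by simp
  then obtain c where "\<And>\<sigma> \<sigma>'. clean (b + k) \<sigma> \<Longrightarrow>
      sem c \<sigma> \<sigma>' \<longleftrightarrow> (P OO (\<lambda>\<sigma> \<sigma>'. \<sigma>' = (\<lambda>r. if r < b then \<sigma> r else 0))) \<sigma> \<sigma>'"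
    unfolding realizable_def by blast
  then show ?thesis by (intro realizableI[of b c]) (auto simp: clean_def relcompp_apply)
qed

text \<open>Moving a value destroys it. So the loop \<open>h\<close> pours \<open>r\<close> into
  \<open>q\<close> and into the scratch register \<open>b\<close> at once, and the loop
  \<open>h'\<close> pours \<open>b\<close> back into \<open>r\<close>.\<close>

lemma realizable_copy:
  assumes "r < b" "q < b" "q \<noteq> r"
  shows "realizable b (\<lambda>\<sigma> \<sigma>'. \<sigma>' = \<sigma>(q := \<sigma> r))"
proof -
  define h :: "(nat \<Rightarrow> nat) \<Rightarrow> nat \<Rightarrow> nat"
    where "h \<sigma> = \<sigma>(r := \<sigma> r - 1, q := Suc (\<sigma> q), b := Suc (\<sigma> b))" for \<sigma>
  define h' :: "(nat \<Rightarrow> nat) \<Rightarrow> nat \<Rightarrow> nat" where "h' \<sigma> = \<sigma>(b := \<sigma> b - 1, r := Suc (\<sigma> r))" for \<sigma>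
  have h: "(h ^^ k) \<sigma> = \<sigma>(r := \<sigma> r - k, q := \<sigma> q + k, b := \<sigma> b + k)" for k \<sigma>
    using assms by (induction k) (auto simp: h_def fun_eq_iff)
  have h': "(h' ^^ k) \<sigma> = \<sigma>(b := \<sigma> b - k, r := \<sigma> r + k)" for k \<sigma>
    using assms by (induction k) (auto simp: h'_def fun_eq_iff)
  have s1: "realizable (b + 1) (\<lambda>\<sigma> \<sigma>'. 0 < \<sigma> r \<and> \<sigma>' = h \<sigma>)"
    by (rule realizable_cong[OF realizable_seq[OF realizable_dec[of r "b + 1"]
          realizable_seq[OF realizable_inc[of q "b + 1"] realizable_inc[of b "b + 1"]]]])
      (use assms in \<open>auto simp: h_def relcompp_apply\<close>)
  have s2: "realizable (b + 1) (\<lambda>\<sigma> \<sigma>'. 0 < \<sigma> b \<and> \<sigma>' = h' \<sigma>)"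
    by (rule realizable_cong[OF realizable_seq[OF realizable_dec[of b "b + 1"] realizable_inc[of r "b + 1"]]])
      (use assms in \<open>auto simp: h'_def relcompp_apply\<close>)
  have 1: "realizable (b + 1) (\<lambda>\<sigma> \<sigma>'. \<sigma>' = (h ^^ \<sigma> r) \<sigma>)"
    by (rule realizable_while[OF s1]) (use assms in \<open>auto simp: h\<close>)
  have 2: "realizable (b + 1) (\<lambda>\<sigma> \<sigma>'. \<sigma>' = (h' ^^ \<sigma> b) \<sigma>)"
    by (rule realizable_while[OF s2]) (use assms in \<open>auto simp: h'\<close>)
  have "q < b + 1" using assms by simp
  note prog = realizable_local[OF realizable_seq[OF realizable_clear[OF this] realizable_seq[OF 1 2]]]
  show ?thesis
  proof (rule realizable_cong[OF prog])
    fix \<sigma> \<sigma>'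
    assume "clean b \<sigma>"
    then have "(\<lambda>x. if x < b then (h' ^^ (h ^^ (\<sigma>(q := 0)) r) (\<sigma>(q := 0)) b)
        ((h ^^ (\<sigma>(q := 0)) r) (\<sigma>(q := 0))) x else 0) = \<sigma>(q := \<sigma> r)"
      using assms by (auto simp: h h' clean_def)
    then show "(\<exists>\<sigma>''. ((\<lambda>\<sigma> \<sigma>'. \<sigma>' = \<sigma>(q := 0)) OO (\<lambda>\<sigma> \<sigma>'. \<sigma>' = (h ^^ \<sigma> r) \<sigma>) OO
        (\<lambda>\<sigma> \<sigma>'. \<sigma>' = (h' ^^ \<sigma> b) \<sigma>)) \<sigma> \<sigma>'' \<and> \<sigma>' = (\<lambda>r. if r < b then \<sigma>'' r else 0)) \<longleftrightarrow>
        \<sigma>' = \<sigma>(q := \<sigma> r)"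
      by (simp add: relcompp_apply del: fun_upd_apply)
  qed
qed

section \<open>Compilation of partial recursive functions\<close>

text \<open>An undefined value shows as the absence of a final state. The bound \<open>b\<close> is
  arbitrary so that a subprogram can be run on top of the working registers of its caller.\<close>

definition computable_by_prog :: "recf \<Rightarrow> bool" where
  "computable_by_prog f \<longleftrightarrow> (\<forall>rs q b. set rs \<subseteq> {..<b} \<longrightarrow> q < b \<longrightarrow> q \<notin> set rs \<longrightarrow>
     realizable b (\<lambda>\<sigma> \<sigma>'. \<exists>y. rec_eval f (map \<sigma> rs) y \<and> \<sigma>' = \<sigma>(q := y)))"

lemma computable_by_progD:
  assumes "computable_by_prog f" "set rs \<subseteq> {..<b}" "q < b" "q \<notin> set rs"
  shows "realizable b (\<lambda>\<sigma> \<sigma>'. \<exists>y. rec_eval f (map \<sigma> rs) y \<and> \<sigma>' = \<sigma>(q := y))"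
  using assms unfolding computable_by_prog_def by blast

inductive_cases rec_eval_ZeroE: "rec_eval Zero xs y"
inductive_cases rec_eval_SuccessorE: "rec_eval Successor xs y"
inductive_cases rec_eval_ProjE: "rec_eval (Proj i) xs y"
inductive_cases rec_eval_CompE: "rec_eval (Comp f gs) xs y"
inductive_cases rec_eval_PrimRec_0E: "rec_eval (PrimRec f g) (0 # xs) y"
inductive_cases rec_eval_PrimRec_SucE: "rec_eval (PrimRec f g) (Suc n # xs) y"
inductive_cases rec_eval_PrimRec_NilE: "rec_eval (PrimRec f g) [] y"
inductive_cases rec_eval_MuE: "rec_eval (Mu f) xs y"

lemma computable_by_prog_Zero: "computable_by_prog Zero"
  unfolding computable_by_prog_def
proof (intro allI impI)
  fix rs :: "nat list" and q b :: nat
  assume "q < b"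
  from realizable_clear[OF this]
  show "realizable b (\<lambda>\<sigma> \<sigma>'. \<exists>y. rec_eval Zero (map \<sigma> rs) y \<and> \<sigma>' = \<sigma>(q := y))"
    by (rule realizable_cong) (auto elim: rec_eval_ZeroE intro: rec_eval.zero)
qed

lemma computable_by_prog_Successor: "computable_by_prog Successor"
  unfolding computable_by_prog_def
proof (intro allI impI)
  fix rs :: "nat list" and q b :: nat
  assume rs: "set rs \<subseteq> {..<b}" "q < b" "q \<notin> set rs"
  show "realizable b (\<lambda>\<sigma> \<sigma>'. \<exists>y. rec_eval Successor (map \<sigma> rs) y \<and> \<sigma>' = \<sigma>(q := y))"
  proof (cases "\<exists>r. rs = [r]")
    case True
    then obtain r where [simp]: "rs = [r]" by blast
    with rs have "r < b" "q < b" "q \<noteq> r" by auto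
    from realizable_seq[OF realizable_copy[OF this] realizable_inc[OF \<open>q < b\<close>]]
    show ?thesis
      by (rule realizable_cong)
        (auto simp: relcompp_apply elim!: rec_eval_SuccessorE intro: rec_eval.successor)
  next
    case False
    show ?thesis
      by (rule realizable_cong[OF realizable_fail]) (use False in \<open>auto elim!: rec_eval_SuccessorE\<close>)
  qed
qed

lemma computable_by_prog_Proj: "computable_by_prog (Proj i)"
  unfolding computable_by_prog_def
proof (intro allI impI)
  fix rs :: "nat list" and q b :: nat
  assume rs: "set rs \<subseteq> {..<b}" "q < b" "q \<notin> set rs"
  show "realizable b (\<lambda>\<sigma> \<sigma>'. \<exists>y. rec_eval (Proj i) (map \<sigma> rs) y \<and> \<sigma>' = \<sigma>(q := y))"
  proof (cases "i < length rs")
    case True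
    then have "rs ! i \<in> set rs" by simp
    with rs have "rs ! i < b" "q < b" "q \<noteq> rs ! i" by auto
    from realizable_copy[OF this] show ?thesis
      by (rule realizable_cong)
        (use True rec_eval.proj[of i "map _ rs"] in \<open>auto elim!: rec_eval_ProjE\<close>)
  next
    case False
    show ?thesis
      by (rule realizable_cong[OF realizable_fail]) (use False in \<open>auto elim!: rec_eval_ProjE\<close>)
  qed
qed

definition upds :: "nat \<Rightarrow> nat list \<Rightarrow> (nat \<Rightarrow> nat) \<Rightarrow> nat \<Rightarrow> nat" where
  "upds s ys \<sigma> = (\<lambda>r. if s \<le> r \<and> r < s + length ys then ys ! (r - s) else \<sigma> r)"

lemma upds_Nil: "upds s [] \<sigma> = \<sigma>"
  by (auto simp: upds_def)

lemma upds_Cons: "upds (Suc s) ys (\<sigma>(s := y)) = upds s (y # ys) \<sigma>"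
  by (auto simp: upds_def fun_eq_iff nth_Cons')

lemma map_upds: "map (upds s ys \<sigma>) [s..<s + length ys] = ys"
  by (auto simp: upds_def intro: nth_equalityI)

text \<open>The results go into consecutive registers above those in \<open>rs\<close>, so the
  arguments are intact when the next function is evaluated.\<close>

lemma realizable_args:
  assumes "\<And>g. g \<in> set gs \<Longrightarrow> computable_by_prog g"
    and "set rs \<subseteq> {..<s}" "s + length gs \<le> b"
  shows "realizable b (\<lambda>\<sigma> \<sigma>'. \<exists>ys. list_all2 (\<lambda>g y. rec_eval g (map \<sigma> rs) y) gs ys \<and> \<sigma>' = upds s ys \<sigma>)"
  using assms
proof (induction gs arbitrary: s)
  case Nil
  show ?case by (rule realizable_cong[OF realizable_id]) (auto simp: upds_Nil)
next
  case (Cons g gs)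
  have g: "realizable b (\<lambda>\<sigma> \<sigma>'. \<exists>y. rec_eval g (map \<sigma> rs) y \<and> \<sigma>' = \<sigma>(s := y))"
    by (rule computable_by_progD) (use Cons.prems in auto)
  have gs: "realizable b (\<lambda>\<sigma> \<sigma>'. \<exists>ys. list_all2 (\<lambda>g y. rec_eval g (map \<sigma> rs) y) gs ys \<and> \<sigma>' = upds (Suc s) ys \<sigma>)"
    by (rule Cons.IH) (use Cons.prems in auto)
  have "s \<notin> set rs" using Cons.prems by auto
  then show ?case
    by (intro realizable_cong[OF realizable_seq[OF g gs]])
      (auto simp: relcompp_choice list_all2_Cons1 upds_Cons simp del: fun_upd_apply)
qed

lemma computable_by_prog_Comp:
  assumes f: "computable_by_prog f" and gs: "\<And>g. g \<in> set gs \<Longrightarrow> computable_by_prog g"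
  shows "computable_by_prog (Comp f gs)"
  unfolding computable_by_prog_def
proof (intro allI impI)
  fix rs :: "nat list" and q b :: nat
  assume rs: "set rs \<subseteq> {..<b}" "q < b" "q \<notin> set rs"
  define k where "k = length gs"
  have 1: "realizable (b + k) (\<lambda>\<sigma> \<sigma>'. \<exists>ys. list_all2 (\<lambda>g y. rec_eval g (map \<sigma> rs) y) gs ys \<and> \<sigma>' = upds b ys \<sigma>)"
    by (rule realizable_args[OF gs]) (use rs in \<open>auto simp: k_def\<close>)
  have 2: "realizable (b + k) (\<lambda>\<sigma> \<sigma>'. \<exists>y. rec_eval f (map \<sigma> [b..<b + k]) y \<and> \<sigma>' = \<sigma>(q := y))"
    by (rule computable_by_progD[OF f]) (use rs in auto)
  show "realizable b (\<lambda>\<sigma> \<sigma>'. \<exists>y. rec_eval (Comp f gs) (map \<sigma> rs) y \<and> \<sigma>' = \<sigma>(q := y))"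
  proof (rule realizable_cong[OF realizable_local[OF realizable_seq[OF 1 2]]])
    fix \<sigma> \<sigma>'
    assume "clean b \<sigma>"
    then have res: "(\<lambda>r. if r < b then ((upds b ys \<sigma>)(q := y)) r else 0) = \<sigma>(q := y)" for ys y
      using rs by (auto simp: clean_def fun_eq_iff upds_def)
    have args: "map (upds b ys \<sigma>) [b..<b + k] = ys" if "list_all2 (\<lambda>g. rec_eval g (map \<sigma> rs)) gs ys" for ys
      using map_upds list_all2_lengthD[OF that] by (simp add: k_def)
    have comp: "rec_eval (Comp f gs) (map \<sigma> rs) y \<longleftrightarrow>
        (\<exists>ys. list_all2 (\<lambda>g. rec_eval g (map \<sigma> rs)) gs ys \<and> rec_eval f ys y)" for y
      by (auto elim: rec_eval_CompE intro: rec_eval.comp)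
    show "(\<exists>\<sigma>''. ((\<lambda>\<sigma> \<sigma>'. \<exists>ys. list_all2 (\<lambda>g. rec_eval g (map \<sigma> rs)) gs ys \<and> \<sigma>' = upds b ys \<sigma>) OO
         (\<lambda>\<sigma> \<sigma>'. \<exists>y. rec_eval f (map \<sigma> [b..<b + k]) y \<and> \<sigma>' = \<sigma>(q := y))) \<sigma> \<sigma>'' \<and>
         \<sigma>' = (\<lambda>r. if r < b then \<sigma>'' r else 0)) \<longleftrightarrow>
       (\<exists>y. rec_eval (Comp f gs) (map \<sigma> rs) y \<and> \<sigma>' = \<sigma>(q := y))" (is "?L \<longleftrightarrow> ?R")
    proof (intro iffI)
      assume ?L
      then obtain ys y where ys: "list_all2 (\<lambda>g. rec_eval g (map \<sigma> rs)) gs ys"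
        "rec_eval f (map (upds b ys \<sigma>) [b..<b + k]) y"
        "\<sigma>' = (\<lambda>r. if r < b then ((upds b ys \<sigma>)(q := y)) r else 0)"
        by (auto simp: relcompp_apply simp del: fun_upd_apply)
      from ys(2) have "rec_eval f ys y" unfolding args[OF ys(1)] .
      with comp ys(1,3) show ?R unfolding res by blast
    next
      assume ?R
      then obtain ys y where "list_all2 (\<lambda>g. rec_eval g (map \<sigma> rs)) gs ys" "rec_eval f ys y" "\<sigma>' = \<sigma>(q := y)"
        using comp by blast
      then show ?L
        by (intro exI[of _ "(upds b ys \<sigma>)(q := y)"]) (auto simp: relcompp_choice res args simp del: fun_upd_apply, metis args)
    qed
  qed
qed

lemma computable_by_prog_PrimRec:
  assumes f: "computable_by_prog f" and g: "computable_by_prog g"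
  shows "computable_by_prog (PrimRec f g)"
  unfolding computable_by_prog_def
proof (intro allI impI)
  fix rs :: "nat list" and q b :: nat
  assume rs: "set rs \<subseteq> {..<b}" "q < b" "q \<notin> set rs"
  show "realizable b (\<lambda>\<sigma> \<sigma>'. \<exists>y. rec_eval (PrimRec f g) (map \<sigma> rs) y \<and> \<sigma>' = \<sigma>(q := y))"
  proof (cases rs)
    case Nil
    then show ?thesis
      by (intro realizable_cong[OF realizable_fail]) (auto elim: rec_eval_PrimRec_NilE)
  next
    case (Cons n ms)
    with rs have n: "n < b" "n \<noteq> q" and ms: "set ms \<subseteq> {..<b}" "q \<notin> set ms" by auto
    have fresh: "b + j \<notin> set ms" "b \<notin> set ms" "Suc b \<notin> set ms" "Suc (Suc b) \<notin> set ms" for j using ms by auto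
    \<comment> \<open>Working registers: \<open>b\<close> counts the rounds done,
      \<open>b + 1\<close> holds the current value, \<open>b + 2\<close> the result of
      \<open>g\<close>, \<open>b + 3\<close> the rounds left. The result needs its own register
      since \<open>b + 1\<close> is an argument of \<open>g\<close>.\<close>
    define body where "body = (\<lambda>\<sigma> \<sigma>'. \<exists>z. (0 < \<sigma> (b + 3) \<and> rec_eval g (\<sigma> b # \<sigma> (b + 1) # map \<sigma> ms) z) \<and>
      \<sigma>' = \<sigma>(b + 3 := \<sigma> (b + 3) - 1, b + 1 := z, b + 2 := 0, b := Suc (\<sigma> b)))"
    have init: "realizable (b + 4) (\<lambda>\<sigma> \<sigma>'. \<exists>y. rec_eval f (map \<sigma> ms) y \<and> \<sigma>' = \<sigma>(b + 3 := \<sigma> n, b + 1 := y))"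
    proof -
      have 1: "realizable (b + 4) (\<lambda>\<sigma> \<sigma>'. \<sigma>' = \<sigma>(b + 3 := \<sigma> n))"
        by (rule realizable_copy) (use n in auto)
      have 2: "realizable (b + 4) (\<lambda>\<sigma> \<sigma>'. \<exists>y. rec_eval f (map \<sigma> ms) y \<and> \<sigma>' = \<sigma>(b + 1 := y))"
        by (rule computable_by_progD[OF f]) (use ms fresh in auto)
      show ?thesis
        by (rule realizable_cong[OF realizable_seq[OF 1 2]])
          (auto simp: relcompp_apply fresh simp del: fun_upd_apply)
    qed
    have "realizable (b + 4) body"
    proof -
      have 1: "realizable (b + 4) (\<lambda>\<sigma> \<sigma>'. 0 < \<sigma> (b + 3) \<and> \<sigma>' = \<sigma>(b + 3 := \<sigma> (b + 3) - 1))"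
        by (rule realizable_dec) simp
      have 2: "realizable (b + 4) (\<lambda>\<sigma> \<sigma>'. \<exists>y. rec_eval g (map \<sigma> (b # (b + 1) # ms)) y \<and> \<sigma>' = \<sigma>(b + 2 := y))"
        by (rule computable_by_progD[OF g]) (use ms fresh in auto)
      have 3: "realizable (b + 4) (\<lambda>\<sigma> \<sigma>'. \<sigma>' = \<sigma>(b + 1 := \<sigma> (b + 2)))"
        by (rule realizable_copy) auto
      have 4: "realizable (b + 4) (\<lambda>\<sigma> \<sigma>'. \<sigma>' = \<sigma>(b + 2 := 0))"
        by (rule realizable_clear) auto
      have 5: "realizable (b + 4) (\<lambda>\<sigma> \<sigma>'. \<sigma>' = \<sigma>(b := Suc (\<sigma> b)))"
        by (rule realizable_inc) auto
      have upd: "(\<sigma>(b + 3 := u, b + 2 := z))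
          (b + 1 := (\<sigma>(b + 3 := u, b + 2 := z)) (b + 2), b + 2 := 0,
           b := Suc (((\<sigma>(b + 3 := u, b + 2 := z))
             (b + 1 := (\<sigma>(b + 3 := u, b + 2 := z)) (b + 2), b + 2 := 0)) b)) =
          \<sigma>(b + 3 := u, b + 1 := z, b + 2 := 0, b := Suc (\<sigma> b))" for \<sigma> :: "nat \<Rightarrow> nat" and u z
        by (auto simp: fun_eq_iff)
      have args: "map (\<sigma>(b + 3 := u)) (b # (b + 1) # ms) = \<sigma> b # \<sigma> (b + 1) # map \<sigma> ms" for \<sigma> :: "nat \<Rightarrow> nat" and u
        using fresh by auto
      show ?thesis unfolding body_def
        by (rule realizable_cong[OF realizable_seq[OF 1 realizable_seq[OF 2 realizable_seq[OF 3 realizable_seq[OF 4 5]]]]])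
          (simp only: relcompp_guard relcompp_choice relcompp_fun args upd ex_simps conj_assoc)
    qed
    from realizable_seq[OF init realizable_seq[OF realizable_star[OF this] realizable_seq[OF
          realizable_test[of "b + 4" "b + 3"] realizable_copy[of "b + 1" "b + 4" q]]]] rs
    have prog: "realizable (b + 4) ((\<lambda>\<sigma> \<sigma>'. \<exists>y. rec_eval f (map \<sigma> ms) y \<and> \<sigma>' = \<sigma>(b + 3 := \<sigma> n, b + 1 := y)) OO
        body\<^sup>*\<^sup>* OO (\<lambda>\<sigma> \<sigma>'. \<sigma> (b + 3) = 0 \<and> \<sigma>' = \<sigma>) OO (\<lambda>\<sigma> \<sigma>'. \<sigma>' = \<sigma>(q := \<sigma> (b + 1))))"
      by auto
    show ?thesis
    proof (rule realizable_cong[OF realizable_local[OF prog]])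
      fix \<sigma> \<sigma>'
      assume "clean b \<sigma>"
      then have \<sigma>: "\<sigma> r = 0" if "r \<ge> b" for r using that by (auto simp: clean_def)
      define st where "st k y = \<sigma>(b := k, b + 1 := y, b + 2 := 0, b + 3 := \<sigma> n - k)" for k y
      have st0: "\<sigma>(b + 3 := \<sigma> n, b + 1 := y) = st 0 y" for y
        using \<sigma> by (auto simp: st_def fun_eq_iff)
      have body: "body (st k y) \<tau> \<longleftrightarrow> (\<exists>z. k < \<sigma> n \<and> rec_eval g (k # y # map \<sigma> ms) z \<and> \<tau> = st (Suc k) z)" for k y \<tau>
      proof -
        have upd: "(st k y)(b + 3 := \<sigma> n - k - 1, b + 1 := z, b + 2 := 0, b := Suc k) = st (Suc k) z" for z
          by (auto simp: st_def fun_eq_iff)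
        have eqs: "map (st k y) ms = map \<sigma> ms" "st k y b = k" "st k y (b + 1) = y" "st k y (b + 3) = \<sigma> n - k"
          using fresh by (auto simp: st_def)
        show ?thesis unfolding body_def eqs upd by auto
      qed
      have loop: "body\<^sup>*\<^sup>* (st 0 y0) \<tau> \<longleftrightarrow>
          (\<exists>k y. k \<le> \<sigma> n \<and> rec_eval (PrimRec f g) (k # map \<sigma> ms) y \<and> \<tau> = st k y)" (is "_ \<longleftrightarrow> ?I \<tau>")
        if y0: "rec_eval f (map \<sigma> ms) y0" for y0 \<tau>
      proof
        assume "body\<^sup>*\<^sup>* (st 0 y0) \<tau>"
        then show "?I \<tau>"
        proof (induction rule: rtranclp_induct)
          case base
          show ?case using rec_eval.primrec_0[OF y0] by blast
        next
          case (step \<tau> \<tau>')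
          then obtain k y z where "rec_eval (PrimRec f g) (k # map \<sigma> ms) y" "k < \<sigma> n"
            "rec_eval g (k # y # map \<sigma> ms) z" "\<tau>' = st (Suc k) z"
            by (auto simp: body)
          then show ?case by (intro exI[of _ "Suc k"] exI[of _ z]) (auto intro: rec_eval.primrec_Suc)
        qed
      next
        assume "?I \<tau>"
        then obtain k y where "k \<le> \<sigma> n" "rec_eval (PrimRec f g) (k # map \<sigma> ms) y" "\<tau> = st k y" by blast
        then show "body\<^sup>*\<^sup>* (st 0 y0) \<tau>"
        proof (induction k arbitrary: y \<tau>)
          case 0
          then have "y = y0" using y0 by (auto elim: rec_eval_PrimRec_0E dest: rec_eval_deterministic)
          then show ?case using 0 by simp
        next
          case (Suc k)
          then obtain u where u: "rec_eval (PrimRec f g) (k # map \<sigma> ms) u" "rec_eval g (k # u # map \<sigma> ms) y"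
            by (auto elim: rec_eval_PrimRec_SucE)
          have "body\<^sup>*\<^sup>* (st 0 y0) (st k u)" using Suc.IH[of u] u(1) Suc.prems(1) by simp
          moreover have "body (st k u) \<tau>" using Suc.prems u(2) by (auto simp: body)
          ultimately show ?case by (meson rtranclp.rtrancl_into_rtrancl)
        qed
      qed
      have res: "(\<lambda>r. if r < b then ((st k y)(q := st k y (b + 1))) r else 0) = \<sigma>(q := y)" for k y
        using \<sigma> rs by (auto simp: st_def fun_eq_iff)
      have st3: "st k y (b + 3) = \<sigma> n - k" for k y by (simp add: st_def)
      \<comment> \<open>The program runs \<open>f\<close> before the loop, so a value of the
        recursion must entail a value of \<open>f\<close>.\<close>
      have defined: "\<exists>y0. rec_eval f xs y0" if "rec_eval (PrimRec f g) (k # xs) y" for k xs y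
        using that by (induction k arbitrary: y) (auto elim: rec_eval_PrimRec_0E rec_eval_PrimRec_SucE)
      have "(\<exists>\<sigma>''. ((\<lambda>\<sigma> \<sigma>'. \<exists>y. rec_eval f (map \<sigma> ms) y \<and> \<sigma>' = \<sigma>(b + 3 := \<sigma> n, b + 1 := y)) OO
          body\<^sup>*\<^sup>* OO (\<lambda>\<sigma> \<sigma>'. \<sigma> (b + 3) = 0 \<and> \<sigma>' = \<sigma>) OO (\<lambda>\<sigma> \<sigma>'. \<sigma>' = \<sigma>(q := \<sigma> (b + 1)))) \<sigma> \<sigma>'' \<and>
          \<sigma>' = (\<lambda>r. if r < b then \<sigma>'' r else 0)) \<longleftrightarrow>
        (\<exists>y0. rec_eval f (map \<sigma> ms) y0 \<and> (\<exists>\<tau>. body\<^sup>*\<^sup>* (st 0 y0) \<tau> \<and> \<tau> (b + 3) = 0 \<and>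
          \<sigma>' = (\<lambda>r. if r < b then (\<tau>(q := \<tau> (b + 1))) r else 0)))"
        unfolding relcompp_choice st0 relcompp_apply by blast
      also have "\<dots> \<longleftrightarrow> (\<exists>y. rec_eval (PrimRec f g) (map \<sigma> rs) y \<and> \<sigma>' = \<sigma>(q := y))"
        (is "?L \<longleftrightarrow> ?R")
      proof
        assume ?L
        then obtain y0 \<tau> where \<tau>: "rec_eval f (map \<sigma> ms) y0" "body\<^sup>*\<^sup>* (st 0 y0) \<tau>" "\<tau> (b + 3) = 0"
          "\<sigma>' = (\<lambda>r. if r < b then (\<tau>(q := \<tau> (b + 1))) r else 0)"
          by blast
        from \<tau>(2) obtain k y where k: "k \<le> \<sigma> n" "rec_eval (PrimRec f g) (k # map \<sigma> ms) y" "\<tau> = st k y"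
          unfolding loop[OF \<tau>(1)] by blast
        then have "k = \<sigma> n" using \<tau>(3) st3 by simp
        with k \<tau>(4) res show ?R by (auto simp: Cons simp del: fun_upd_apply)
      next
        assume ?R
        then obtain y where y: "rec_eval (PrimRec f g) (\<sigma> n # map \<sigma> ms) y" "\<sigma>' = \<sigma>(q := y)"
          by (auto simp: Cons)
        from defined[OF y(1)] obtain y0 where y0: "rec_eval f (map \<sigma> ms) y0" by blast
        then have "body\<^sup>*\<^sup>* (st 0 y0) (st (\<sigma> n) y)" using y(1) loop by blast
        with y0 y(2) st3[of "\<sigma> n" y] res[of "\<sigma> n" y] show ?L by (metis diff_self_eq_0)
      qed
      finally show "(\<exists>\<sigma>''. ((\<lambda>\<sigma> \<sigma>'. \<exists>y. rec_eval f (map \<sigma> ms) y \<and> \<sigma>' = \<sigma>(b + 3 := \<sigma> n, b + 1 := y)) OO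
          body\<^sup>*\<^sup>* OO (\<lambda>\<sigma> \<sigma>'. \<sigma> (b + 3) = 0 \<and> \<sigma>' = \<sigma>) OO (\<lambda>\<sigma> \<sigma>'. \<sigma>' = \<sigma>(q := \<sigma> (b + 1)))) \<sigma> \<sigma>'' \<and>
          \<sigma>' = (\<lambda>r. if r < b then \<sigma>'' r else 0)) \<longleftrightarrow>
        (\<exists>y. rec_eval (PrimRec f g) (map \<sigma> rs) y \<and> \<sigma>' = \<sigma>(q := y))" .
    qed
  qed
qed

lemma computable_by_prog_Mu:
  assumes f: "computable_by_prog f"
  shows "computable_by_prog (Mu f)"
  unfolding computable_by_prog_def
proof (intro allI impI)
  fix rs :: "nat list" and q b :: nat
  assume rs: "set rs \<subseteq> {..<b}" "q < b" "q \<notin> set rs"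
  have fresh: "b + j \<notin> set rs" "Suc b \<notin> set rs" "b \<notin> set rs" for j using rs by auto
  have f': "realizable (b + 2) (\<lambda>\<sigma> \<sigma>'. \<exists>y. rec_eval f (map \<sigma> (b # rs)) y \<and> \<sigma>' = \<sigma>(b + 1 := y))"
    by (rule computable_by_progD[OF f]) (use rs fresh in auto)
  \<comment> \<open>Register \<open>b\<close> holds the candidate and \<open>b + 1\<close> the value
    of \<open>f\<close> there. A decrement of \<open>b + 1\<close> blocks on the value 0 and thus
    enforces \<open>Suc v\<close>; the test behind the loop enforces the value 0 at the candidate
    returned.\<close>
  define body where "body = (\<lambda>\<sigma> \<sigma>'. \<exists>v. rec_eval f (\<sigma> b # map \<sigma> rs) (Suc v) \<and>
      \<sigma>' = \<sigma>(b + 1 := 0, b := Suc (\<sigma> b)))"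
  have "realizable (b + 2) body"
  proof -
    have 2: "realizable (b + 2) (\<lambda>\<sigma> \<sigma>'. 0 < \<sigma> (b + 1) \<and> \<sigma>' = \<sigma>(b + 1 := \<sigma> (b + 1) - 1))"
      by (rule realizable_dec) simp
    have 3: "realizable (b + 2) (\<lambda>\<sigma> \<sigma>'. \<sigma>' = \<sigma>(b + 1 := 0))"
      by (rule realizable_clear) auto
    have 4: "realizable (b + 2) (\<lambda>\<sigma> \<sigma>'. \<sigma>' = \<sigma>(b := Suc (\<sigma> b)))"
      by (rule realizable_inc) auto
    have args: "map \<sigma> (b # rs) = \<sigma> b # map \<sigma> rs" for \<sigma> :: "nat \<Rightarrow> nat"
      by simp
    have upd: "(\<sigma>(b + 1 := y))(b + 1 := u, b + 1 := 0, b := Suc (((\<sigma>(b + 1 := y))(b + 1 := u, b + 1 := 0)) b)) =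
        \<sigma>(b + 1 := 0, b := Suc (\<sigma> b))" for \<sigma> :: "nat \<Rightarrow> nat" and u y
      by simp
    show ?thesis unfolding body_def
      by (rule realizable_cong[OF realizable_seq[OF f' realizable_seq[OF 2 realizable_seq[OF 3 4]]]])
        (simp only: relcompp_guard relcompp_choice relcompp_fun upd args, metis Suc_pred fun_upd_same zero_less_Suc)
  qed
  from realizable_seq[OF realizable_star[OF this] realizable_seq[OF f' realizable_seq[OF
        realizable_test[of "b + 2" "b + 1"] realizable_copy[of b "b + 2" q]]]] rs
  have prog: "realizable (b + 2) (body\<^sup>*\<^sup>* OO (\<lambda>\<sigma> \<sigma>'. \<exists>y. rec_eval f (map \<sigma> (b # rs)) y \<and> \<sigma>' = \<sigma>(b + 1 := y)) OO
      (\<lambda>\<sigma> \<sigma>'. \<sigma> (b + 1) = 0 \<and> \<sigma>' = \<sigma>) OO (\<lambda>\<sigma> \<sigma>'. \<sigma>' = \<sigma>(q := \<sigma> b)))"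
    by auto
  show "realizable b (\<lambda>\<sigma> \<sigma>'. \<exists>y. rec_eval (Mu f) (map \<sigma> rs) y \<and> \<sigma>' = \<sigma>(q := y))"
  proof (rule realizable_cong[OF realizable_local[OF prog]])
    fix \<sigma> \<sigma>'
    assume "clean b \<sigma>"
    then have \<sigma>: "\<sigma> r = 0" if "r \<ge> b" for r using that by (auto simp: clean_def)
    define st where "st k = \<sigma>(b := k)" for k
    have \<sigma>0: "\<sigma> = st 0" using \<sigma>[of b] by (auto simp: st_def)
    have st_simps: "map (st k) rs = map \<sigma> rs" "st k b = k" for k
      using fresh by (auto simp: st_def)
    have body: "body (st k) \<tau> \<longleftrightarrow> (\<exists>v. rec_eval f (k # map \<sigma> rs) (Suc v)) \<and> \<tau> = st (Suc k)" for k \<tau>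
    proof -
      have "(st k)(b + 1 := 0, b := Suc k) = st (Suc k)"
        using \<sigma> by (auto simp: st_def fun_eq_iff)
      then show ?thesis by (auto simp: body_def st_simps)
    qed
    have loop: "body\<^sup>*\<^sup>* (st 0) \<tau> \<longleftrightarrow> (\<exists>k. (\<forall>j<k. \<exists>v. rec_eval f (j # map \<sigma> rs) (Suc v)) \<and> \<tau> = st k)"
      (is "_ \<longleftrightarrow> ?I \<tau>") for \<tau>
    proof
      assume "body\<^sup>*\<^sup>* (st 0) \<tau>"
      then show "?I \<tau>"
      proof (induction rule: rtranclp_induct)
        case base
        show ?case by blast
      next
        case (step \<tau> \<tau>')
        then obtain k where "\<forall>j<k. \<exists>v. rec_eval f (j # map \<sigma> rs) (Suc v)" "\<tau> = st k" by blast
        with step.hyps(2) show ?case by (intro exI[of _ "Suc k"]) (auto simp: body less_Suc_eq)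
      qed
    next
      assume "?I \<tau>"
      then obtain k where "\<forall>j<k. \<exists>v. rec_eval f (j # map \<sigma> rs) (Suc v)" "\<tau> = st k" by blast
      then show "body\<^sup>*\<^sup>* (st 0) \<tau>"
      proof (induction k arbitrary: \<tau>)
        case (Suc k)
        then have "body\<^sup>*\<^sup>* (st 0) (st k)" "body (st k) \<tau>" by (auto simp: body)
        then show ?case by (meson rtranclp.rtrancl_into_rtrancl)
      qed simp
    qed
    have res: "(\<lambda>r. if r < b then (((st k)(b + 1 := y))(q := ((st k)(b + 1 := y)) b)) r else 0) = \<sigma>(q := k)" for k y
      using \<sigma> rs by (auto simp: st_def fun_eq_iff)
    have "(\<exists>\<sigma>''. (body\<^sup>*\<^sup>* OO (\<lambda>\<sigma> \<sigma>'. \<exists>y. rec_eval f (map \<sigma> (b # rs)) y \<and> \<sigma>' = \<sigma>(b + 1 := y)) OO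
      (\<lambda>\<sigma> \<sigma>'. \<sigma> (b + 1) = 0 \<and> \<sigma>' = \<sigma>) OO (\<lambda>\<sigma> \<sigma>'. \<sigma>' = \<sigma>(q := \<sigma> b))) \<sigma> \<sigma>'' \<and>
          \<sigma>' = (\<lambda>r. if r < b then \<sigma>'' r else 0)) \<longleftrightarrow>
        (\<exists>\<tau> y. body\<^sup>*\<^sup>* (st 0) \<tau> \<and> rec_eval f (\<tau> b # map \<tau> rs) y \<and> (\<tau>(b + 1 := y)) (b + 1) = 0 \<and>
          \<sigma>' = (\<lambda>r. if r < b then ((\<tau>(b + 1 := y))(q := (\<tau>(b + 1 := y)) b)) r else 0))"
      unfolding \<sigma>0[symmetric] relcompp_apply[of "body\<^sup>*\<^sup>*"] relcompp_choice relcompp_guard relcompp_fun list.map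
      by (rule ex_flatten)
    also have "\<dots> \<longleftrightarrow> (\<exists>k. (\<forall>j<k. \<exists>v. rec_eval f (j # map \<sigma> rs) (Suc v)) \<and>
        rec_eval f (k # map \<sigma> rs) 0 \<and> \<sigma>' = \<sigma>(q := k))"
      (is "?L \<longleftrightarrow> ?R")
    proof
      assume ?L
      then obtain \<tau> y where \<tau>: "body\<^sup>*\<^sup>* (st 0) \<tau>" "rec_eval f (\<tau> b # map \<tau> rs) y" "(\<tau>(b + 1 := y)) (b + 1) = 0"
        "\<sigma>' = (\<lambda>r. if r < b then ((\<tau>(b + 1 := y))(q := (\<tau>(b + 1 := y)) b)) r else 0)"
        by blast
      from \<tau>(1) obtain k where k: "\<forall>j<k. \<exists>v. rec_eval f (j # map \<sigma> rs) (Suc v)" "\<tau> = st k"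
        unfolding loop by blast
      from \<tau>(2,3,4) have "rec_eval f (k # map \<sigma> rs) 0" "\<sigma>' = \<sigma>(q := k)"
        unfolding k(2) res st_simps by simp_all
      with k(1) show ?R by blast
    next
      assume ?R
      then obtain k where "\<forall>j<k. \<exists>v. rec_eval f (j # map \<sigma> rs) (Suc v)" "rec_eval f (k # map \<sigma> rs) 0"
        "\<sigma>' = \<sigma>(q := k)" by blast
      then show ?L
        by (intro exI[of _ "st k"] exI[of _ 0]) (auto simp: loop res st_simps simp del: fun_upd_apply simp: fun_upd_same)
    qed
    also have "\<dots> \<longleftrightarrow> (\<exists>y. rec_eval (Mu f) (map \<sigma> rs) y \<and> \<sigma>' = \<sigma>(q := y))"
      by (auto intro: rec_eval.mu elim: rec_eval_MuE)
    finally show "(\<exists>\<sigma>''. (body\<^sup>*\<^sup>* OO (\<lambda>\<sigma> \<sigma>'. \<exists>y. rec_eval f (map \<sigma> (b # rs)) y \<and> \<sigma>' = \<sigma>(b + 1 := y)) OO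
      (\<lambda>\<sigma> \<sigma>'. \<sigma> (b + 1) = 0 \<and> \<sigma>' = \<sigma>) OO (\<lambda>\<sigma> \<sigma>'. \<sigma>' = \<sigma>(q := \<sigma> b))) \<sigma> \<sigma>'' \<and>
          \<sigma>' = (\<lambda>r. if r < b then \<sigma>'' r else 0)) \<longleftrightarrow>
        (\<exists>y. rec_eval (Mu f) (map \<sigma> rs) y \<and> \<sigma>' = \<sigma>(q := y))" .
  qed
qed

lemma computable_by_prog: "computable_by_prog f"
proof (induction f)
  case (Comp f gs)
  then show ?case by (intro computable_by_prog_Comp) auto
qed (auto intro: computable_by_prog_Zero computable_by_prog_Successor computable_by_prog_Proj
    computable_by_prog_PrimRec computable_by_prog_Mu)

text \<open>The test of register 1 turns the value 0 into termination. Register 0 is emptied at the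
  end so that the run can be repeated, since the next \<open>Start\<close> tests all
  registers.\<close>

lemma prog_for_zero_of_recf:
  "\<exists>c. \<forall>n \<sigma>'. sem c (\<lambda>r. if r = 0 then n else 0) \<sigma>' \<longleftrightarrow> rec_eval f [n] 0 \<and> \<sigma>' = (\<lambda>_. 0)"
proof -
  have 1: "realizable 2 (\<lambda>\<sigma> \<sigma>'. \<exists>y. rec_eval f (map \<sigma> [0]) y \<and> \<sigma>' = \<sigma>(1 := y))"
    by (rule computable_by_progD[OF computable_by_prog]) auto
  have "realizable 2 ((\<lambda>\<sigma> \<sigma>'. \<exists>y. rec_eval f (map \<sigma> [0]) y \<and> \<sigma>' = \<sigma>(1 := y)) OO
      (\<lambda>\<sigma> \<sigma>'. \<sigma> 1 = 0 \<and> \<sigma>' = \<sigma>) OO (\<lambda>\<sigma> \<sigma>'. \<sigma>' = \<sigma>(0 := 0)))"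
    by (intro realizable_seq 1 realizable_test realizable_clear) auto
  then obtain c where c: "\<And>\<sigma> \<sigma>'. clean 2 \<sigma> \<Longrightarrow> sem c \<sigma> \<sigma>' \<longleftrightarrow>
      (\<exists>y. rec_eval f [\<sigma> 0] y \<and> y = 0 \<and> \<sigma>' = \<sigma>(1 := y, 0 := 0))"
    unfolding realizable_def by (auto simp: relcompp_choice relcompp_apply)
  have "(\<lambda>r::nat. if r = 0 then n else 0::nat)(1 := 0, 0 := 0) = (\<lambda>_. 0)" for n
    by auto
  then show ?thesis by (intro exI[of _ c]) (auto simp: c clean_def simp del: fun_upd_apply)
qed


section \<open>Counters as data\<close>

text \<open>\<open>I\<close>, \<open>D\<close> and \<open>Z\<close> are the positions that
  increment, decrement and test one counter; \<open>x\<close> and \<open>y\<close> are its coarse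
  and fine data. The innermost condition rules out that the unit has been consumed in
  between.\<close>

definition tokens_past ::
  "enat \<Rightarrow> (nat \<Rightarrow> bool) \<Rightarrow> (nat \<Rightarrow> bool) \<Rightarrow> (nat \<Rightarrow> bool) \<Rightarrow> (nat \<Rightarrow> 'd) \<Rightarrow> (nat \<Rightarrow> 'd) \<Rightarrow> bool" where
  "tokens_past len I D Z x y \<longleftrightarrow>
     (\<forall>p. enat (Suc p) < len \<longrightarrow> (if Z p then \<forall>j\<le>p. x j \<noteq> x (Suc p) else x (Suc p) = x p)) \<and>
     (\<forall>p. enat p < len \<longrightarrow> D p \<longrightarrow> (\<exists>j<p. x j = x p \<and> y j = y p \<and> I j \<and>
        (\<forall>k. j < k \<and> k < p \<and> x k = x p \<and> y k = y p \<longrightarrow> \<not> D k)))"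

definition tokens_future ::
  "enat \<Rightarrow> (nat \<Rightarrow> bool) \<Rightarrow> (nat \<Rightarrow> bool) \<Rightarrow> (nat \<Rightarrow> 'd) \<Rightarrow> (nat \<Rightarrow> 'd) \<Rightarrow> bool" where
  "tokens_future len I D x y \<longleftrightarrow>
     (\<forall>p. enat p < len \<longrightarrow> I p \<longrightarrow> (\<exists>j>p. enat j < len \<and> x j = x p \<and> y j = y p \<and> D j \<and>
        (\<forall>k. p < k \<and> k < j \<and> x k = x p \<and> y k = y p \<longrightarrow> \<not> I k)))"

text \<open>\<open>v p\<close> is the value before the operation at \<open>p\<close>. A test sets
  the counter to 0 whatever it held, which is how units get lost; correctness of the tests is stated
  separately.\<close>

definition counts ::
  "enat \<Rightarrow> (nat \<Rightarrow> bool) \<Rightarrow> (nat \<Rightarrow> bool) \<Rightarrow> (nat \<Rightarrow> bool) \<Rightarrow> (nat \<Rightarrow> nat) \<Rightarrow> bool" where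
  "counts len I D Z v \<longleftrightarrow> v 0 = 0 \<and>
     (\<forall>p. enat p < len \<longrightarrow> (D p \<longrightarrow> 0 < v p) \<and>
        v (Suc p) = (if Z p then 0 else if I p then Suc (v p) else if D p then v p - 1 else v p))"

definition exclusive :: "enat \<Rightarrow> (nat \<Rightarrow> bool) \<Rightarrow> (nat \<Rightarrow> bool) \<Rightarrow> (nat \<Rightarrow> bool) \<Rightarrow> bool" where
  "exclusive len I D Z \<longleftrightarrow>
     (\<forall>p. enat p < len \<longrightarrow> \<not> (I p \<and> D p) \<and> \<not> (Z p \<and> I p) \<and> \<not> (Z p \<and> D p))"

text \<open>Right after a test the coarse value differs from all earlier ones, so \<open>x p\<close>
  is left for good: every later value is a copy of such a value or fresh again.\<close>

lemma tokens_past_same_segment: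
  assumes "tokens_past len I D Z x y" "enat q < len" "x p = x q" "p \<le> j" "j < q"
  shows "\<not> Z j"
proof
  assume Z: "Z j"
  have "enat q < len \<Longrightarrow> j < q \<Longrightarrow> x q \<noteq> x p"
  proof (induction q)
    case (Suc q)
    show ?case
    proof (cases "Z q")
      case True
      then show ?thesis using assms(1,4) Suc.prems unfolding tokens_past_def
        by (metis less_Suc_eq_le order_trans)
    next
      case False
      then have "x (Suc q) = x q" using assms(1) Suc.prems unfolding tokens_past_def by metis
      moreover have "j < q" using False Z Suc.prems(2) by (metis less_SucE)
      moreover have "enat q < len" using Suc.prems(1) by (metis enat_ord_simps(2) lessI order_less_trans)
      ultimately show ?thesis using Suc.IH by simp
    qed
  qed simp
  with assms show False by simp
qed

definition seg :: "(nat \<Rightarrow> bool) \<Rightarrow> nat \<Rightarrow> nat set" where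
  "seg Z p = {q. q < p \<and> (\<forall>j. q \<le> j \<and> j < p \<longrightarrow> \<not> Z j)}"

lemma finite_seg [simp]: "finite (seg Z p)"
  by (simp add: seg_def)

lemma seg_Suc: "seg Z (Suc p) = (if Z p then {} else insert p (seg Z p))"
  by (auto simp: seg_def less_Suc_eq) (metis less_imp_le)

lemma not_in_seg [simp]: "p \<notin> seg Z p"
  by (simp add: seg_def)

lemma card_seg_Suc:
  "card {q \<in> seg Z (Suc p). Q q} =
    (if Z p then 0 else if Q p then Suc (card {q \<in> seg Z p. Q q}) else card {q \<in> seg Z p. Q q})"
proof -
  have "{q \<in> insert p (seg Z p). Q q} = (if Q p then insert p {q \<in> seg Z p. Q q} else {q \<in> seg Z p. Q q})"
    by auto
  then show ?thesis by (simp add: seg_Suc)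
qed

text \<open>Each decrement is sent to the production it consumes. The map is injective: of two
  decrements with the same image, the earlier one would lie between the later one and its
  production. The common coarse value keeps the image in the segment.\<close>

lemma tokens_past_card:
  assumes past: "tokens_past len I D Z x y" and p: "enat p < len" "D p"
  shows "card {q \<in> seg Z p. D q} < card {q \<in> seg Z p. I q}"
proof -
  have "\<forall>q. enat q < len \<and> D q \<longrightarrow> (\<exists>j<q. x j = x q \<and> y j = y q \<and> I j \<and>
        (\<forall>k. j < k \<and> k < q \<and> x k = x q \<and> y k = y q \<longrightarrow> \<not> D k))"
    using past unfolding tokens_past_def by blast
  then obtain m where m: "\<And>q. enat q < len \<Longrightarrow> D q \<Longrightarrow> m q < q \<and> x (m q) = x q \<and> y (m q) = y q \<and> I (m q) \<and>
        (\<forall>k. m q < k \<and> k < q \<and> x k = x q \<and> y k = y q \<longrightarrow> \<not> D k)"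
    by metis
  \<comment> \<open>Counting \<open>p\<close> itself among the decrements makes the inequality
    strict.\<close>
  let ?A = "insert p {q \<in> seg Z p. D q}"
  have A: "enat q < len \<and> D q \<and> q \<le> p \<and> (\<forall>j. q \<le> j \<and> j < p \<longrightarrow> \<not> Z j)" if "q \<in> ?A" for q
    using that p by (auto simp: seg_def) (metis enat_ord_simps(2) order_less_trans)
  have "m ` ?A \<subseteq> {q \<in> seg Z p. I q}"
  proof (rule image_subsetI)
    fix q assume "q \<in> ?A"
    note q = A[OF this]
    then have mq: "m q < q" "x (m q) = x q" "I (m q)" using m by blast+
    have "\<not> Z j" if "m q \<le> j" "j < p" for j
      using tokens_past_same_segment[OF past _ mq(2) that(1)] q that(2) by (cases "j < q") auto
    then show "m q \<in> {q \<in> seg Z p. I q}" using mq q by (auto simp: seg_def)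
  qed
  moreover have "inj_on m ?A"
  proof (rule linorder_inj_onI')
    fix q q' assume *: "q \<in> ?A" "q' \<in> ?A" "q < q'"
    show "m q \<noteq> m q'"
    proof
      assume "m q = m q'"
      with A[OF *(1)] A[OF *(2)] m[of q] m[of q'] *(3) show False by metis
    qed
  qed
  ultimately have "card ?A \<le> card {q \<in> seg Z p. I q}"
    by (metis (no_types, lifting) card_inj_on_le finite_Collect_conjI finite_seg finite_subset mem_Collect_eq subsetI)
  then show ?thesis by simp
qed

text \<open>The mirror image: productions are sent to their consumptions. The image cannot lie
  beyond \<open>p\<close>, since a test separates coarse values, nor at \<open>p\<close>, where no
  decrement takes place.\<close>

lemma tokens_future_card:
  assumes past: "tokens_past len I D Z x y" and future: "tokens_future len I D x y"
    and excl: "exclusive len I D Z" and p: "enat p < len" "Z p"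
  shows "card {q \<in> seg Z p. I q} \<le> card {q \<in> seg Z p. D q}"
proof -
  have "\<forall>q. enat q < len \<and> I q \<longrightarrow> (\<exists>j>q. enat j < len \<and> x j = x q \<and> y j = y q \<and> D j \<and>
        (\<forall>k. q < k \<and> k < j \<and> x k = x q \<and> y k = y q \<longrightarrow> \<not> I k))"
    using future unfolding tokens_future_def by blast
  then obtain m where m: "\<And>q. enat q < len \<Longrightarrow> I q \<Longrightarrow> q < m q \<and> enat (m q) < len \<and> x (m q) = x q \<and>
        y (m q) = y q \<and> D (m q) \<and> (\<forall>k. q < k \<and> k < m q \<and> x k = x q \<and> y k = y q \<longrightarrow> \<not> I k)"
    by metis
  let ?A = "{q \<in> seg Z p. I q}"
  have A: "enat q < len \<and> I q \<and> q < p \<and> (\<forall>j. q \<le> j \<and> j < p \<longrightarrow> \<not> Z j)" if "q \<in> ?A" for q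
    using that p by (auto simp: seg_def) (metis enat_ord_simps(2) order_less_trans)
  have "m ` ?A \<subseteq> {q \<in> seg Z p. D q}"
  proof (rule image_subsetI)
    fix q assume "q \<in> ?A"
    note q = A[OF this]
    then have mq: "q < m q" "enat (m q) < len" "x q = x (m q)" "D (m q)" using m by metis+
    have "\<not> p < m q"
      using tokens_past_same_segment[OF past mq(2,3), of p] q p by auto
    moreover have "p \<noteq> m q" using excl mq p unfolding exclusive_def by blast
    ultimately show "m q \<in> {q \<in> seg Z p. D q}" using mq q by (auto simp: seg_def)
  qed
  moreover have "inj_on m ?A"
  proof (rule linorder_inj_onI')
    fix q q' assume *: "q \<in> ?A" "q' \<in> ?A" "q < q'"
    show "m q \<noteq> m q'"
    proof
      assume "m q = m q'"
      with A[OF *(1)] A[OF *(2)] m[of q] m[of q'] *(3) show False by metis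
    qed
  qed
  ultimately show ?thesis
    by (metis (no_types, lifting) card_inj_on_le finite_Collect_conjI finite_seg finite_subset mem_Collect_eq subsetI)
qed

lemma tokens_imp_counts:
  assumes past: "tokens_past len I D Z x y" and excl: "exclusive len I D Z"
  shows "\<exists>v. counts len I D Z v \<and> (tokens_future len I D x y \<longrightarrow> (\<forall>p. enat p < len \<longrightarrow> Z p \<longrightarrow> v p = 0))"
proof -
  \<comment> \<open>Truncated subtraction is safe: \<open>sum\<close> shows that the decrements of a
    segment never outnumber its increments.\<close>
  define v where "v p = card {q \<in> seg Z p. I q} - card {q \<in> seg Z p. D q}" for p
  have sum: "card {q \<in> seg Z p. D q} + v p = card {q \<in> seg Z p. I q} \<and>
      (enat p < len \<longrightarrow> (D p \<longrightarrow> 0 < v p) \<and>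
        v (Suc p) = (if Z p then 0 else if I p then Suc (v p) else if D p then v p - 1 else v p))"
    if "\<forall>q<p. enat q < len" for p
    using that
  proof (induction p)
    have step: "(D p \<longrightarrow> 0 < v p) \<and>
        v (Suc p) = (if Z p then 0 else if I p then Suc (v p) else if D p then v p - 1 else v p) \<and>
        card {q \<in> seg Z (Suc p). D q} + v (Suc p) = card {q \<in> seg Z (Suc p). I q}"
      if "card {q \<in> seg Z p. D q} + v p = card {q \<in> seg Z p. I q}" "enat p < len" for p
    proof -
      have "D p \<Longrightarrow> card {q \<in> seg Z p. D q} < card {q \<in> seg Z p. I q}"
        using tokens_past_card[OF past that(2)] .
      moreover have "\<not> (I p \<and> D p)" using excl that(2) by (auto simp: exclusive_def)
      ultimately show ?thesis using that(1) unfolding v_def card_seg_Suc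
        by auto
    qed
    {
      case 0
      have "card {q \<in> seg Z 0. D q} + v 0 = card {q \<in> seg Z 0. I q}"
        by (simp add: v_def seg_def)
      with step[OF this] show ?case by blast
    next
      case (Suc p)
      then have "card {q \<in> seg Z (Suc p). D q} + v (Suc p) = card {q \<in> seg Z (Suc p). I q}"
        using step[of p] by auto
      with step[OF this] show ?case by blast
    }
  qed
  have before: "\<forall>q<p. enat q < len" if "enat p < len" for p
    using that by (metis enat_ord_simps(2) order_less_trans)
  have "counts len I D Z v" unfolding counts_def
    using sum before by (auto simp: v_def seg_def)
  moreover have "v p = 0" if "tokens_future len I D x y" "enat p < len" "Z p" for p
    using tokens_future_card[OF past that(1) excl that(2,3)] by (simp add: v_def)
  ultimately show ?thesis by blast
qed

text \<open>A unit is named by the height of the counter at which it is produced.\<close>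

lemma counts_imp_tokens:
  assumes counts: "counts len I D Z v" and excl: "exclusive len I D Z"
    and exact: "\<And>p. enat p < len \<Longrightarrow> Z p \<Longrightarrow> v p = 0" and inj: "inj g"
  shows "tokens_past len I D Z (\<lambda>p. g (card {j. j < p \<and> Z j})) (\<lambda>p. g (if D p then v p - 1 else v p))"
    (is "tokens_past _ _ _ _ ?x ?y")
    and "len = enat l \<Longrightarrow> v l = 0 \<Longrightarrow>
      tokens_future len I D (\<lambda>p. g (card {j. j < p \<and> Z j})) (\<lambda>p. g (if D p then v p - 1 else v p))"
proof -
  \<comment> \<open>The number of tests so far is the coarse value, hence fresh after each test. A
    decrement from height \<open>h + 1\<close> bears \<open>h\<close>, like the increment from
    \<open>h\<close> that it undoes.\<close>
  let ?z = "\<lambda>p. card {j. j < p \<and> Z j}"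
  have z_Suc: "?z (Suc p) = (if Z p then Suc (?z p) else ?z p)" for p
  proof -
    have "{j. j < Suc p \<and> Z j} = (if Z p then insert p {j. j < p \<and> Z j} else {j. j < p \<and> Z j})"
      by (auto simp: less_Suc_eq)
    then show ?thesis by simp
  qed
  have z_mono: "?z j \<le> ?z p" if "j \<le> p" for j p
    using that by (intro card_mono) auto
  have z_eq: "?z j = ?z p" if "j \<le> p" "\<And>k. j \<le> k \<Longrightarrow> k < p \<Longrightarrow> \<not> Z k" for j p
    using that by (intro arg_cong[where f = card]) (auto, meson not_le order_less_le_trans)
  have g: "g a = g b \<longleftrightarrow> a = b" for a b using inj by (auto dest: injD)
  have below: "enat k < len" if "k \<le> p" "enat p < len" for k p
    using that by (metis enat_ord_simps(1) order_le_less_trans)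
  have v0: "v 0 = 0" and D_pos: "\<And>p. enat p < len \<Longrightarrow> D p \<Longrightarrow> 0 < v p"
    and v_Suc: "\<And>p. enat p < len \<Longrightarrow>
      v (Suc p) = (if Z p then 0 else if I p then Suc (v p) else if D p then v p - 1 else v p)"
    using counts by (auto simp: counts_def)
  have ex: "\<And>p. enat p < len \<Longrightarrow> \<not> (I p \<and> D p) \<and> \<not> (Z p \<and> I p) \<and> \<not> (Z p \<and> D p)"
    using excl by (auto simp: exclusive_def)
  have fresh: "if Z p then \<forall>j\<le>p. ?x j \<noteq> ?x (Suc p) else ?x (Suc p) = ?x p" for p
  proof -
    have "?z j \<noteq> Suc (?z p)" if "j \<le> p" for j using z_mono[OF that] by simp
    then show ?thesis by (simp add: g z_Suc)
  qed
  have matched: "\<exists>j<p. ?x j = ?x p \<and> ?y j = ?y p \<and> I j \<and>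
        (\<forall>k. j < k \<and> k < p \<and> ?x k = ?x p \<and> ?y k = ?y p \<longrightarrow> \<not> D k)" if p: "enat p < len" "D p" for p
  proof -
    let ?h = "v p - 1"
    have vp: "v p = Suc ?h" using D_pos[OF p] by simp
    \<comment> \<open>The decrement at \<open>p\<close> undoes the last increment from height
      \<open>?h\<close>. It sits at the last position where the height was at most
      \<open>?h\<close>.\<close>
    define j where "j = (GREATEST j. j < p \<and> v j \<le> ?h)"
    have "p \<noteq> 0" using vp v0 by (metis nat.distinct(1))
    then have "0 < p \<and> v 0 \<le> ?h" using v0 by simp
    then have "j < p \<and> v j \<le> ?h"
      unfolding j_def by (rule GreatestI_nat[where b = p]) auto
    then have j: "j < p" "v j \<le> ?h" by auto
    have above: "?h < v k" if "j < k" "k \<le> p" for k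
    proof (cases "k = p")
      case False
      show ?thesis
      proof (rule ccontr)
        assume "\<not> ?h < v k"
        then have "k \<le> j" unfolding j_def
          by (intro Greatest_le_nat[where b = p]) (use that False in auto)
        with that show False by simp
      qed
    qed (use vp in simp)
    have jl: "enat j < len" using below[of j p] j p by simp
    have "?h < v (Suc j)" using above[of "Suc j"] j by simp
    then have I: "I j" and vj: "v j = ?h"
      using v_Suc[OF jl] j(2) by (auto split: if_splits)
    have noZ: "\<not> Z k" if "j \<le> k" "k < p" for k
    proof (cases "k = j")
      case True
      then show ?thesis using ex[OF jl] I by simp
    next
      case False
      then show ?thesis using above[of k] exact[of k] below[of k p] that p by fastforce
    qed
    have "\<not> D k" if k: "j < k" "k < p" "?y k = ?y p" for k
    proof
      assume "D k"
      have kl: "enat k < len" using below[of k p] k p by simp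
      with \<open>D k\<close> k(3) p(2) have "v k - 1 = ?h" by (simp add: g)
      then have "v (Suc k) = ?h" using v_Suc[OF kl] ex[OF kl] \<open>D k\<close> by simp
      with above[of "Suc k"] k show False by simp
    qed
    moreover have "?x j = ?x p" using z_eq[of j p] noZ j by simp
    moreover have "?y j = ?y p" using ex[OF jl] I vj p(2) by simp
    ultimately show ?thesis using j I by blast
  qed
  show "tokens_past len I D Z ?x ?y"
    unfolding tokens_past_def using fresh matched by blast
  show "tokens_future len I D ?x ?y" if len: "len = enat l" and vl: "v l = 0"
    unfolding tokens_future_def
  proof (intro allI impI)
    fix p assume p: "enat p < len" "I p"
    let ?h = "v p"
    have vS: "v (Suc p) = Suc ?h" using v_Suc[OF p(1)] ex[OF p(1)] p(2) by simp
    \<comment> \<open>The unit is used up by the step that first brings the height back to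
      \<open>?h\<close>. There is one because the counter is 0 at the end of the word, and it is not
      a test because tests are exact.\<close>
    define m where "m = (LEAST m. p < m \<and> v m \<le> ?h)"
    have l: "p < l \<and> v l \<le> ?h" using p len vl by simp
    have "p < m \<and> v m \<le> ?h" unfolding m_def by (rule LeastI[of _ l]) (rule l)
    moreover have "m \<le> l" unfolding m_def by (rule Least_le) (rule l)
    ultimately have m: "p < m" "v m \<le> ?h" "m \<le> l" by auto
    have above: "?h < v k" if "p < k" "k < m" for k
      using not_less_Least[of k "\<lambda>m. p < m \<and> v m \<le> ?h"] that unfolding m_def by auto
    have "m \<noteq> Suc p" using m vS by auto
    then obtain j where mj: "m = Suc j" and j: "p < j" using m(1) by (cases m) auto
    have jl: "enat j < len" using m(3) mj len by simp
    have vj: "?h < v j" using above j mj by simp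
    have "\<not> Z j" using exact[OF jl] vj by auto
    then have D: "D j" and vj': "v j - 1 = ?h"
      using v_Suc[OF jl] m(2) mj vj D_pos[OF jl] by (auto split: if_splits)
    have noZ: "\<not> Z k" if "p \<le> k" "k < j" for k
    proof (cases "k = p")
      case True
      then show ?thesis using ex[OF p(1)] p(2) by simp
    next
      case False
      then show ?thesis using above[of k] exact[of k] below[of k j] that jl mj by fastforce
    qed
    have "\<not> I k" if k: "p < k" "k < j" "?y k = ?y p" for k
    proof
      assume "I k"
      have kl: "enat k < len" using below[of k j] k jl by simp
      with \<open>I k\<close> k(3) ex[OF p(1)] p(2) ex[OF kl] have "v k = ?h" by (simp add: g)
      with above[of k] k mj show False by simp
    qed
    moreover have "?x j = ?x p" using z_eq[of p j] noZ j by simp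
    moreover have "?y j = ?y p" using ex[OF p(1)] p(2) D vj' by simp
    ultimately show "\<exists>j>p. enat j < len \<and> ?x j = ?x p \<and> ?y j = ?y p \<and> D j \<and>
        (\<forall>k. p < k \<and> k < j \<and> ?x k = ?x p \<and> ?y k = ?y p \<longrightarrow> \<not> I k)"
      using j jl D by blast
  qed
qed


section \<open>Runs of a program\<close>

definition proper :: "op \<Rightarrow> bool" where
  "proper p \<longleftrightarrow> p \<noteq> Fill \<and> p \<noteq> Start \<and> p \<noteq> Load"

text \<open>Mere moves of control are labelled \<open>Nop\<close>, so that every step carries
  exactly one operation, as every position of a word carries one edge.\<close>

inductive sstep :: "prog \<Rightarrow> op \<Rightarrow> prog \<Rightarrow> bool" where
  sstep_Op: "proper p \<Longrightarrow> sstep (Op p) p Skip"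
| sstep_Seq: "sstep a p a' \<Longrightarrow> sstep (Seq a b) p (Seq a' b)"
| sstep_Skip: "sstep (Seq Skip b) Nop b"
| sstep_exit: "sstep (Star a) Nop Skip"
| sstep_enter: "sstep (Star a) Nop (Seq a (Star a))"

inductive_cases sstep_SkipE: "sstep Skip p a"
inductive_cases sstep_OpE: "sstep (Op q) p a"
inductive_cases sstep_SeqE: "sstep (Seq a b) p c"
inductive_cases sstep_StarE: "sstep (Star a) p c"

lemma sstep_proper: "sstep a p a' \<Longrightarrow> proper p"
  by (induction rule: sstep.induct) (auto simp: proper_def)

definition cfg_step :: "prog \<times> (nat \<Rightarrow> nat) \<Rightarrow> prog \<times> (nat \<Rightarrow> nat) \<Rightarrow> bool" where
  "cfg_step x y \<longleftrightarrow> (\<exists>p. sstep (fst x) p (fst y) \<and> op_step p (snd x) (snd y))"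

lemma sstep_sem: "sstep a p a' \<Longrightarrow> op_step p \<sigma> \<sigma>' \<Longrightarrow> sem a' \<sigma>' \<tau> \<Longrightarrow> sem a \<sigma> \<tau>"
  by (induction arbitrary: \<sigma> \<sigma>' \<tau> rule: sstep.induct)
    (auto simp: relcompp_apply intro: converse_rtranclp_into_rtranclp)

lemma cfg_steps_sem: "cfg_step\<^sup>*\<^sup>* x y \<Longrightarrow> fst y = Skip \<Longrightarrow> sem (fst x) (snd x) (snd y)"
  by (induction rule: converse_rtranclp_induct) (auto simp: cfg_step_def intro: sstep_sem)

lemma cfg_steps_Seq: "cfg_step\<^sup>*\<^sup>* x y \<Longrightarrow> cfg_step\<^sup>*\<^sup>* (Seq (fst x) b, snd x) (Seq (fst y) b, snd y)"
proof (induction rule: rtranclp_induct)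
  case (step y z)
  then have "cfg_step (Seq (fst y) b, snd y) (Seq (fst z) b, snd z)"
    by (auto simp: cfg_step_def intro: sstep_Seq)
  with step.IH show ?case by (rule rtranclp.rtrancl_into_rtrancl)
qed simp

lemma sem_cfg_steps: "sem a \<sigma> \<sigma>' \<Longrightarrow> cfg_step\<^sup>*\<^sup>* (a, \<sigma>) (Skip, \<sigma>')"
proof (induction a arbitrary: \<sigma> \<sigma>')
  case (Op p)
  then have "proper p" by (cases p) (auto simp: proper_def)
  with Op show ?case by (intro r_into_rtranclp) (auto simp: cfg_step_def intro: sstep_Op)
next
  case (Seq a b)
  then obtain \<tau> where "sem a \<sigma> \<tau>" "sem b \<tau> \<sigma>'" by (auto simp: relcompp_apply)
  with Seq.IH have "cfg_step\<^sup>*\<^sup>* (a, \<sigma>) (Skip, \<tau>)" and b: "cfg_step\<^sup>*\<^sup>* (b, \<tau>) (Skip, \<sigma>')"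
    by blast+
  from cfg_steps_Seq[OF this(1), of b] have "cfg_step\<^sup>*\<^sup>* (Seq a b, \<sigma>) (Seq Skip b, \<tau>)" by simp
  moreover have "cfg_step (Seq Skip b, \<tau>) (b, \<tau>)" by (auto simp: cfg_step_def intro: sstep_Skip)
  ultimately show ?case using b by (meson rtranclp.rtrancl_into_rtrancl rtranclp_trans)
next
  case (Star a)
  then have "(sem a)\<^sup>*\<^sup>* \<sigma> \<sigma>'" by simp
  then show ?case
  proof (induction rule: converse_rtranclp_induct)
    case base
    show ?case by (auto simp: cfg_step_def intro!: r_into_rtranclp sstep_exit exI[of _ Nop])
  next
    case (step \<sigma> \<tau>)
    have "cfg_step (Star a, \<sigma>) (Seq a (Star a), \<sigma>)"
      by (auto simp: cfg_step_def intro!: sstep_enter exI[of _ Nop])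
    moreover have "cfg_step\<^sup>*\<^sup>* (Seq a (Star a), \<sigma>) (Seq Skip (Star a), \<tau>)"
      using cfg_steps_Seq[OF Star.IH[OF step.hyps(1)]] by simp
    moreover have "cfg_step (Seq Skip (Star a), \<tau>) (Star a, \<tau>)"
      by (auto simp: cfg_step_def intro!: sstep_Skip exI[of _ Nop])
    ultimately show ?case using step.IH
      by (meson converse_rtranclp_into_rtranclp rtranclp_trans)
  qed
qed simp

section \<open>The finite control graph of a program\<close>

text \<open>Continuations of a program, formed like Antimirov's partial derivatives of a regular
  expression. Some may be unreachable; what counts is that they are finitely many and closed under
  steps.\<close>

primrec residuals :: "prog \<Rightarrow> prog set" where
  "residuals Skip = {Skip}"
| "residuals (Op p) = {Op p, Skip}"
| "residuals (Seq a b) = (\<lambda>a'. Seq a' b) ` residuals a \<union> residuals b"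
| "residuals (Star a) = insert (Star a) (insert Skip ((\<lambda>a'. Seq a' (Star a)) ` residuals a))"

lemma finite_residuals: "finite (residuals a)"
  by (induction a) auto

lemma residuals_refl: "a \<in> residuals a"
  by (induction a) auto

lemma residuals_sstep: "b \<in> residuals a \<Longrightarrow> sstep b p b' \<Longrightarrow> b' \<in> residuals a"
proof (induction a arbitrary: b b')
  case (Seq a1 a2)
  then show ?case using residuals_refl[of a2] by (fastforce elim: sstep_SeqE)
next
  case (Star a)
  then show ?case using residuals_refl[of a] by (fastforce elim: sstep_SeqE sstep_StarE sstep_SkipE)
qed (auto elim: sstep_OpE sstep_SkipE)

lemma finite_sstep: "finite {(p, b). sstep a p b}"
proof (induction a)
  case Skip
  have "{(p, b). sstep Skip p b} = {}" by (auto elim: sstep_SkipE)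
  then show ?case by (metis finite.emptyI)
next
  case (Op q)
  have "{(p, b). sstep (Op q) p b} \<subseteq> {(q, Skip)}" by (auto elim: sstep_OpE)
  then show ?case by (rule finite_subset) simp
next
  case (Seq a b)
  have "{(p, c). sstep (Seq a b) p c} \<subseteq> insert (Nop, b) ((\<lambda>(p, a'). (p, Seq a' b)) ` {(p, a'). sstep a p a'})"
    by (auto elim!: sstep_SeqE)
  then show ?case by (rule finite_subset) (use Seq in simp)
next
  case (Star a)
  have "{(p, c). sstep (Star a) p c} \<subseteq> {(Nop, Skip), (Nop, Seq a (Star a))}" by (auto elim: sstep_StarE)
  then show ?case by (rule finite_subset) simp
qed

fun op_regs :: "op \<Rightarrow> nat set" where
  "op_regs (Inc r) = {r}"
| "op_regs (Dec r) = {r}"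
| "op_regs (Test r) = {r}"
| "op_regs _ = {}"

primrec regs :: "prog \<Rightarrow> nat set" where
  "regs Skip = {}"
| "regs (Op p) = op_regs p"
| "regs (Seq a b) = regs a \<union> regs b"
| "regs (Star a) = regs a"

lemma finite_regs: "finite (regs a)"
proof (induction a)
  case (Op p)
  then show ?case by (cases p) auto
qed auto

lemma regs_residuals: "b \<in> residuals a \<Longrightarrow> regs b \<subseteq> regs a"
  by (induction a arbitrary: b) fastforce+

lemma sstep_regs: "sstep a p a' \<Longrightarrow> op_regs p \<subseteq> regs a"
  by (induction rule: sstep.induct) auto

datatype node = Fil | Lod | Run prog

type_synonym edge = "node \<times> op \<times> node"

text \<open>The edge from \<open>Run Skip\<close> to \<open>Lod\<close> allows endless repetition
  without a return to \<open>Fil\<close>, so the budget is filled at the beginning only.\<close>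

definition graph :: "prog \<Rightarrow> edge set" where
  "graph c = {(Fil, Fill, Fil), (Fil, Start, Lod), (Lod, Load, Lod), (Lod, Nop, Run c), (Run Skip, Start, Lod)} \<union>
     {(Run a, p, Run b) | a p b. a \<in> residuals c \<and> sstep a p b}"

lemma finite_graph: "finite (graph c)"
proof -
  have "{(Run a, p, Run b) | a p b. a \<in> residuals c \<and> sstep a p b} \<subseteq>
      (\<Union>a\<in>residuals c. (\<lambda>(p, b). (Run a, p, Run b)) ` {(p, b). sstep a p b})"
    by auto
  then have "finite {(Run a, p, Run b) | a p b. a \<in> residuals c \<and> sstep a p b}"
    by (rule finite_subset) (use finite_residuals finite_sstep in auto)
  then show ?thesis by (simp add: graph_def)
qed

abbreviation src :: "edge \<Rightarrow> node" where "src e \<equiv> fst e"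
abbreviation lbl :: "edge \<Rightarrow> op" where "lbl e \<equiv> fst (snd e)"
abbreviation tgt :: "edge \<Rightarrow> node" where "tgt e \<equiv> snd (snd e)"

text \<open>Counter \<open>0\<close> holds the unused part of the budget, and register \<open>r\<close> is counter \<open>Suc r\<close>.
  \<open>Start\<close> tests all registers, so each iteration begins with empty registers even if
  earlier tests were wrong.\<close>

fun incs :: "op \<Rightarrow> nat set" where
  "incs (Inc r) = {Suc r}"
| "incs (Dec r) = {0}"
| "incs Load = {Suc 0}"
| "incs Fill = {0}"
| "incs _ = {}"

fun decs :: "op \<Rightarrow> nat set" where
  "decs (Inc r) = {0}"
| "decs (Dec r) = {Suc r}"
| "decs Load = {0}"
| "decs _ = {}"

fun tests :: "op \<Rightarrow> nat set" where
  "tests (Test r) = {Suc r}"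
| "tests Start = {0<..}"
| "tests _ = {}"

lemma exclusive_ops: "exclusive len (\<lambda>p. r \<in> incs (f p)) (\<lambda>p. r \<in> decs (f p)) (\<lambda>p. r \<in> tests (f p))"
proof -
  have "\<not> (r \<in> incs a \<and> r \<in> decs a) \<and> \<not> (r \<in> tests a \<and> r \<in> incs a) \<and> \<not> (r \<in> tests a \<and> r \<in> decs a)" for a
    by (cases a) auto
  then show ?thesis by (simp add: exclusive_def)
qed

section \<open>Runs, and extraction of a computation from a run\<close>

definition run :: "prog \<Rightarrow> nat \<Rightarrow> enat \<Rightarrow> (nat \<Rightarrow> edge) \<Rightarrow> bool" where
  "run c n len t \<longleftrightarrow> (\<forall>p. enat p < len \<longrightarrow> t p \<in> graph c) \<and> src (t 0) = Fil \<and>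
     (\<forall>p. enat (Suc p) < len \<longrightarrow> tgt (t p) = src (t (Suc p))) \<and>
     (\<forall>p. enat p < len \<longrightarrow> lbl (t p) = Start \<longrightarrow>
        (\<forall>i<n. enat (Suc p + i) < len \<and> lbl (t (Suc p + i)) = Load) \<and>
        enat (Suc p + n) < len \<and> lbl (t (Suc p + n)) \<noteq> Load)"

definition counter_run :: "nat \<Rightarrow> enat \<Rightarrow> (nat \<Rightarrow> edge) \<Rightarrow> (nat \<Rightarrow> nat \<Rightarrow> nat) \<Rightarrow> bool" where
  "counter_run K len t v \<longleftrightarrow> (\<forall>r\<le>K. counts len (\<lambda>p. r \<in> incs (lbl (t p))) (\<lambda>p. r \<in> decs (lbl (t p)))
     (\<lambda>p. r \<in> tests (lbl (t p))) (v r))"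

definition exact_at :: "nat \<Rightarrow> (nat \<Rightarrow> edge) \<Rightarrow> (nat \<Rightarrow> nat \<Rightarrow> nat) \<Rightarrow> nat \<Rightarrow> bool" where
  "exact_at K t v p \<longleftrightarrow> (\<forall>r\<le>K. r \<in> tests (lbl (t p)) \<longrightarrow> v r p = 0)"

definition regs_at :: "nat \<Rightarrow> (nat \<Rightarrow> nat \<Rightarrow> nat) \<Rightarrow> nat \<Rightarrow> nat \<Rightarrow> nat" where
  "regs_at K v p = (\<lambda>r. if r < K then v (Suc r) p else 0)"

lemma counter_run_step:
  assumes "counter_run K len t v" "enat p < len" "r \<le> K"
  shows "r \<in> decs (lbl (t p)) \<Longrightarrow> 0 < v r p"
    and "v r (Suc p) = (if r \<in> tests (lbl (t p)) then 0 else if r \<in> incs (lbl (t p)) then Suc (v r p)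
      else if r \<in> decs (lbl (t p)) then v r p - 1 else v r p)"
  using assms unfolding counter_run_def counts_def by blast+

lemma op_step_regs_at:
  assumes run: "counter_run K len t v" "enat p < len" and ex: "exact_at K t v p"
    and p: "proper (lbl (t p))" "op_regs (lbl (t p)) \<subseteq> {..<K}"
  shows "op_step (lbl (t p)) (regs_at K v p) (regs_at K v (Suc p))"
proof -
  note step = counter_run_step[OF run]
  have up: "Suc r \<le> K" if "r < K" for r using that by simp
  show ?thesis
  proof (cases "lbl (t p)")
    case (Dec r)
    with p have "r < K" by simp
    with step(1)[OF up] Dec have "0 < v (Suc r) p" by simp
    with Dec \<open>r < K\<close> show ?thesis by (auto simp: regs_at_def step(2)[OF up])
  next
    case (Test r)
    with p have "r < K" by simp
    with Test ex up have "v (Suc r) p = 0" by (auto simp: exact_at_def)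
    with Test \<open>r < K\<close> show ?thesis by (auto simp: regs_at_def step(2)[OF up])
  qed (use p in \<open>auto simp: regs_at_def step(2)[OF up] proper_def\<close>)
qed

lemma graph_from_Lod: "e \<in> graph c \<Longrightarrow> src e = Lod \<Longrightarrow> e = (Lod, Load, Lod) \<or> e = (Lod, Nop, Run c)"
  by (auto simp: graph_def)

lemma graph_from_Run: "e \<in> graph c \<Longrightarrow> src e = Run a \<Longrightarrow> lbl e \<noteq> Start \<Longrightarrow>
    \<exists>p b. e = (Run a, p, Run b) \<and> a \<in> residuals c \<and> sstep a p b"
  by (auto simp: graph_def)

lemma graph_Start: "e \<in> graph c \<Longrightarrow> lbl e = Start \<Longrightarrow> tgt e = Lod \<and> (src e = Fil \<or> src e = Run Skip)"
  using sstep_proper by (auto simp: graph_def proper_def)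

text \<open>The \<open>Start\<close> at \<open>s\<close> empties the registers even as a wrong test,
  so exactness is demanded only after \<open>s\<close>.\<close>

lemma run_iteration:
  assumes run: "run c n len t" and cr: "counter_run K len t v" and K: "regs c \<subseteq> {..<K}" "0 < K"
    and s: "lbl (t s) = Start" "s < e" "\<And>p. s < p \<Longrightarrow> p < e \<Longrightarrow> lbl (t p) \<noteq> Start"
    and e: "\<And>p. p < e \<Longrightarrow> enat p < len" "tgt (t (e - 1)) = Run Skip"
    and ex: "\<And>p. s < p \<Longrightarrow> p < e \<Longrightarrow> exact_at K t v p"
  shows "\<exists>\<sigma>'. sem c (\<lambda>r. if r = 0 then n else 0) \<sigma>'"
proof -
  have graph: "t p \<in> graph c" if "p < e" for p using run e(1) that by (auto simp: run_def)
  have succ: "src (t (Suc p)) = tgt (t p)" if "Suc p < e" for p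
    using run e(1) that by (auto simp: run_def)
  have loads: "enat (Suc s + n) < len" "lbl (t (Suc s + n)) \<noteq> Load"
    "\<And>i. i < n \<Longrightarrow> lbl (t (Suc s + i)) = Load"
    using run s(1) e(1)[OF s(2)] by (auto simp: run_def)
  have init: "regs_at K v (Suc s) = (\<lambda>_. 0)"
    using counter_run_step(2)[OF cr e(1)[OF s(2)]] s(1) by (auto simp: regs_at_def)
  \<comment> \<open>The iteration cannot stop while loading: its last edge leads to
    \<open>Run Skip\<close>, a load edge to \<open>Lod\<close>.\<close>
  have Lod: "Suc s + i < e \<and> src (t (Suc s + i)) = Lod \<and> regs_at K v (Suc s + i) = (\<lambda>r. if r = 0 then i else 0)"
    if "i \<le> n" for i
    using that
  proof (induction i)
    case 0
    have "tgt (t s) = Lod" using graph_Start[OF graph[OF s(2)] s(1)] by simp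
    then have "Suc s < e" using e(2) s(2) by (cases "e = Suc s") auto
    with succ[OF this] \<open>tgt (t s) = Lod\<close> init show ?case by auto
  next
    case (Suc i)
    let ?p = "Suc s + i"
    from Suc have IH: "?p < e" "src (t ?p) = Lod" "regs_at K v ?p = (\<lambda>r. if r = 0 then i else 0)" by auto
    have l: "lbl (t ?p) = Load" using loads(3) Suc.prems by simp
    with graph_from_Lod[OF graph[OF IH(1)] IH(2)] have tgt: "tgt (t ?p) = Lod" by auto
    then have "Suc ?p < e" using e(2) IH(1) by (cases "e = Suc ?p") auto
    moreover have "regs_at K v (Suc ?p) = (regs_at K v ?p)(0 := Suc (regs_at K v ?p 0))"
      using counter_run_step(2)[OF cr e(1)[OF IH(1)]] l K(2)
      by (auto simp: regs_at_def fun_eq_iff)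
    then have "regs_at K v (Suc ?p) = (\<lambda>r. if r = 0 then Suc i else 0)"
      unfolding IH(3) by auto
    ultimately show ?case using succ[of ?p] tgt by simp
  qed
  let ?q = "Suc s + n"
  from Lod[of n] have q: "?q < e" "src (t ?q) = Lod" "regs_at K v ?q = (\<lambda>r. if r = 0 then n else 0)" by auto
  \<comment> \<open>After \<open>n\<close> loads the next label is not \<open>Load\<close>, which
    forces control into the program.\<close>
  from graph_from_Lod[OF graph[OF q(1)] q(2)] loads(2) have tq: "t ?q = (Lod, Nop, Run c)" by auto
  have "regs_at K v (Suc ?q) = regs_at K v ?q"
    using counter_run_step(2)[OF cr e(1)[OF q(1)]] tq by (auto simp: regs_at_def)
  with q(3) have Suc_q: "regs_at K v (Suc ?q) = (\<lambda>r. if r = 0 then n else 0)" by simp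
  have steps: "\<exists>a. tgt (t (?q + i)) = Run a \<and> a \<in> residuals c \<and>
      cfg_step\<^sup>*\<^sup>* (c, \<lambda>r. if r = 0 then n else 0) (a, regs_at K v (Suc ?q + i))" if "?q + i < e" for i
    using that
  proof (induction i)
    case 0
    then show ?case using tq Suc_q by (auto simp: residuals_refl)
  next
    case (Suc i)
    let ?p = "Suc ?q + i"
    from Suc obtain a where a: "tgt (t (?q + i)) = Run a" "a \<in> residuals c"
      "cfg_step\<^sup>*\<^sup>* (c, \<lambda>r. if r = 0 then n else 0) (a, regs_at K v ?p)" by auto
    have p: "?p < e" "s < ?p" using Suc.prems by auto
    have "src (t ?p) = Run a" using succ[of "?q + i"] a(1) p by simp
    from graph_from_Run[OF graph[OF p(1)] this s(3)[OF p(2,1)]] obtain x b where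
      b: "t ?p = (Run a, x, Run b)" "sstep a x b" by blast
    have "op_regs x \<subseteq> {..<K}" using sstep_regs[OF b(2)] regs_residuals[OF a(2)] K(1) by blast
    then have "op_step x (regs_at K v ?p) (regs_at K v (Suc ?p))"
      using op_step_regs_at[OF cr e(1)[OF p(1)] ex[OF p(2,1)]] b sstep_proper[OF b(2)] by simp
    with b(2) have "cfg_step (a, regs_at K v ?p) (b, regs_at K v (Suc ?p))"
      by (auto simp: cfg_step_def)
    with a(3) have "cfg_step\<^sup>*\<^sup>* (c, \<lambda>r. if r = 0 then n else 0) (b, regs_at K v (Suc ?p))"
      by (meson rtranclp.rtrancl_into_rtrancl)
    then show ?case using b(1) residuals_sstep[OF a(2) b(2)] by auto
  qed
  from q(1) obtain i where i: "e - 1 = ?q + i" "?q + i < e" by (metis Suc_leI add_diff_inverse_nat diff_Suc_1 lessI less_imp_Suc_add not_less not_less_eq)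
  from steps[OF i(2)] e(2) i(1) have "cfg_step\<^sup>*\<^sup>* (c, \<lambda>r. if r = 0 then n else 0) (Skip, regs_at K v (Suc ?q + i))"
    by auto
  from cfg_steps_sem[OF this] show ?thesis by auto
qed


lemma graph_not_Fil: "e \<in> graph c \<Longrightarrow> src e \<noteq> Fil \<Longrightarrow> tgt e \<noteq> Fil \<and> lbl e \<noteq> Fill"
  using sstep_proper by (auto simp: graph_def proper_def)

lemma graph_from_Fil: "e \<in> graph c \<Longrightarrow> src e = Fil \<Longrightarrow> lbl e \<noteq> Start \<Longrightarrow> tgt e = Fil"
  by (auto simp: graph_def)

text \<open>Control never returns to \<open>Fil\<close>, so after the first \<open>Start\<close>
  nothing adds to the total of the counters.\<close>

lemma run_not_Fil:
  assumes run: "run c n len t" and s: "lbl (t s) = Start" "s < p" "enat p < len"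
  shows "src (t p) \<noteq> Fil"
  using s(2,3)
proof (induction p)
  case (Suc p)
  have p: "enat p < len" using Suc.prems(2) by (metis enat_ord_simps(2) lessI order_less_trans)
  then have g: "t p \<in> graph c" and tgt: "src (t (Suc p)) = tgt (t p)"
    using run Suc.prems(2) by (auto simp: run_def)
  show ?case
  proof (cases "s = p")
    case True
    with graph_Start[OF g] s(1) tgt show ?thesis by simp
  next
    case False
    with Suc p have "src (t p) \<noteq> Fil" by simp
    from graph_not_Fil[OF g this] tgt show ?thesis by simp
  qed
qed simp

text \<open>A path can leave \<open>Fil\<close> only by \<open>Start\<close>, and from its last
  \<open>Start\<close> to the end it performs one whole iteration.\<close>

lemma finite_run_imp_sem:
  assumes run: "run c n (enat l) t" and cr: "counter_run K (enat l) t v"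
    and K: "regs c \<subseteq> {..<K}" "0 < K" and l: "0 < l" "tgt (t (l - 1)) = Run Skip"
    and ex: "\<And>p. p < l \<Longrightarrow> exact_at K t v p"
  shows "\<exists>\<sigma>'. sem c (\<lambda>r. if r = 0 then n else 0) \<sigma>'"
proof -
  have "\<exists>s<l. lbl (t s) = Start"
  proof (rule ccontr)
    assume no: "\<not> ?thesis"
    have "src (t p) = Fil" if "p < l" for p
      using that
    proof (induction p)
      case 0
      show ?case using run by (simp add: run_def)
    next
      case (Suc p)
      then have "t p \<in> graph c" "tgt (t p) = src (t (Suc p))" using run by (auto simp: run_def)
      with Suc no graph_from_Fil show ?case by (metis Suc_lessD)
    qed
    then have "tgt (t (l - 1)) = Fil"
      using graph_from_Fil[of "t (l - 1)" c] no l(1) run by (auto simp: run_def)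
    with l(2) show False by simp
  qed
  then obtain s0 where s0: "s0 < l \<and> lbl (t s0) = Start" by blast
  define s where "s = (GREATEST s. s < l \<and> lbl (t s) = Start)"
  have s: "s < l \<and> lbl (t s) = Start"
    unfolding s_def by (rule GreatestI_nat[where b = l and k = s0]) (use s0 in auto)
  have "lbl (t p) \<noteq> Start" if "s < p" "p < l" for p
    using Greatest_le_nat[of "\<lambda>s. s < l \<and> lbl (t s) = Start" p l] that unfolding s_def by auto
  with s l(2) ex show ?thesis
    by (intro run_iteration[OF run cr K, of s l]) auto
qed

text \<open>An operation other than \<open>Fill\<close> takes as many units from some counter as it
  gives to another, and a test only removes units. The bound on the registers ensures that both
  counters occur in the sum.\<close>

lemma counter_sum_step:
  assumes cr: "counter_run K len t v" and p: "enat p < len" "lbl (t p) \<noteq> Fill" "op_regs (lbl (t p)) \<subseteq> {..<K}"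
    and K: "0 < K"
  shows "(\<Sum>r\<le>K. v r (Suc p)) \<le> (\<Sum>r\<le>K. v r p)"
    and "\<not> exact_at K t v p \<Longrightarrow> (\<Sum>r\<le>K. v r (Suc p)) < (\<Sum>r\<le>K. v r p)"
proof -
  let ?d = "\<lambda>r. if r \<in> decs (lbl (t p)) then 1 else 0 :: nat"
  let ?i = "\<lambda>r. if r \<in> incs (lbl (t p)) then 1 else 0 :: nat"
  have bal: "(\<Sum>r\<le>K. ?d r) = (\<Sum>r\<le>K. ?i r)"
    using p(2,3) K by (cases "lbl (t p)") simp_all
  have disj: "\<not> (r \<in> incs a \<and> r \<in> decs a)" "\<not> (r \<in> tests a \<and> (r \<in> incs a \<or> r \<in> decs a))" for a r
    by (cases a; auto)+
  have le: "v r (Suc p) + ?d r \<le> v r p + ?i r" if "r \<le> K" for r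
    using counter_run_step[OF cr p(1) that] disj[of r "lbl (t p)"] by auto
  have "(\<Sum>r\<le>K. v r (Suc p) + ?d r) \<le> (\<Sum>r\<le>K. v r p + ?i r)"
    by (rule sum_mono) (use le in auto)
  then show "(\<Sum>r\<le>K. v r (Suc p)) \<le> (\<Sum>r\<le>K. v r p)"
    using bal by (simp add: sum.distrib)
  assume "\<not> exact_at K t v p"
  then obtain r where r: "r \<le> K" "r \<in> tests (lbl (t p))" "0 < v r p" by (auto simp: exact_at_def)
  then have "v r (Suc p) + ?d r < v r p + ?i r"
    using counter_run_step(2)[OF cr p(1) r(1)] disj[of r "lbl (t p)"] by auto
  then have "(\<Sum>r\<le>K. v r (Suc p) + ?d r) < (\<Sum>r\<le>K. v r p + ?i r)"
    using le r(1) by (intro sum_strict_mono_ex1) (simp, blast, blast)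
  then show "(\<Sum>r\<le>K. v r (Suc p)) < (\<Sum>r\<le>K. v r p)"
    using bal by (simp add: sum.distrib)
qed

lemma graph_regs: "e \<in> graph c \<Longrightarrow> op_regs (lbl e) \<subseteq> regs c"
  using regs_residuals sstep_regs unfolding graph_def by fastforce

text \<open>The sum of all counters does not increase after the first \<^const>\<open>Start\<close>, and it drops at
  every test of a nonzero counter. So in an infinite run only finitely many tests are wrong.\<close>

lemma infinite_run_imp_sem:
  assumes run: "run c n \<infinity> t" and cr: "counter_run K \<infinity> t v"
    and K: "regs c \<subseteq> {..<K}" "0 < K" and inf: "\<And>p. \<exists>q\<ge>p. lbl (t q) = Start"
  shows "\<exists>\<sigma>'. sem c (\<lambda>r. if r = 0 then n else 0) \<sigma>'"
proof -
  obtain s0 where s0: "lbl (t s0) = Start" using inf by blast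
  have graph: "t p \<in> graph c" for p using run by (simp add: run_def)
  have notFil: "src (t p) \<noteq> Fil" if "s0 < p" for p
    using run_not_Fil[OF run s0 that] by simp
  define f where "f i = (\<Sum>r\<le>K. v r (Suc s0 + i))" for i
  have step: "f (Suc i) \<le> f i" "\<not> exact_at K t v (Suc s0 + i) \<Longrightarrow> f (Suc i) < f i" for i
  proof -
    have "lbl (t (Suc s0 + i)) \<noteq> Fill" using graph_not_Fil[OF graph notFil] by auto
    then show "f (Suc i) \<le> f i" "\<not> exact_at K t v (Suc s0 + i) \<Longrightarrow> f (Suc i) < f i"
      using counter_sum_step[OF cr, of "Suc s0 + i"] graph_regs[OF graph] K by (auto simp: f_def)
  qed
  \<comment> \<open>The sum attains its minimum at \<open>N\<close>. As it never increases, it is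
    constant from there on, which excludes wrong tests.\<close>
  obtain N where N: "\<And>i. f N \<le> f i" using ex_has_least_nat[of "\<lambda>_. True" 0 f] by auto
  have dec: "f j \<le> f i" if "i \<le> j" for i j
    by (rule lift_Suc_antimono_le[of f, OF step(1) that])
  have ex: "exact_at K t v p" if "Suc s0 + N \<le> p" for p
  proof -
    define i where "i = p - Suc s0"
    have i: "p = Suc s0 + i" "N \<le> i" using that by (auto simp: i_def)
    have "\<not> f (Suc i) < f i" using dec[OF i(2)] N[of "Suc i"] by simp
    with step(2) i(1) show ?thesis by blast
  qed
  obtain s where s: "Suc s0 + N \<le> s" "lbl (t s) = Start" using inf by blast
  define e where "e = (LEAST e. s < e \<and> lbl (t e) = Start)"
  obtain e0 where e0: "s < e0 \<and> lbl (t e0) = Start" using inf[of "Suc s"] by (auto simp: Suc_le_eq)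
  have e: "s < e \<and> lbl (t e) = Start" unfolding e_def by (rule LeastI[of _ e0]) (rule e0)
  have between: "lbl (t p) \<noteq> Start" if "s < p" "p < e" for p
    using not_less_Least[of p "\<lambda>e. s < e \<and> lbl (t e) = Start"] that unfolding e_def by auto
  \<comment> \<open>The \<open>Start\<close> at \<open>e\<close> cannot come from \<open>Fil\<close>
    any more, so the iteration before it has run to completion.\<close>
  have "src (t e) = Run Skip"
    using graph_Start[OF graph] e notFil[of e] s(1) by auto
  moreover have "tgt (t (e - 1)) = src (t (Suc (e - 1)))" using run by (simp add: run_def)
  ultimately have "tgt (t (e - 1)) = Run Skip" using e by simp
  then show ?thesis
    using s e between ex by (intro run_iteration[OF run cr K, of s e]) auto
qed

section \<open>From a computation to a periodic run\<close>

lemma sum_fun_upd: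
  fixes \<sigma> :: "nat \<Rightarrow> nat"
  assumes "x < K"
  shows "(\<Sum>r<K. (\<sigma>(x := y)) r) + \<sigma> x = (\<Sum>r<K. \<sigma> r) + y"
proof -
  have "(\<Sum>r<K. (\<sigma>(x := y)) r) = y + (\<Sum>r\<in>{..<K} - {x}. \<sigma> r)"
    using assms by (subst sum.remove[of _ x]) (auto intro!: sum.cong)
  moreover have "(\<Sum>r<K. \<sigma> r) = \<sigma> x + (\<Sum>r\<in>{..<K} - {x}. \<sigma> r)"
    using assms by (subst sum.remove[of _ x]) auto
  ultimately show ?thesis by simp
qed

text \<open>The run fills the budget with \<open>B\<close> units and then repeats a period of length \<open>P\<close> forever.\<close>

lemma sem_imp_run:
  assumes sem: "sem c (\<lambda>r. if r = 0 then n else 0) (\<lambda>_. 0)" and K: "regs c \<subseteq> {..<K}" "0 < K"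
  obtains t v l where "run c n \<infinity> t" "run c n (enat l) t" "counter_run K \<infinity> t v" "\<And>p. exact_at K t v p"
    "0 < l" "tgt (t (l - 1)) = Run Skip" "\<And>r. 0 < r \<Longrightarrow> r \<le> K \<Longrightarrow> v r l = 0" "\<And>p. \<exists>q\<ge>p. lbl (t q) = Start"
proof -
  let ?\<sigma> = "\<lambda>r::nat. if r = 0 then n else 0"
  obtain L where "(cfg_step ^^ L) (c, ?\<sigma>) (Skip, \<lambda>_. 0)"
    using sem_cfg_steps[OF sem] by (auto simp: rtranclp_power)
  then obtain f where f: "f 0 = (c, ?\<sigma>)" "f L = (Skip, \<lambda>_. 0)" "\<And>i. i < L \<Longrightarrow> cfg_step (f i) (f (Suc i))"
    by (auto simp: relpowp_fun_conv)
  then have "\<forall>i. \<exists>q. i < L \<longrightarrow> sstep (fst (f i)) q (fst (f (Suc i))) \<and> op_step q (snd (f i)) (snd (f (Suc i)))"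
    by (auto simp: cfg_step_def)
  then obtain w where w: "\<And>i. i < L \<Longrightarrow> sstep (fst (f i)) (w i) (fst (f (Suc i)))"
    "\<And>i. i < L \<Longrightarrow> op_step (w i) (snd (f i)) (snd (f (Suc i)))"
    by metis
  have res: "fst (f i) \<in> residuals c" if "i \<le> L" for i
    using that by (induction i) (auto simp: f residuals_refl intro: residuals_sstep[OF _ w(1)])
  \<comment> \<open>One \<open>Start\<close>, \<open>n\<close> loads, one \<open>Nop\<close> into
    the program and \<open>L\<close> program steps.\<close>
  define P where "P = n + 2 + L"
  define node where "node j = (if j = 0 then Run Skip else if j \<le> Suc n then Lod else Run (fst (f (j - (n + 2)))))" for j
  define st where "st j = (if j = 0 then (\<lambda>_. 0) else if j \<le> Suc n then (\<lambda>r. if r = 0 then j - 1 else 0)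
    else snd (f (j - (n + 2))))" for j
  define op where "op j = (if j = 0 then Start else if j \<le> n then Load else if j = Suc n then Nop else w (j - (n + 2)))" for j
  have P: "1 + n < P" "0 < P" by (auto simp: P_def)
  have cases: "j = 0 \<or> (1 \<le> j \<and> j \<le> n) \<or> j = Suc n \<or> (\<exists>i<L. j = n + 2 + i)" if "j < P" for j
  proof -
    have "j = n + 2 + (j - (n + 2))" if "\<not> j \<le> Suc n" using that by simp
    with that show ?thesis unfolding P_def by (metis One_nat_def Suc_leI add_less_cancel_left le_SucE neq0_conv)
  qed
  have graph: "(node j, op j, node (Suc j)) \<in> graph c" if "j < P" for j
    using cases[OF that] w(1) res by (auto simp: node_def op_def graph_def f(1))
  have wproper: "proper (w i)" if "i < L" for i using sstep_proper[OF w(1)[OF that]] .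
  have node_P: "node P = Run Skip" and st_P: "st P = (\<lambda>_. 0)"
    by (auto simp: node_def st_def P_def f(2))
  have op_Start: "op j = Start \<longleftrightarrow> j = 0" if "j < P" for j
    using cases[OF that] wproper by (auto simp: op_def proper_def)
  have op_Fill: "op j \<noteq> Fill" if "j < P" for j
    using cases[OF that] wproper by (auto simp: op_def proper_def)
  have eff: "(op j = Start \<and> st j = (\<lambda>_. 0) \<and> st (Suc j) = (\<lambda>_. 0)) \<or>
      (op j = Load \<and> st (Suc j) = (st j)(0 := Suc (st j 0))) \<or> op_step (op j) (st j) (st (Suc j))" if "j < P" for j
    using cases[OF that]
  proof (elim disjE)
    assume "\<exists>i<L. j = n + 2 + i"
    then obtain i where "i < L" "j = n + 2 + i" by blast
    then show ?thesis using w(2) by (simp add: st_def op_def)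
  qed (auto simp: st_def op_def f(1) fun_eq_iff)
  define S where "S j = (\<Sum>r<K. st j r)" for j
  \<comment> \<open>A crude bound on the register contents within a period, enough for the budget
    never to run out.\<close>
  define B where "B = (\<Sum>j\<le>P. S j)"
  have SB: "S j \<le> B" if "j \<le> P" for j
    unfolding B_def using that by (intro member_le_sum) auto
  define ph where "ph p = (p - B) mod P" for p
  have ph_less: "ph p < P" for p using P by (simp add: ph_def)
  have ph_Suc: "ph (Suc p) = Suc (ph p) mod P" if "B \<le> p" for p
    using that by (simp add: ph_def Suc_diff_le mod_Suc_eq)
  \<comment> \<open>The computation ends with empty registers, which closes the period: phase
    \<open>P\<close> agrees with phase 0.\<close>
  have wrap: "node (Suc j mod P) = node (Suc j)" "st (Suc j mod P) = st (Suc j)" if "j < P" for j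
  proof -
    have "Suc j mod P = (if Suc j = P then 0 else Suc j)" using that by auto
    then show "node (Suc j mod P) = node (Suc j)" "st (Suc j mod P) = st (Suc j)"
      using node_P st_P by (auto simp: node_def st_def)
  qed
  \<comment> \<open>Only the first \<open>Start\<close> comes from \<open>Fil\<close>; all later
    ones come from \<open>Run Skip\<close>, which is \<open>node 0\<close>.\<close>
  define t where "t p = (if p < B then (Fil, Fill, Fil)
    else (if p = B then Fil else node (ph p), op (ph p), node (Suc (ph p))))" for p
  \<comment> \<open>Once the filling is over, budget and registers together always hold
    \<open>B\<close> units.\<close>
  define v where "v r p = (if p < B then (if r = 0 then p else 0)
    else (case r of 0 \<Rightarrow> B - S (ph p) | Suc r \<Rightarrow> st (ph p) r))" for r p
  have phB: "ph B = 0" by (simp add: ph_def)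
  have t_graph: "t p \<in> graph c" for p
    using graph[OF ph_less[of p]] by (auto simp: t_def phB op_def node_def graph_def)
  have t_succ: "tgt (t p) = src (t (Suc p))" for p
    using wrap(1)[OF ph_less[of p]] by (auto simp: t_def ph_Suc)
  have t_Fil: "src (t 0) = Fil" by (simp add: t_def)
  have t_Start: "B \<le> p \<and> ph p = 0" if "lbl (t p) = Start" for p
    using that op_Start[OF ph_less[of p]] by (auto simp: t_def split: if_splits)
  have after: "lbl (t (Suc p + i)) = op (Suc i)" if "lbl (t p) = Start" "i \<le> n" for p i
  proof -
    have "Suc p + i - B = (p - B) + Suc i" using t_Start[OF that(1)] by arith
    then have "ph (Suc p + i) = (ph p + Suc i) mod P" unfolding ph_def by (simp only: mod_add_left_eq)
    also have "\<dots> = Suc i" using t_Start[OF that(1)] that(2) P by simp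
    finally show ?thesis using t_Start[OF that(1)] by (simp add: t_def)
  qed
  have run: "run c n \<infinity> t"
    using t_graph t_succ t_Fil after by (auto simp: run_def op_def)
  have run': "run c n (enat (B + P)) t"
  proof -
    \<comment> \<open>The only \<open>Start\<close> before \<open>B + P\<close> is at
      \<open>B\<close>, so its block of loads fits into the finite prefix.\<close>
    have "Suc p + i < B + P" if "lbl (t p) = Start" "p < B + P" "i \<le> n" for p i
    proof -
      have "p - B < P" "(p - B) mod P = 0" "B \<le> p" using that t_Start[OF that(1)] by (auto simp: ph_def)
      then have "p = B" by simp
      then show ?thesis using that(3) P by simp
    qed
    then show ?thesis using t_graph t_succ t_Fil after by (auto simp: run_def op_def)
  qed
  have regs: "op_regs (op j) \<subseteq> {..<K}" if "j < P" for j
    using graph_regs[OF graph[OF that]] K(1) by auto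
  have step: "(r \<in> decs (lbl (t p)) \<longrightarrow> 0 < v r p) \<and> (r \<in> tests (lbl (t p)) \<longrightarrow> v r p = 0) \<and>
      v r (Suc p) = (if r \<in> tests (lbl (t p)) then 0 else if r \<in> incs (lbl (t p)) then Suc (v r p)
        else if r \<in> decs (lbl (t p)) then v r p - 1 else v r p)" if r: "r \<le> K" for r p
  proof (cases "p < B")
    case True
    then consider "Suc p < B" | "Suc p = B" by linarith
    then show ?thesis
      by cases (use True in \<open>auto simp: t_def v_def phB st_def S_def split: nat.split\<close>)
  next
    case False
    define j where "j = ph p"
    have j: "j < P" by (simp add: j_def ph_less)
    have vp: "v r p = (case r of 0 \<Rightarrow> B - S j | Suc r \<Rightarrow> st j r)"
      and vS: "v r (Suc p) = (case r of 0 \<Rightarrow> B - S (Suc j) | Suc r \<Rightarrow> st (Suc j) r)"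
      and lp: "lbl (t p) = op j"
      using False wrap(2)[OF j] by (auto simp: v_def t_def j_def ph_Suc S_def split: nat.split)
    have SjB: "S j \<le> B" "S (Suc j) \<le> B" using SB j by auto
    have upd: "S (Suc j) + st j x = S j + y" if "st (Suc j) = (st j)(x := y)" "x < K" for x y
      unfolding S_def that(1) using sum_fun_upd[OF that(2)] .
    have le: "st j x \<le> S j" if "x < K" for x
      unfolding S_def using that by (intro member_le_sum) auto
    from eff[OF j] show ?thesis
    proof (elim disjE conjE)
      assume a: "op j = Load" "st (Suc j) = (st j)(0 := Suc (st j 0))"
      from upd[OF a(2) K(2)] a SjB show ?thesis by (cases r; use vp vS in \<open>auto simp: lp\<close>)
    next
      assume a: "op_step (op j) (st j) (st (Suc j))"
      show ?thesis
      proof (cases "op j")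
        case (Inc x)
        with a have s: "st (Suc j) = (st j)(x := Suc (st j x))" by simp
        moreover have "x < K" using regs[OF j] Inc by simp
        ultimately show ?thesis using upd[OF s] Inc SjB by (cases r; use vp vS in \<open>auto simp: lp\<close>)
      next
        case (Dec x)
        with a have s: "st (Suc j) = (st j)(x := st j x - 1)" "0 < st j x" by simp_all
        moreover have "x < K" using regs[OF j] Dec by simp
        ultimately show ?thesis using upd[OF s(1)] le[of x] Dec SjB by (cases r; use vp vS in \<open>auto simp: lp\<close>)
      next
        case (Test x)
        with a show ?thesis by (cases r; use vp vS in \<open>auto simp: lp S_def\<close>)
      next
        case Nop
        with a show ?thesis by (cases r; use vp vS in \<open>auto simp: lp S_def\<close>)
      qed (use a in auto)
    next
      assume "op j = Start" "st j = (\<lambda>_. 0)" "st (Suc j) = (\<lambda>_. 0)"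
      then show ?thesis by (cases r; use vp vS in \<open>auto simp: lp S_def\<close>)
    qed
  qed
  have "ph 0 = 0" by (simp add: ph_def)
  then have "v r 0 = 0" for r
    by (cases "0 < B") (auto simp: v_def S_def st_def split: nat.split)
  then have cr: "counter_run K \<infinity> t v" using step by (auto simp: counter_run_def counts_def)
  have ex: "exact_at K t v p" for p using step by (auto simp: exact_at_def)
  have "ph (B + P - 1) = P - 1" using P by (simp add: ph_def)
  then have last: "tgt (t (B + P - 1)) = Run Skip" using P node_P by (simp add: t_def)
  have final: "v r (B + P) = 0" if "0 < r" for r
    using that by (cases r) (auto simp: v_def ph_def st_def)
  have inf: "\<exists>q\<ge>p. lbl (t q) = Start" for p
  proof (intro exI conjI)
    have "p * 1 \<le> p * P" using P by (intro mult_le_mono) auto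
    then show "p \<le> B + p * P" by linarith
    show "lbl (t (B + p * P)) = Start" by (simp add: t_def ph_def op_def)
  qed
  show thesis by (rule that[OF run run' cr ex _ last final inf]) (use P in auto)
qed


section \<open>Runs as data words\<close>

text \<open>Disjoint chains of length two, one per counter. The recursion on their number makes the
  code of the list a recursive function of it.\<close>

primrec attr_pairs :: "nat \<Rightarrow> (nat \<times> nat) list" where
  "attr_pairs 0 = []"
| "attr_pairs (Suc k) = (2 * k, 2 * k) # (2 * k, 2 * k + 1) # (2 * k + 1, 2 * k + 1) # attr_pairs k"

lemma set_attr_pairs: "set (attr_pairs k) = {(i, j). i \<le> j \<and> j < 2 * k \<and> i div 2 = j div 2}"
proof (induction k)
  case (Suc k)
  have "{(i, j). i \<le> j \<and> j < 2 * Suc k \<and> i div 2 = j div 2} =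
      {(2 * k, 2 * k), (2 * k, 2 * k + 1), (2 * k + 1, 2 * k + 1)} \<union> {(i, j). i \<le> j \<and> j < 2 * k \<and> i div 2 = j div 2}"
  proof (intro set_eqI, clarify)
    fix i j
    have "j < 2 * Suc k \<longleftrightarrow> j < 2 * k \<or> j = 2 * k \<or> j = 2 * k + 1" by auto
    moreover have "i \<le> 2 * k \<and> i div 2 = 2 * k div 2 \<longleftrightarrow> i = 2 * k" by auto
    moreover have "i \<le> 2 * k + 1 \<and> i div 2 = (2 * k + 1) div 2 \<longleftrightarrow> i = 2 * k \<or> i = 2 * k + 1" by auto
    ultimately show "(i, j) \<in> {(i, j). i \<le> j \<and> j < 2 * Suc k \<and> i div 2 = j div 2} \<longleftrightarrow> (i, j) \<in>
        {(2 * k, 2 * k), (2 * k, 2 * k + 1), (2 * k + 1, 2 * k + 1)} \<union> {(i, j). i \<le> j \<and> j < 2 * k \<and> i div 2 = j div 2}"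
      by blast
  qed
  with Suc show ?case by simp
qed auto

abbreviation attr_order :: "nat \<Rightarrow> nat rel" where
  "attr_order k \<equiv> set (attr_pairs k)"

lemma under_attr_order: "z < 2 * k \<Longrightarrow> under (attr_order k) z = {u. u \<le> z \<and> u div 2 = z div 2}"
  by (auto simp: under_def set_attr_pairs)

lemma under_coarse: "r < k \<Longrightarrow> under (attr_order k) (2 * r) = {2 * r}"
proof -
  assume "r < k"
  then have *: "2 * r < 2 * k" by simp
  have "u \<le> 2 * r \<and> u div 2 = 2 * r div 2 \<longleftrightarrow> u = 2 * r" for u by auto
  then show ?thesis unfolding under_attr_order[OF *] by simp
qed

lemma under_fine: "r < k \<Longrightarrow> under (attr_order k) (2 * r + 1) = {2 * r, 2 * r + 1}"
proof -
  assume "r < k"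
  then have *: "2 * r + 1 < 2 * k" by simp
  have "u \<le> 2 * r + 1 \<and> u div 2 = (2 * r + 1) div 2 \<longleftrightarrow> u = 2 * r \<or> u = 2 * r + 1" for u by auto
  then show ?thesis unfolding under_attr_order[OF *] by auto
qed

lemma tree_order_fibres: "tree_order_on {..<n} {(i, j). i \<le> j \<and> j < n \<and> f i = f (j :: nat)}"
proof -
  let ?R = "{(i, j). i \<le> j \<and> j < n \<and> f i = f j}"
  have trans: "trans ?R" by (rule transI) (unfold mem_Collect_eq prod.case, metis order_trans)
  have antisym: "antisym ?R" by (rule antisymI) (unfold mem_Collect_eq prod.case, metis order_antisym)
  have partial: "partial_order_on A (Restr ?R A)" if "A \<subseteq> {..<n}" for A
    using that trans_Restr[OF trans] antisym
    by (auto simp: partial_order_on_def preorder_on_def intro!: refl_onI intro: antisym_subset)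
  have "Restr ?R {..<n} = ?R" by auto
  with partial[of "{..<n}"] have "partial_order_on {..<n} ?R" by simp
  moreover have "linear_order_on (under ?R z) (Restr ?R (under ?R z))" if "z < n" for z
  proof -
    have "under ?R z \<subseteq> {..<n}" using that by (auto simp: under_def)
    moreover have "total_on (under ?R z) (Restr ?R (under ?R z))"
    proof (rule total_onI)
      fix x y
      assume x: "x \<in> under ?R z" and y: "y \<in> under ?R z"
      then have "x \<le> z" "y \<le> z" "f x = f y" by (simp_all add: under_def)
      then have "(x, y) \<in> ?R \<or> (y, x) \<in> ?R" using that by (cases "x \<le> y") simp_all
      with x y show "(x, y) \<in> Restr ?R (under ?R z) \<or> (y, x) \<in> Restr ?R (under ?R z)" by blast
    qed
    ultimately show ?thesis using partial by (simp add: linear_order_on_def)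
  qed
  ultimately show ?thesis by (simp add: tree_order_on_def)
qed

lemma tree_order_attr_order: "tree_order_on {..<2 * k} (attr_order k)"
  unfolding set_attr_pairs by (rule tree_order_fibres)

text \<open>\<open>enum_chain\<close> is a definite description, so such a list must be shown to
  exist and to be unique: it is the strictly sorted one. Afterwards only its set of entries
  matters.\<close>

lemma set_enum_chain:
  assumes "z < 2 * k"
  shows "set (enum_chain (attr_order k) (under (attr_order k) z)) = under (attr_order k) z"
proof -
  let ?S = "under (attr_order k) z"
  let ?Q = "\<lambda>xs. set xs = ?S \<and> sorted_wrt (\<lambda>x y. (x, y) \<in> attr_order k \<and> x \<noteq> y) xs"
  have S: "?S = {u. u \<le> z \<and> u div 2 = z div 2}" using under_attr_order[OF assms] .
  then have fin: "finite ?S" by simp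
  have "sorted_wrt (<) (sorted_list_of_set ?S)" by simp
  then have "sorted_wrt (\<lambda>x y. (x, y) \<in> attr_order k \<and> x \<noteq> y) (sorted_list_of_set ?S)"
    by (rule sorted_wrt_mono_rel[rotated])
      (use fin S assms in \<open>auto simp: set_attr_pairs\<close>)
  then have "?Q (sorted_list_of_set ?S)" using fin by simp
  moreover have "xs = sorted_list_of_set ?S" if "?Q xs" for xs
  proof -
    have "sorted_wrt (<) xs"
      by (rule sorted_wrt_mono_rel[OF _ conjunct2[OF that]]) (auto simp: set_attr_pairs)
    then show ?thesis using that fin by (intro strict_sorted_equal) auto
  qed
  ultimately have "?Q (enum_chain (attr_order k) ?S)"
    unfolding enum_chain_def by (rule theI)
  then show ?thesis by blast
qed

text \<open>Both valuations have the same domain and are read off along the same enumeration, so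
  equal vectors mean equal data.\<close>

lemma val_equiv_restr:
  assumes "z < 2 * k"
  shows "val_equiv (attr_order k) (restr (attr_order k) d z) (restr (attr_order k) d' z) \<longleftrightarrow>
    (\<forall>u\<in>under (attr_order k) z. d u = d' u)"
proof -
  have dom: "dom (restr (attr_order k) d z) = under (attr_order k) z" for d :: "nat \<Rightarrow> 'd"
    by (auto simp: restr_def restrict_map_def split: if_splits)
  have the: "(the \<circ> restr (attr_order k) d z) u = d u" if "u \<in> under (attr_order k) z" for d :: "nat \<Rightarrow> 'd" and u
    using that by (simp add: restr_def)
  show ?thesis
    unfolding val_equiv_def vec_def dom map_eq_conv set_enum_chain[OF assms] using the by (metis (lifting))
qed

text \<open>Vectors do not name their attributes, so a class may also contain positions where
  another attribute carries the same vector. Guarding both arguments with \<open>At a\<close> makes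
  these positions harmless.\<close>

lemma csat_SinceEq_At:
  assumes "a \<in> A" "enat i < wlen w"
  shows "csat A R w (SinceEq (CNot (CAnd (At a) \<beta>)) (CAnd (At a) \<alpha>)) i v \<longleftrightarrow>
    (\<exists>j\<le>i. csat A R w (At a) j v \<and> csat A R w \<alpha> j v \<and>
      (\<forall>k. j < k \<and> k \<le> i \<and> csat A R w (At a) k v \<longrightarrow> \<not> csat A R w \<beta> k v))"
proof -
  have "j \<in> class_pos A R w v" if "j \<le> i" "csat A R w (At a) j v" for j
    using assms that unfolding class_pos_def
    by (auto simp: val_equiv_def intro!: bexI[of _ a]) (metis enat_ord_simps(1) order_le_less_trans)
  then show ?thesis by auto
qed

lemma csat_UntilEq_At:
  assumes "a \<in> A"
  shows "csat A R w (UntilEq (CNot (CAnd (At a) \<beta>)) (CAnd (At a) \<alpha>)) i v \<longleftrightarrow>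
    (\<exists>j\<ge>i. enat j < wlen w \<and> csat A R w (At a) j v \<and> csat A R w \<alpha> j v \<and>
      (\<forall>k. i \<le> k \<and> k < j \<and> csat A R w (At a) k v \<longrightarrow> \<not> csat A R w \<beta> k v))"
proof -
  have 1: "j \<in> class_pos A R w v" if "enat j < wlen w" "csat A R w (At a) j v" for j
    using assms that unfolding class_pos_def by (auto simp: val_equiv_def intro!: bexI[of _ a])
  have 2: "enat j < wlen w" if "j \<in> class_pos A R w v" for j
    using that by (simp add: class_pos_def)
  have 3: "enat k < wlen w" if "k < j" "enat j < wlen w" for j k
    using that by (metis enat_ord_simps(2) order_less_trans)
  show ?thesis using 1 2 3 by (auto; blast)
qed

section \<open>Derived connectives\<close>

text \<open>The syntax has no truth constant, so a tautology in proposition 0 is used. This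
  proposition exists anyway as the mark of \<open>Start\<close>.\<close>

definition PTrue :: "(nat, 'a) pform" where
  "PTrue = PNot (PAnd (Prop 0) (PNot (Prop 0)))"

definition PImp :: "('p, 'a) pform \<Rightarrow> ('p, 'a) pform \<Rightarrow> ('p, 'a) pform" where
  "PImp \<phi> \<psi> = PNot (PAnd \<phi> (PNot \<psi>))"

definition Conj :: "(nat, 'a) pform list \<Rightarrow> (nat, 'a) pform" where
  "Conj \<phi>s = foldr PAnd \<phi>s PTrue"

definition Disj :: "(nat, 'a) pform list \<Rightarrow> (nat, 'a) pform" where
  "Disj \<phi>s = PNot (Conj (map PNot \<phi>s))"

definition Always :: "(nat, 'a) pform \<Rightarrow> (nat, 'a) pform" where
  "Always \<phi> = PNot (Until PTrue (PNot \<phi>))"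

lemma psat_PTrue [simp]: "psat A R w PTrue i"
  by (simp add: PTrue_def)

lemma psat_PImp [simp]: "psat A R w (PImp \<phi> \<psi>) i \<longleftrightarrow> (psat A R w \<phi> i \<longrightarrow> psat A R w \<psi> i)"
  by (simp add: PImp_def)

lemma psat_Conj [simp]: "psat A R w (Conj \<phi>s) i \<longleftrightarrow> (\<forall>\<phi>\<in>set \<phi>s. psat A R w \<phi> i)"
  by (induction \<phi>s) (auto simp: Conj_def)

lemma psat_Disj [simp]: "psat A R w (Disj \<phi>s) i \<longleftrightarrow> (\<exists>\<phi>\<in>set \<phi>s. psat A R w \<phi> i)"
  by (simp add: Disj_def)

lemma psat_Always [simp]:
  "psat A R w (Always \<phi>) i \<longleftrightarrow> (\<forall>j\<ge>i. enat j < wlen w \<longrightarrow> psat A R w \<phi> j)"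
  by (auto simp: Always_def)

lemma psat_Always_Conj3:
  "psat A R w (Always (Conj [\<phi>, \<chi>, \<psi>])) 0 \<longleftrightarrow> (\<forall>p. enat p < wlen w \<longrightarrow> psat A R w \<phi> p) \<and>
     (\<forall>p. enat p < wlen w \<longrightarrow> psat A R w \<chi> p) \<and> (\<forall>p. enat p < wlen w \<longrightarrow> psat A R w \<psi> p)"
  by auto

lemma past_pform_Conj [simp]: "past_pform (Conj \<phi>s) \<longleftrightarrow> (\<forall>\<phi>\<in>set \<phi>s. past_pform \<phi>)"
  by (induction \<phi>s) (auto simp: Conj_def PTrue_def)

lemma past_pform_simps [simp]:
  "past_pform PTrue"
  "past_pform (PImp \<phi> \<psi>) \<longleftrightarrow> past_pform \<phi> \<and> past_pform \<psi>"
  "past_pform (Disj \<phi>s) \<longleftrightarrow> (\<forall>\<phi>\<in>set \<phi>s. past_pform \<phi>)"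
  "past_pform (Always \<phi>) \<longleftrightarrow> past_pform \<phi>"
  by (simp_all add: PTrue_def PImp_def Disj_def Always_def)

lemma pform_over_Conj: "pform_over P A (Conj \<phi>s) \<longleftrightarrow> 0 \<in> P \<and> (\<forall>\<phi>\<in>set \<phi>s. pform_over P A \<phi>)"
  by (induction \<phi>s) (auto simp: Conj_def PTrue_def)

lemma pform_over_Disj: "pform_over P A (Disj \<phi>s) \<longleftrightarrow> 0 \<in> P \<and> (\<forall>\<phi>\<in>set \<phi>s. pform_over P A \<phi>)"
  by (simp add: Disj_def pform_over_Conj)

section \<open>Formulae that describe runs\<close>

locale edge_encoding =
  fixes c :: prog and es :: "edge list" and lab :: "edge \<Rightarrow> nat set" and M :: nat
  assumes es: "set es = graph c" and lab_inj: "inj_on lab (graph c)"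
    and lab_less: "e \<in> graph c \<Longrightarrow> lab e \<subseteq> {..<M}" and M: "2 \<le> M"
    and lab_Start: "e \<in> graph c \<Longrightarrow> 0 \<in> lab e \<longleftrightarrow> lbl e = Start"
    and lab_Load: "e \<in> graph c \<Longrightarrow> Suc 0 \<in> lab e \<longleftrightarrow> lbl e = Load"
begin

definition letter :: "nat set \<Rightarrow> (nat, nat) pform" where
  "letter S = Conj (map (\<lambda>p. if p \<in> S then Prop p else PNot (Prop p)) [0..<M])"

text \<open>Propositions from \<open>M\<close> on remain free, as the signature of an instance may
  exceed the labels.\<close>

lemma psat_letter: "S \<subseteq> {..<M} \<Longrightarrow> psat A R w (letter S) i \<longleftrightarrow> props_at w i \<inter> {..<M} = S"
  unfolding letter_def psat_Conj set_map ball_simps by (auto split: if_splits)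

definition edge_in :: "(edge \<Rightarrow> bool) \<Rightarrow> (nat, nat) pform" where
  "edge_in X = Disj (map (\<lambda>e. letter (lab e)) (filter X es))"

lemma psat_edge_in:
  "psat A R w (edge_in X) i \<longleftrightarrow> (\<exists>e\<in>graph c. X e \<and> props_at w i \<inter> {..<M} = lab e)"
proof -
  have *: "psat A R w (letter (lab e)) i \<longleftrightarrow> props_at w i \<inter> {..<M} = lab e" if "e \<in> graph c" for e
    using psat_letter[OF lab_less[OF that]] .
  show ?thesis unfolding edge_in_def by (auto simp: es *)
qed

lemma past_edge_in [simp]: "past_pform (edge_in X)"
  by (auto simp: edge_in_def letter_def)

lemma pform_over_edge_in:
  assumes "pform_over P A (edge_in X)" "e \<in> graph c" "X e"
  shows "{..<M} \<subseteq> P"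
proof -
  have "pform_over P A (letter (lab e))"
    using assms unfolding edge_in_def pform_over_Disj set_map set_filter es by blast
  then have "\<forall>p\<in>set [0..<M]. pform_over P A (if p \<in> lab e then Prop p else PNot (Prop p))"
    unfolding letter_def pform_over_Conj set_map ball_simps by blast
  then show ?thesis by (auto split: if_splits)
qed

text \<open>The doubly negated \<open>Next\<close> is the weak next operator, which holds at the
  last position of a finite word.\<close>

definition path_form :: "(nat, nat) pform" where
  "path_form = PAnd (edge_in (\<lambda>e. src e = Fil)) (Always (PAnd (edge_in (\<lambda>_. True))
     (Conj (map (\<lambda>e. PImp (edge_in (\<lambda>e'. e' = e)) (PNot (Next (PNot (edge_in (\<lambda>e'. src e' = tgt e)))))) es))))"

abbreviation "inc_form r \<equiv> edge_in (\<lambda>e. r \<in> incs (lbl e))"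
abbreviation "dec_form r \<equiv> edge_in (\<lambda>e. r \<in> decs (lbl e))"
abbreviation "test_form r \<equiv> edge_in (\<lambda>e. r \<in> tests (lbl e))"

text \<open>Attribute \<open>2 * r\<close> identifies the period between two tests of counter \<open>r\<close>, and
  attribute \<open>2 * r + 1\<close> identifies a unit of the counter within such a period.\<close>

definition past_form :: "nat \<Rightarrow> (nat, nat) pform" where
  "past_form r = Always (Conj
    [PImp (PAnd (PNot (test_form r)) (Next PTrue)) (Class 1 (2 * r) (At (2 * r))),
     PImp (Prev (test_form r)) (PNot (Class (-1) (2 * r)
       (SinceEq (CNot (CAnd (At (2 * r)) (CNot (Pos PTrue)))) (CAnd (At (2 * r)) (Pos PTrue))))),
     PImp (dec_form r) (Class (-1) (2 * r + 1)
       (SinceEq (CNot (CAnd (At (2 * r + 1)) (Pos (dec_form r)))) (CAnd (At (2 * r + 1)) (Pos (inc_form r)))))])"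

definition future_form :: "nat \<Rightarrow> (nat, nat) pform" where
  "future_form r = Always (PImp (inc_form r) (Class 1 (2 * r + 1)
     (UntilEq (CNot (CAnd (At (2 * r + 1)) (Pos (inc_form r)))) (CAnd (At (2 * r + 1)) (Pos (dec_form r))))))"

definition final_form :: "(nat, nat) pform" where
  "final_form = Until PTrue (PAnd (PNot (Next PTrue)) (edge_in (\<lambda>e. tgt e = Run Skip)))"

definition recurrence_form :: "(nat, nat) pform" where
  "recurrence_form = Always (Until PTrue (edge_in (\<lambda>e. lbl e = Start)))"

lemma psat_path_form_labels:
  assumes "psat A R w path_form 0"
  shows "\<exists>t. \<forall>p. enat p < wlen w \<longrightarrow> t p \<in> graph c \<and> props_at w p \<inter> {..<M} = lab (t p)"
proof -
  have "\<forall>p. \<exists>e. enat p < wlen w \<longrightarrow> e \<in> graph c \<and> props_at w p \<inter> {..<M} = lab e"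
    using assms unfolding path_form_def psat.simps psat_Always psat_edge_in by blast
  then show ?thesis by metis
qed

end

text \<open>Once the edges \<open>t\<close> behind the labels are fixed, formulae become statements
  about \<open>t\<close> and the data. Both directions use this: for a given model \<open>t\<close>
  is read off its labels, and for a given run the word is built from \<open>t\<close>.\<close>

locale labelled_word = edge_encoding +
  fixes w :: "(nat, nat, 'd) data_word" and k :: nat and t :: "nat \<Rightarrow> edge"
  assumes t: "enat p < wlen w \<Longrightarrow> t p \<in> graph c" "enat p < wlen w \<Longrightarrow> props_at w p \<inter> {..<M} = lab (t p)"
    and nonempty: "0 < wlen w"
begin

abbreviation sat :: "(nat, nat) pform \<Rightarrow> nat \<Rightarrow> bool" where
  "sat \<equiv> psat {..<2 * k} (attr_order k) w"

lemma sat_edge_in: "enat p < wlen w \<Longrightarrow> sat (edge_in X) p \<longleftrightarrow> X (t p)"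
  using t lab_inj by (auto simp: psat_edge_in dest: inj_onD)

lemma below_len: "q \<le> p \<Longrightarrow> enat p < wlen w \<Longrightarrow> enat q < wlen w"
  by (metis enat_ord_simps(1) order_le_less_trans)

lemma sat_path_form:
  "sat path_form 0 \<longleftrightarrow> src (t 0) = Fil \<and> (\<forall>p. enat (Suc p) < wlen w \<longrightarrow> tgt (t p) = src (t (Suc p)))"
proof -
  have "enat 0 < wlen w" using nonempty by (simp add: zero_enat_def)
  moreover have "sat (Conj (map (\<lambda>e. PImp (edge_in (\<lambda>e'. e' = e))
        (PNot (Next (PNot (edge_in (\<lambda>e'. src e' = tgt e)))))) es)) p \<longleftrightarrow>
      (enat (Suc p) < wlen w \<longrightarrow> tgt (t p) = src (t (Suc p)))" if "enat p < wlen w" for p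
    using that t(1)[OF that] by (auto simp: sat_edge_in es)
  moreover have "enat p < wlen w" if "enat (Suc p) < wlen w" for p
    using below_len[OF _ that] by simp
  ultimately show ?thesis unfolding path_form_def by (auto simp: sat_edge_in)
qed

lemma props_at_iff: "enat p < wlen w \<Longrightarrow> q < M \<Longrightarrow> q \<in> props_at w p \<longleftrightarrow> q \<in> lab (t p)"
  using t(2)[of p] by blast

lemma sat_Start: "enat p < wlen w \<Longrightarrow> sat (Prop 0) p \<longleftrightarrow> lbl (t p) = Start"
  using props_at_iff[of p 0] lab_Start[OF t(1)] M by simp

lemma sat_Load: "enat p < wlen w \<Longrightarrow> sat (Prop 1) p \<longleftrightarrow> lbl (t p) = Load"
  using props_at_iff[of p 1] lab_Load[OF t(1)] M by simp

text \<open>\<open>Class (-1)\<close> keeps the data of the current position but evaluates at the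
  one before, so the past operators look strictly back. At position 0 it fails, in accordance with
  the lack of an earlier position.\<close>

lemma sat_past_form:
  assumes "r < k"
  shows "sat (past_form r) 0 \<longleftrightarrow> tokens_past (wlen w) (\<lambda>p. r \<in> incs (lbl (t p))) (\<lambda>p. r \<in> decs (lbl (t p)))
    (\<lambda>p. r \<in> tests (lbl (t p))) (\<lambda>p. data_at w p (2 * r)) (\<lambda>p. data_at w p (2 * r + 1))"
    (is "_ \<longleftrightarrow> tokens_past _ ?I ?D ?Z ?x ?y")
proof -
  let ?A = "{..<2 * k}" and ?R = "attr_order k"
  have coarse: "csat ?A ?R w (At (2 * r)) j (restr ?R (data_at w p) (2 * r)) \<longleftrightarrow> ?x j = ?x p" for j p
    using assms by (simp add: val_equiv_restr under_coarse)
  have fine: "csat ?A ?R w (At (2 * r + 1)) j (restr ?R (data_at w p) (2 * r + 1)) \<longleftrightarrow> ?x j = ?x p \<and> ?y j = ?y p" for j p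
    using assms val_equiv_restr[of "2 * r + 1" k] under_fine[OF assms] by simp
  have 1: "sat (PImp (PAnd (PNot (test_form r)) (Next PTrue)) (Class 1 (2 * r) (At (2 * r)))) p \<longleftrightarrow>
      (\<not> ?Z p \<and> enat (Suc p) < wlen w \<longrightarrow> ?x (Suc p) = ?x p)" if "enat p < wlen w" for p
    using that coarse[of "Suc p" p] by (auto simp: sat_edge_in nat_add_distrib)
  have 2: "sat (PImp (Prev (test_form r)) (PNot (Class (-1) (2 * r)
       (SinceEq (CNot (CAnd (At (2 * r)) (CNot (Pos PTrue)))) (CAnd (At (2 * r)) (Pos PTrue)))))) (Suc p) \<longleftrightarrow>
      (?Z p \<longrightarrow> (\<forall>j\<le>p. ?x j \<noteq> ?x (Suc p)))" if "enat (Suc p) < wlen w" for p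
  proof -
    have p: "enat p < wlen w" using below_len[OF _ that] by simp
    \<comment> \<open>The blocking condition is never met here, so \<open>SinceEq\<close> merely
      asks for some position up to \<open>p\<close> with the coarse value of
      \<open>Suc p\<close>.\<close>
    have "csat ?A ?R w (SinceEq (CNot (CAnd (At (2 * r)) (CNot (Pos PTrue)))) (CAnd (At (2 * r)) (Pos PTrue)))
        p (restr ?R (data_at w (Suc p)) (2 * r)) \<longleftrightarrow> (\<exists>j\<le>p. ?x j = ?x (Suc p))"
      using assms p by (subst csat_SinceEq_At) (simp_all only: coarse, simp_all)
    then show ?thesis using p that by (simp add: sat_edge_in del: csat.simps(7))
  qed
  have base: "sat (PImp (Prev (test_form r)) \<phi>) 0" for \<phi> by simp
  have 3: "sat (PImp (dec_form r) (Class (-1) (2 * r + 1)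
       (SinceEq (CNot (CAnd (At (2 * r + 1)) (Pos (dec_form r)))) (CAnd (At (2 * r + 1)) (Pos (inc_form r)))))) p \<longleftrightarrow>
      (?D p \<longrightarrow> (\<exists>j<p. ?x j = ?x p \<and> ?y j = ?y p \<and> ?I j \<and>
        (\<forall>k. j < k \<and> k < p \<and> ?x k = ?x p \<and> ?y k = ?y p \<longrightarrow> \<not> ?D k)))" if p: "enat p < wlen w" for p
  proof (cases p)
    case 0
    then show ?thesis using p by (simp add: sat_edge_in)
  next
    case (Suc q)
    have q: "enat q < wlen w" using below_len[OF _ p] Suc by simp
    have "csat ?A ?R w (SinceEq (CNot (CAnd (At (2 * r + 1)) (Pos (dec_form r)))) (CAnd (At (2 * r + 1)) (Pos (inc_form r))))
        q (restr ?R (data_at w p) (2 * r + 1)) \<longleftrightarrow> (\<exists>j\<le>q. (?x j = ?x p \<and> ?y j = ?y p) \<and> ?I j \<and>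
        (\<forall>k. j < k \<and> k \<le> q \<and> ?x k = ?x p \<and> ?y k = ?y p \<longrightarrow> \<not> ?D k))"
      using assms q by (subst csat_SinceEq_At) (simp_all only: fine csat.simps(8), auto simp: sat_edge_in below_len[OF _ q])
    then show ?thesis using p q Suc
      by (simp add: sat_edge_in less_Suc_eq_le del: csat.simps(7))
  qed
  \<comment> \<open>\<open>Prev\<close> fails at position 0, so this conjunct speaks about
    successors only.\<close>
  have shift: "(\<forall>p. enat p < wlen w \<longrightarrow> sat (PImp (Prev (test_form r)) \<phi>) p) \<longleftrightarrow>
      (\<forall>p. enat (Suc p) < wlen w \<longrightarrow> sat (PImp (Prev (test_form r)) \<phi>) (Suc p))" for \<phi>
    using base by (metis not0_implies_Suc)
  have pred: "enat p < wlen w" if "enat (Suc p) < wlen w" for p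
    using below_len[OF _ that] by simp
  have "sat (past_form r) 0 \<longleftrightarrow>
      (\<forall>p. enat p < wlen w \<longrightarrow> sat (PImp (PAnd (PNot (test_form r)) (Next PTrue)) (Class 1 (2 * r) (At (2 * r)))) p) \<and>
      (\<forall>p. enat p < wlen w \<longrightarrow> sat (PImp (Prev (test_form r)) (PNot (Class (-1) (2 * r)
       (SinceEq (CNot (CAnd (At (2 * r)) (CNot (Pos PTrue)))) (CAnd (At (2 * r)) (Pos PTrue)))))) p) \<and>
      (\<forall>p. enat p < wlen w \<longrightarrow> sat (PImp (dec_form r) (Class (-1) (2 * r + 1)
       (SinceEq (CNot (CAnd (At (2 * r + 1)) (Pos (dec_form r)))) (CAnd (At (2 * r + 1)) (Pos (inc_form r)))))) p)"
    unfolding past_form_def by (rule psat_Always_Conj3)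
  also have "\<dots> \<longleftrightarrow>
      (\<forall>p. enat (Suc p) < wlen w \<longrightarrow> \<not> ?Z p \<longrightarrow> ?x (Suc p) = ?x p) \<and>
      (\<forall>p. enat (Suc p) < wlen w \<longrightarrow> ?Z p \<longrightarrow> (\<forall>j\<le>p. ?x j \<noteq> ?x (Suc p))) \<and>
      (\<forall>p. enat p < wlen w \<longrightarrow> ?D p \<longrightarrow> (\<exists>j<p. ?x j = ?x p \<and> ?y j = ?y p \<and> ?I j \<and>
        (\<forall>k. j < k \<and> k < p \<and> ?x k = ?x p \<and> ?y k = ?y p \<longrightarrow> \<not> ?D k)))"
    unfolding shift by (intro arg_cong2[where f = "(\<and>)"] all_cong1) (use 1 2 3 pred in blast)+
  also have "\<dots> \<longleftrightarrow> tokens_past (wlen w) ?I ?D ?Z ?x ?y"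
    unfolding tokens_past_def by (simp only: if_bool_eq_conj) blast
  finally show ?thesis .
qed

lemma sat_future_form:
  assumes "r < k"
  shows "sat (future_form r) 0 \<longleftrightarrow> tokens_future (wlen w) (\<lambda>p. r \<in> incs (lbl (t p))) (\<lambda>p. r \<in> decs (lbl (t p)))
    (\<lambda>p. data_at w p (2 * r)) (\<lambda>p. data_at w p (2 * r + 1))"
    (is "_ \<longleftrightarrow> tokens_future _ ?I ?D ?x ?y")
proof -
  let ?A = "{..<2 * k}" and ?R = "attr_order k"
  have fine: "csat ?A ?R w (At (2 * r + 1)) j (restr ?R (data_at w p) (2 * r + 1)) \<longleftrightarrow> ?x j = ?x p \<and> ?y j = ?y p" for j p
    using assms val_equiv_restr[of "2 * r + 1" k] under_fine[OF assms] by simp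
  have "sat (Class 1 (2 * r + 1)
     (UntilEq (CNot (CAnd (At (2 * r + 1)) (Pos (inc_form r)))) (CAnd (At (2 * r + 1)) (Pos (dec_form r))))) p \<longleftrightarrow>
     (\<exists>j>p. enat j < wlen w \<and> ?x j = ?x p \<and> ?y j = ?y p \<and> ?D j \<and>
        (\<forall>k. p < k \<and> k < j \<and> ?x k = ?x p \<and> ?y k = ?y p \<longrightarrow> \<not> ?I k))" for p
  proof -
    have "csat ?A ?R w (UntilEq (CNot (CAnd (At (2 * r + 1)) (Pos (inc_form r)))) (CAnd (At (2 * r + 1)) (Pos (dec_form r))))
        (Suc p) (restr ?R (data_at w p) (2 * r + 1)) \<longleftrightarrow>
        (\<exists>j\<ge>Suc p. enat j < wlen w \<and> (?x j = ?x p \<and> ?y j = ?y p) \<and> sat (dec_form r) j \<and>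
        (\<forall>k. Suc p \<le> k \<and> k < j \<and> (?x k = ?x p \<and> ?y k = ?y p) \<longrightarrow> \<not> sat (inc_form r) k))"
      using assms by (subst csat_UntilEq_At) (simp_all only: fine csat.simps(8), simp)
    also have "\<dots> \<longleftrightarrow> (\<exists>j>p. enat j < wlen w \<and> ?x j = ?x p \<and> ?y j = ?y p \<and> ?D j \<and>
        (\<forall>k. p < k \<and> k < j \<and> ?x k = ?x p \<and> ?y k = ?y p \<longrightarrow> \<not> ?I k))"
      using sat_edge_in below_len less_imp_le unfolding Suc_le_eq by (smt (verit))
    finally have *: "csat ?A ?R w (UntilEq (CNot (CAnd (At (2 * r + 1)) (Pos (inc_form r)))) (CAnd (At (2 * r + 1)) (Pos (dec_form r))))
        (Suc p) (restr ?R (data_at w p) (2 * r + 1)) \<longleftrightarrow> (\<exists>j>p. enat j < wlen w \<and> ?x j = ?x p \<and> ?y j = ?y p \<and> ?D j \<and>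
        (\<forall>k. p < k \<and> k < j \<and> ?x k = ?x p \<and> ?y k = ?y p \<longrightarrow> \<not> ?I k))" .
    \<comment> \<open>\<open>Class 1\<close> needs the next position to exist; any witness
      \<open>j\<close> beyond \<open>p\<close> provides it.\<close>
    have "enat (Suc p) < wlen w" if "p < j" "enat j < wlen w" for j
      using below_len[of "Suc p" j] that by simp
    then show ?thesis using * by (auto simp: nat_add_distrib simp del: csat.simps(6))
  qed
  then show ?thesis unfolding future_form_def tokens_future_def by (simp add: sat_edge_in del: psat.simps(8))
qed

lemma sat_final_form:
  assumes "wlen w = enat l"
  shows "sat final_form 0 \<longleftrightarrow> tgt (t (l - 1)) = Run Skip"
proof -
  have l: "0 < l" using nonempty assms by (simp add: zero_enat_def)
  have "sat final_form 0 \<longleftrightarrow> (\<exists>j. j < l \<and> \<not> Suc j < l \<and> tgt (t j) = Run Skip)"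
    using assms by (auto simp: final_form_def sat_edge_in)
  also have "\<dots> \<longleftrightarrow> tgt (t (l - 1)) = Run Skip"
  proof -
    have "j < l \<and> \<not> Suc j < l \<longleftrightarrow> j = l - 1" for j using l by auto
    then show ?thesis by (metis (no_types))
  qed
  finally show ?thesis .
qed

lemma sat_recurrence_form:
  "wlen w = \<infinity> \<Longrightarrow> sat recurrence_form 0 \<longleftrightarrow> (\<forall>p. \<exists>q\<ge>p. lbl (t q) = Start)"
  by (auto simp: recurrence_form_def sat_edge_in)

end

section \<open>The input, and the meaning of the complete formulae\<close>

text \<open>A unary description, so that its code is obtained by primitive recursion. The negation
  at the end makes the number of loads exact.\<close>

primrec load_form :: "nat \<Rightarrow> (nat, nat) pform" where
  "load_form 0 = Next (PNot (Prop 1))"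
| "load_form (Suc n) = Next (PAnd (Prop 1) (load_form n))"

definition input_form :: "nat \<Rightarrow> (nat, nat) pform" where
  "input_form n = Always (PImp (Prop 0) (load_form n))"

lemma past_input_form: "past_pform (input_form n)"
proof -
  have "past_pform (load_form n)" by (induction n) auto
  then show ?thesis by (simp add: input_form_def)
qed

text \<open>Beyond the end of a finite word \<open>data_at\<close> is unspecified, so the data of a
  run and of its word can be compared at actual positions only.\<close>

lemma tokens_past_cong:
  assumes "\<And>p. enat p < len \<Longrightarrow> x p = x' p \<and> y p = y' p" and "tokens_past len I D Z x y"
  shows "tokens_past len I D Z x' y'"
proof -
  have below: "enat j < len" if "enat p < len" "j \<le> p" for j p
    using that by (metis enat_ord_simps(1) order_le_less_trans)
  have 1: "if Z p then \<forall>j\<le>p. x' j \<noteq> x' (Suc p) else x' (Suc p) = x' p" if p: "enat (Suc p) < len" for p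
  proof -
    have "x j = x' j" if "j \<le> Suc p" for j using assms(1) below[OF p that] by blast
    then show ?thesis using assms(2) p unfolding tokens_past_def by (metis le_SucI order_refl)
  qed
  have 2: "\<exists>j<p. x' j = x' p \<and> y' j = y' p \<and> I j \<and> (\<forall>k. j < k \<and> k < p \<and> x' k = x' p \<and> y' k = y' p \<longrightarrow> \<not> D k)"
    if p: "enat p < len" "D p" for p
  proof -
    have eq: "x j = x' j" "y j = y' j" if "j \<le> p" for j using assms(1) below[OF p(1) that] by blast+
    obtain j where j: "j < p" "x j = x p" "y j = y p" "I j" "\<forall>k. j < k \<and> k < p \<and> x k = x p \<and> y k = y p \<longrightarrow> \<not> D k"
      using assms(2) p unfolding tokens_past_def by blast
    then show ?thesis using eq by (intro exI[of _ j]) (metis less_imp_le order_refl)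
  qed
  show ?thesis unfolding tokens_past_def using 1 2 by blast
qed

lemma tokens_future_cong:
  assumes "\<And>p. enat p < len \<Longrightarrow> x p = x' p \<and> y p = y' p" and "tokens_future len I D x y"
  shows "tokens_future len I D x' y'"
  unfolding tokens_future_def
proof (intro allI impI)
  fix p assume p: "enat p < len" "I p"
  obtain j where j: "j > p" "enat j < len" "x j = x p" "y j = y p" "D j"
    "\<forall>k. p < k \<and> k < j \<and> x k = x p \<and> y k = y p \<longrightarrow> \<not> I k"
    using assms(2) p unfolding tokens_future_def by blast
  have eq: "x k = x' k" "y k = y' k" if "k \<le> j" for k
    using assms(1) j(2) that by (metis enat_ord_simps(1) order_le_less_trans)+
  show "\<exists>j>p. enat j < len \<and> x' j = x' p \<and> y' j = y' p \<and> D j \<and>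
      (\<forall>k. p < k \<and> k < j \<and> x' k = x' p \<and> y' k = y' p \<longrightarrow> \<not> I k)"
    using j eq by (intro exI[of _ j]) (metis less_imp_le order_refl)
qed

lemma tokens_imp_counter_run:
  assumes "\<And>r. r \<le> K \<Longrightarrow> tokens_past len (\<lambda>p. r \<in> incs (lbl (t p))) (\<lambda>p. r \<in> decs (lbl (t p)))
    (\<lambda>p. r \<in> tests (lbl (t p))) (x r) (y r)"
  obtains v where "counter_run K len t v"
    and "\<And>r p. r \<le> K \<Longrightarrow> tokens_future len (\<lambda>p. r \<in> incs (lbl (t p))) (\<lambda>p. r \<in> decs (lbl (t p))) (x r) (y r) \<Longrightarrow>
      enat p < len \<Longrightarrow> r \<in> tests (lbl (t p)) \<Longrightarrow> v r p = 0"
proof -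
  have "\<exists>v. \<forall>r\<le>K. counts len (\<lambda>p. r \<in> incs (lbl (t p))) (\<lambda>p. r \<in> decs (lbl (t p))) (\<lambda>p. r \<in> tests (lbl (t p))) (v r) \<and>
      (tokens_future len (\<lambda>p. r \<in> incs (lbl (t p))) (\<lambda>p. r \<in> decs (lbl (t p))) (x r) (y r) \<longrightarrow>
        (\<forall>p. enat p < len \<longrightarrow> r \<in> tests (lbl (t p)) \<longrightarrow> v r p = 0))"
    using tokens_imp_counts[OF assms exclusive_ops] by metis
  then show thesis using that unfolding counter_run_def by blast
qed

lemma zero_notin_tests: "0 \<notin> tests a"
  by (cases a) auto

context edge_encoding
begin

definition base_form :: "nat \<Rightarrow> (nat, nat) pform" where
  "base_form K = PAnd path_form (Conj (map past_form [0..<Suc K]))"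

definition finite_form :: "nat \<Rightarrow> (nat, nat) pform" where
  "finite_form K = PAnd (base_form K) (PAnd final_form (Conj (map future_form [1..<Suc K])))"

definition infinite_form :: "nat \<Rightarrow> (nat, nat) pform" where
  "infinite_form K = PAnd (base_form K) recurrence_form"

text \<open>Recurrence is expressed with the ordinary \<open>Until\<close>, which the fragment
  retains.\<close>

lemma past_infinite_form: "past_pform (infinite_form K)"
  by (auto simp: infinite_form_def base_form_def path_form_def past_form_def recurrence_form_def)

text \<open>The signature is not chosen along with the formula, so its size must be recovered from
  well-formedness: the letters mention all propositions below \<open>M\<close>, and
  \<open>past_form K\<close> mentions attribute \<open>2 * K + 1\<close>.\<close>

lemma pform_over_base_form:
  assumes "pform_over P {..<n} (base_form K)"
  shows "{..<M} \<subseteq> P" and "2 * K + 1 < n"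
proof -
  have "pform_over P {..<n} (edge_in (\<lambda>e. src e = Fil))"
    using assms by (auto simp: base_form_def path_form_def)
  then show "{..<M} \<subseteq> P"
    by (rule pform_over_edge_in[of _ _ _ "(Fil, Fill, Fil)"]) (auto simp: graph_def)
  have "pform_over P {..<n} (past_form K)"
    using assms by (auto simp: base_form_def pform_over_Conj)
  then show "2 * K + 1 < n"
    by (auto simp: past_form_def pform_over_Conj Always_def PImp_def PTrue_def)
qed

end

context labelled_word
begin

lemma sat_load_form:
  "enat p < wlen w \<Longrightarrow> sat (load_form n) p \<longleftrightarrow>
    (\<forall>i<n. enat (Suc p + i) < wlen w \<and> lbl (t (Suc p + i)) = Load) \<and>
    enat (Suc p + n) < wlen w \<and> lbl (t (Suc p + n)) \<noteq> Load"
proof (induction n arbitrary: p)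
  case 0
  then show ?case using sat_Load[of "Suc p"] by auto
next
  case (Suc n)
  show ?case
  proof (cases "enat (Suc p) < wlen w")
    case True
    then show ?thesis using Suc.IH[OF True] sat_Load[OF True] by (auto simp: All_less_Suc2)
  next
    case False
    then show ?thesis by auto
  qed
qed

lemma sat_base_form:
  assumes "K < k"
  shows "sat (base_form K) 0 \<and> sat (input_form n) 0 \<longleftrightarrow> run c n (wlen w) t \<and>
    (\<forall>r\<le>K. tokens_past (wlen w) (\<lambda>p. r \<in> incs (lbl (t p))) (\<lambda>p. r \<in> decs (lbl (t p)))
      (\<lambda>p. r \<in> tests (lbl (t p))) (\<lambda>p. data_at w p (2 * r)) (\<lambda>p. data_at w p (2 * r + 1)))"
proof -
  have "sat path_form 0 \<and> sat (input_form n) 0 \<longleftrightarrow> run c n (wlen w) t"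
    unfolding sat_path_form run_def input_form_def psat_Always psat_PImp
    using sat_Start sat_load_form t(1) by auto
  moreover have "sat (Conj (map past_form [0..<Suc K])) 0 \<longleftrightarrow> (\<forall>r\<le>K. sat (past_form r) 0)"
    unfolding psat_Conj by (auto simp del: upt_Suc)
  ultimately show ?thesis
    using assms sat_past_form unfolding base_form_def psat.simps by auto
qed

lemma sat_finite_form_imp:
  assumes K: "K < k" "regs c \<subseteq> {..<K}" "0 < K" and w: "wlen w = enat l"
    and sat: "sat (PAnd (finite_form K) (input_form n)) 0"
  shows "\<exists>\<sigma>'. sem c (\<lambda>r. if r = 0 then n else 0) \<sigma>'"
proof -
  have base: "sat (base_form K) 0 \<and> sat (input_form n) 0" and "sat final_form 0"
    and fut: "\<And>r. 0 < r \<Longrightarrow> r \<le> K \<Longrightarrow> sat (future_form r) 0"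
    using sat by (auto simp: finite_form_def simp del: upt_Suc)
  then have final: "tgt (t (l - 1)) = Run Skip" using sat_final_form[OF w] by simp
  from base sat_base_form[OF K(1)] have run: "run c n (enat l) t"
    and past: "\<And>r. r \<le> K \<Longrightarrow> tokens_past (enat l) (\<lambda>p. r \<in> incs (lbl (t p))) (\<lambda>p. r \<in> decs (lbl (t p)))
      (\<lambda>p. r \<in> tests (lbl (t p))) (\<lambda>p. data_at w p (2 * r)) (\<lambda>p. data_at w p (2 * r + 1))"
    unfolding w by blast+
  from tokens_imp_counter_run[OF past] obtain v where v: "counter_run K (enat l) t v"
    and ex: "\<And>r p. r \<le> K \<Longrightarrow> tokens_future (enat l) (\<lambda>p. r \<in> incs (lbl (t p))) (\<lambda>p. r \<in> decs (lbl (t p)))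
      (\<lambda>p. data_at w p (2 * r)) (\<lambda>p. data_at w p (2 * r + 1)) \<Longrightarrow>
      enat p < enat l \<Longrightarrow> r \<in> tests (lbl (t p)) \<Longrightarrow> v r p = 0"
    by blast
  have "exact_at K t v p" if "p < l" for p
    unfolding exact_at_def
  proof (intro allI impI)
    fix r assume r: "r \<le> K" "r \<in> tests (lbl (t p))"
    then have "0 < r" using zero_notin_tests by (metis gr0I)
    with r K(1) fut sat_future_form[of r] have "tokens_future (enat l) (\<lambda>p. r \<in> incs (lbl (t p)))
        (\<lambda>p. r \<in> decs (lbl (t p))) (\<lambda>p. data_at w p (2 * r)) (\<lambda>p. data_at w p (2 * r + 1))"
      unfolding w by simp
    from ex[OF r(1) this _ r(2)] that show "v r p = 0" by simp
  qed
  moreover have "0 < l" using nonempty w by (simp add: zero_enat_def)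
  ultimately show ?thesis using finite_run_imp_sem[OF run v K(2,3) _ final] by blast
qed

lemma sat_infinite_form_imp:
  assumes K: "K < k" "regs c \<subseteq> {..<K}" "0 < K" and w: "wlen w = \<infinity>"
    and sat: "sat (PAnd (infinite_form K) (input_form n)) 0"
  shows "\<exists>\<sigma>'. sem c (\<lambda>r. if r = 0 then n else 0) \<sigma>'"
proof -
  have base: "sat (base_form K) 0 \<and> sat (input_form n) 0" and "sat recurrence_form 0"
    using sat by (auto simp: infinite_form_def)
  then have inf: "\<exists>q\<ge>p. lbl (t q) = Start" for p using sat_recurrence_form[OF w] by simp
  from base sat_base_form[OF K(1)] have run: "run c n \<infinity> t"
    and past: "\<And>r. r \<le> K \<Longrightarrow> tokens_past \<infinity> (\<lambda>p. r \<in> incs (lbl (t p))) (\<lambda>p. r \<in> decs (lbl (t p)))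
      (\<lambda>p. r \<in> tests (lbl (t p))) (\<lambda>p. data_at w p (2 * r)) (\<lambda>p. data_at w p (2 * r + 1))"
    unfolding w by blast+
  from tokens_imp_counter_run[OF past] obtain v where v: "counter_run K \<infinity> t v" by blast
  show ?thesis by (rule infinite_run_imp_sem[OF run v K(2,3) inf])
qed

end

section \<open>From runs to data words\<close>

text \<open>The data are those of \<open>counts_imp_tokens\<close>: even attributes carry the coarse
  value of a counter and odd ones the fine value, with \<open>g\<close> embedding the naturals into
  the data domain.\<close>

definition run_letter ::
  "(edge \<Rightarrow> nat set) \<Rightarrow> (nat \<Rightarrow> 'd) \<Rightarrow> (nat \<Rightarrow> edge) \<Rightarrow> (nat \<Rightarrow> nat \<Rightarrow> nat) \<Rightarrow> nat \<Rightarrow> (nat, nat, 'd) letter" where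
  "run_letter lab g t v p = (lab (t p), \<lambda>a.
     if even a then g (card {j. j < p \<and> a div 2 \<in> tests (lbl (t j))})
     else g (if a div 2 \<in> decs (lbl (t p)) then v (a div 2) p - 1 else v (a div 2) p))"

lemma run_letter_simps:
  "fst (run_letter lab g t v p) = lab (t p)"
  "snd (run_letter lab g t v p) (2 * r) = g (card {j. j < p \<and> r \<in> tests (lbl (t j))})"
  "snd (run_letter lab g t v p) (2 * r + 1) = g (if r \<in> decs (lbl (t p)) then v r p - 1 else v r p)"
  by (simp_all add: run_letter_def)

context edge_encoding
begin

lemma run_letter_word:
  assumes run: "run c n (wlen w) t" "counter_run K (wlen w) t v" "\<And>p. exact_at K t v p"
    and K: "K < k" and g: "inj g" and w: "0 < wlen w" "\<And>p. enat p < wlen w \<Longrightarrow> wnth w p = run_letter lab g t v p"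
  shows "wlen w = enat l \<Longrightarrow> tgt (t (l - 1)) = Run Skip \<Longrightarrow> (\<And>r. 0 < r \<Longrightarrow> r \<le> K \<Longrightarrow> v r l = 0) \<Longrightarrow>
      psat {..<2 * k} (attr_order k) w (PAnd (finite_form K) (input_form n)) 0"
    and "wlen w = \<infinity> \<Longrightarrow> (\<And>p. \<exists>q\<ge>p. lbl (t q) = Start) \<Longrightarrow>
      psat {..<2 * k} (attr_order k) w (PAnd (infinite_form K) (input_form n)) 0"
proof -
  interpret labelled_word c es lab M w k t
  proof
    fix p assume p: "enat p < wlen w"
    show "t p \<in> graph c" using run(1) p by (simp add: run_def)
    from lab_less[OF this] show "props_at w p \<inter> {..<M} = lab (t p)"
      unfolding w(2)[OF p] run_letter_simps by blast
  qed (rule w(1))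
  have counts: "counts (wlen w) (\<lambda>p. r \<in> incs (lbl (t p))) (\<lambda>p. r \<in> decs (lbl (t p))) (\<lambda>p. r \<in> tests (lbl (t p))) (v r)"
    if "r \<le> K" for r using run(2) that by (simp add: counter_run_def)
  have zero: "v r p = 0" if "r \<le> K" "r \<in> tests (lbl (t p))" for r p
    using run(3) that by (simp add: exact_at_def)
  have data: "g (card {j. j < p \<and> r \<in> tests (lbl (t j))}) = data_at w p (2 * r) \<and>
      g (if r \<in> decs (lbl (t p)) then v r p - 1 else v r p) = data_at w p (2 * r + 1)" if "enat p < wlen w" for p r
    unfolding w(2)[OF that] run_letter_simps by simp
  have past: "tokens_past (wlen w) (\<lambda>p. r \<in> incs (lbl (t p))) (\<lambda>p. r \<in> decs (lbl (t p)))
      (\<lambda>p. r \<in> tests (lbl (t p))) (\<lambda>p. data_at w p (2 * r)) (\<lambda>p. data_at w p (2 * r + 1))" if "r \<le> K" for r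
    by (rule tokens_past_cong[OF data counts_imp_tokens(1)[OF counts[OF that] exclusive_ops zero[OF that] g]])
  then have base: "sat (base_form K) 0 \<and> sat (input_form n) 0"
    unfolding sat_base_form[OF K] using run(1) by blast
  show "sat (PAnd (infinite_form K) (input_form n)) 0"
    if "wlen w = \<infinity>" "\<And>p. \<exists>q\<ge>p. lbl (t q) = Start"
    using base that sat_recurrence_form[OF that(1)] by (simp add: infinite_form_def)
  show "sat (PAnd (finite_form K) (input_form n)) 0"
    if l: "wlen w = enat l" "tgt (t (l - 1)) = Run Skip" "\<And>r. 0 < r \<Longrightarrow> r \<le> K \<Longrightarrow> v r l = 0"
  proof -
    have "sat (future_form r) 0" if r: "0 < r" "r \<le> K" for r
    proof -
      have "tokens_future (wlen w) (\<lambda>p. r \<in> incs (lbl (t p))) (\<lambda>p. r \<in> decs (lbl (t p)))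
          (\<lambda>p. data_at w p (2 * r)) (\<lambda>p. data_at w p (2 * r + 1))"
        by (rule tokens_future_cong[OF data counts_imp_tokens(2)[OF counts[OF r(2)] exclusive_ops zero[OF r(2)] g l(1) l(3)[OF r]]])
      then show ?thesis using sat_future_form[of r] r(2) K by simp
    qed
    then show ?thesis using base l(2) sat_final_form[OF l(1)]
      by (auto simp: finite_form_def simp del: upt_Suc)
  qed
qed

end

lemma edge_encoding_exists: "\<exists>es lab M. edge_encoding c es lab M"
proof -
  obtain es where es: "set es = graph c" using finite_list[OF finite_graph] by blast
  obtain enc :: "edge \<Rightarrow> nat" where enc: "inj_on enc (graph c)"
    using finite_imp_inj_to_nat_seg[OF finite_graph] by blast
  obtain N where N: "\<And>e. e \<in> graph c \<Longrightarrow> enc e < N"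
    using finite_nat_bounded[OF finite_imageI[OF finite_graph[of c], of enc]] by auto
  \<comment> \<open>Each edge owns one proposition; the offset 2 keeps 0 and 1 free for the two
    marks.\<close>
  define lab where "lab e = {enc e + 2} \<union> (if lbl e = Start then {0} else {}) \<union> (if lbl e = Load then {1} else {})" for e
  have "inj_on lab (graph c)"
  proof (rule inj_onI)
    fix e e' assume e: "e \<in> graph c" "e' \<in> graph c" "lab e = lab e'"
    have "enc e + 2 \<in> lab e" by (simp add: lab_def)
    then have "enc e + 2 \<in> lab e'" unfolding e(3) .
    then have "enc e = enc e'" by (simp add: lab_def split: if_splits)
    then show "e = e'" using enc e by (auto dest: inj_onD)
  qed
  then have "edge_encoding c es lab (N + 2)"
    using es N by unfold_locales (auto simp: lab_def)
  then show ?thesis by blast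
qed

text \<open>The formulae depend on \<open>f\<close> alone. The diagonal argument chooses
  \<open>m\<close>, \<open>k\<close> and \<open>n\<close> by the code of the formula, hence only
  after the formula is fixed.\<close>

lemma satisfiable_iff_rec_eval:
  fixes \<Delta> :: "'d set"
  assumes "infinite \<Delta>"
  obtains \<phi> \<psi> where "past_pform \<psi>"
    and "\<And>m k n. pform_over {..<m} {..<2 * k} \<phi> \<Longrightarrow>
      sat_finite \<Delta> (m, 2 * k, attr_pairs k, PAnd \<phi> (input_form n)) \<longleftrightarrow> rec_eval f [n] 0"
    and "\<And>m k n. pform_over {..<m} {..<2 * k} \<psi> \<Longrightarrow>
      sat_infinite \<Delta> (m, 2 * k, attr_pairs k, PAnd \<psi> (input_form n)) \<longleftrightarrow> rec_eval f [n] 0"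
proof -
  obtain c where c: "\<And>n \<sigma>'. sem c (\<lambda>r. if r = 0 then n else 0) \<sigma>' \<longleftrightarrow> rec_eval f [n] 0 \<and> \<sigma>' = (\<lambda>_. 0)"
    using prog_for_zero_of_recf by blast
  obtain N where N: "regs c \<subseteq> {..<N}" using finite_nat_bounded[OF finite_regs] by blast
  \<comment> \<open>The successor ensures that the input register 0 is represented even if the
    program never touches it.\<close>
  define K where "K = Suc N"
  have K: "regs c \<subseteq> {..<K}" "0 < K" using N by (auto simp: K_def)
  obtain es lab M where "edge_encoding c es lab M" using edge_encoding_exists by blast
  then interpret edge_encoding c es lab M .
  \<comment> \<open>The infinity of the data domain enters here: heights and test counts have no
    bound.\<close>
  obtain g :: "nat \<Rightarrow> 'd" where g: "inj g" "range g \<subseteq> \<Delta>"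
    using infinite_countable_subset[OF assms] by blast
  have over: "data_word_over {..<m} {..<2 * k} \<Delta> w"
    if "{..<M} \<subseteq> {..<m}" "\<And>p. enat p < wlen w \<Longrightarrow> wnth w p = run_letter lab g t v p" "\<And>p. enat p < wlen w \<Longrightarrow> t p \<in> graph c"
    for m k w t v
    unfolding data_word_over_def
  proof (intro allI impI conjI)
    fix p assume p: "enat p < wlen w"
    show "props_at w p \<subseteq> {..<m}"
      using lab_less[OF that(3)[OF p]] that(1) unfolding that(2)[OF p] run_letter_simps by (rule subset_trans)
    show "data_at w p ` {..<2 * k} \<subseteq> \<Delta>"
      using g(2) unfolding that(2)[OF p] by (auto simp: run_letter_def)
  qed
  have labelled: "\<exists>t. labelled_word c es lab M w t"
    if "psat A R w (base_form K) 0" "0 < wlen w" for A R and w :: "(nat, nat, 'd) data_word"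
  proof -
    from that(1) psat_path_form_labels[of A R w] obtain t where
      "\<forall>p. enat p < wlen w \<longrightarrow> t p \<in> graph c \<and> props_at w p \<inter> {..<M} = lab (t p)"
      by (auto simp: base_form_def)
    then have "labelled_word c es lab M w t" using that(2) by unfold_locales auto
    then show ?thesis by (rule exI[where x = t])
  qed
  show thesis
  proof (rule that)
    show "past_pform (infinite_form K)" by (rule past_infinite_form)
  next
    fix m k n
    assume wf: "pform_over {..<m} {..<2 * k} (finite_form K)"
    then have M: "{..<M} \<subseteq> {..<m}" and "2 * K + 1 < 2 * k"
      using pform_over_base_form[of "{..<m}" "2 * k" K] by (auto simp: finite_form_def)
    then have k: "K < k" by simp
    show "sat_finite \<Delta> (m, 2 * k, attr_pairs k, PAnd (finite_form K) (input_form n)) \<longleftrightarrow> rec_eval f [n] 0"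
    proof
      assume "sat_finite \<Delta> (m, 2 * k, attr_pairs k, PAnd (finite_form K) (input_form n))"
      then obtain w :: "(nat, nat, 'd) data_word" where w: "wlen w \<noteq> \<infinity>" "0 < wlen w"
        "psat {..<2 * k} (attr_order k) w (PAnd (finite_form K) (input_form n)) 0"
        by (auto simp: sat_finite_def)
      obtain l where l: "wlen w = enat l" using w(1) by blast
      have "psat {..<2 * k} (attr_order k) w (base_form K) 0"
        using w(3) by (simp add: finite_form_def)
      from labelled[OF this w(2)] obtain t where "labelled_word c es lab M w t" by (rule exE)
      from labelled_word.sat_finite_form_imp[OF this k K l w(3)] c show "rec_eval f [n] 0" by blast
    next
      assume "rec_eval f [n] 0"
      then have "sem c (\<lambda>r. if r = 0 then n else 0) (\<lambda>_. 0)" using c by blast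
      from sem_imp_run[OF this K] obtain t v l where t: "run c n (enat l) t" "counter_run K \<infinity> t v"
        "\<And>p. exact_at K t v p" "0 < l" "tgt (t (l - 1)) = Run Skip" "\<And>r. 0 < r \<Longrightarrow> r \<le> K \<Longrightarrow> v r l = 0"
        by metis
      define w where "w = Finite_Word (map (run_letter lab g t v) [0..<l])"
      have len: "wlen w = enat l" and nth: "\<And>p. enat p < wlen w \<Longrightarrow> wnth w p = run_letter lab g t v p"
        by (auto simp: w_def)
      have "counter_run K (wlen w) t v" using t(2) by (auto simp: counter_run_def counts_def)
      moreover have "0 < wlen w" using t(4) len by (simp add: zero_enat_def)
      ultimately have "psat {..<2 * k} (attr_order k) w (PAnd (finite_form K) (input_form n)) 0"
        using run_letter_word(1)[OF _ _ t(3) k g(1) _ nth len t(5,6)] t(1) len by auto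
      moreover have "data_word_over {..<m} {..<2 * k} \<Delta> w"
        by (rule over[OF M nth]) (use t(1) len in \<open>auto simp: run_def\<close>)
      ultimately show "sat_finite \<Delta> (m, 2 * k, attr_pairs k, PAnd (finite_form K) (input_form n))"
        using \<open>0 < wlen w\<close> len unfolding sat_finite_def by auto
    qed
  next
    fix m k n
    assume wf: "pform_over {..<m} {..<2 * k} (infinite_form K)"
    then have M: "{..<M} \<subseteq> {..<m}" and "2 * K + 1 < 2 * k"
      using pform_over_base_form[of "{..<m}" "2 * k" K] by (auto simp: infinite_form_def)
    then have k: "K < k" by simp
    show "sat_infinite \<Delta> (m, 2 * k, attr_pairs k, PAnd (infinite_form K) (input_form n)) \<longleftrightarrow> rec_eval f [n] 0"
    proof
      assume "sat_infinite \<Delta> (m, 2 * k, attr_pairs k, PAnd (infinite_form K) (input_form n))"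
      then obtain w :: "(nat, nat, 'd) data_word" where w: "wlen w = \<infinity>"
        "psat {..<2 * k} (attr_order k) w (PAnd (infinite_form K) (input_form n)) 0"
        by (auto simp: sat_infinite_def)
      have "psat {..<2 * k} (attr_order k) w (base_form K) 0" "0 < wlen w"
        using w by (simp_all add: infinite_form_def)
      from labelled[OF this] obtain t where "labelled_word c es lab M w t" by (rule exE)
      from labelled_word.sat_infinite_form_imp[OF this k K w] c show "rec_eval f [n] 0" by blast
    next
      assume "rec_eval f [n] 0"
      then have "sem c (\<lambda>r. if r = 0 then n else 0) (\<lambda>_. 0)" using c by blast
      from sem_imp_run[OF this K] obtain t v where t: "run c n \<infinity> t" "counter_run K \<infinity> t v"
        "\<And>p. exact_at K t v p" "\<And>p. \<exists>q\<ge>p. lbl (t q) = Start"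
        by metis
      define w where "w = Infinite_Word (run_letter lab g t v)"
      have len: "wlen w = \<infinity>" and nth: "\<And>p. enat p < wlen w \<Longrightarrow> wnth w p = run_letter lab g t v p"
        by (auto simp: w_def)
      have "psat {..<2 * k} (attr_order k) w (PAnd (infinite_form K) (input_form n)) 0"
        using run_letter_word(2)[OF _ _ t(3) k g(1) _ nth len t(4)] t(1,2) len by auto
      moreover have "data_word_over {..<m} {..<2 * k} \<Delta> w"
        by (rule over[OF M nth]) (use t(1) in \<open>auto simp: run_def\<close>)
      ultimately show "sat_infinite \<Delta> (m, 2 * k, attr_pairs k, PAnd (infinite_form K) (input_form n))"
        using len unfolding sat_infinite_def by auto
    qed
  qed
qed


section \<open>Diagonalization\<close>

definition recursive :: "nat \<Rightarrow> (nat list \<Rightarrow> nat) \<Rightarrow> bool" where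
  "recursive k F \<longleftrightarrow> (\<exists>f. \<forall>xs. length xs = k \<longrightarrow> rec_eval f xs (F xs))"

lemma recursive_Suc:
  assumes "recursive k F"
  shows "recursive k (\<lambda>xs. Suc (F xs))"
proof -
  from assms obtain f where f: "\<And>xs. length xs = k \<Longrightarrow> rec_eval f xs (F xs)"
    unfolding recursive_def by blast
  have "rec_eval (Comp Successor [f]) xs (Suc (F xs))" if "length xs = k" for xs
    by (rule rec_eval.comp[of _ _ "[F xs]"]) (auto simp: f that intro: rec_eval.successor)
  then show ?thesis unfolding recursive_def by blast
qed

lemma recursive_const: "recursive k (\<lambda>_. c)"
proof (induction c)
  case 0
  show ?case unfolding recursive_def using rec_eval.zero by blast
next
  case (Suc c)
  then show ?case by (rule recursive_Suc)
qed

lemma recursive_nth: "i < k \<Longrightarrow> recursive k (\<lambda>xs. xs ! i)"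
  unfolding recursive_def using rec_eval.proj by blast

lemma recursive_comp1:
  assumes "recursive 1 (\<lambda>xs. h (xs ! 0))" "recursive k F"
  shows "recursive k (\<lambda>xs. h (F xs))"
proof -
  from assms obtain g f where g: "\<And>xs. length xs = 1 \<Longrightarrow> rec_eval g xs (h (xs ! 0))"
    and f: "\<And>xs. length xs = k \<Longrightarrow> rec_eval f xs (F xs)"
    unfolding recursive_def by blast
  have "rec_eval (Comp g [f]) xs (h (F xs))" if "length xs = k" for xs
    by (rule rec_eval.comp[of _ _ "[F xs]"]) (use f[OF that] g[of "[F xs]"] in auto)
  then show ?thesis unfolding recursive_def by blast
qed

lemma recursive_comp2:
  assumes "recursive 2 (\<lambda>xs. h (xs ! 0) (xs ! 1))" "recursive k F" "recursive k G"
  shows "recursive k (\<lambda>xs. h (F xs) (G xs))"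
proof -
  from assms obtain h' f g where h: "\<And>xs. length xs = 2 \<Longrightarrow> rec_eval h' xs (h (xs ! 0) (xs ! 1))"
    and f: "\<And>xs. length xs = k \<Longrightarrow> rec_eval f xs (F xs)"
    and g: "\<And>xs. length xs = k \<Longrightarrow> rec_eval g xs (G xs)"
    unfolding recursive_def by blast
  have "rec_eval (Comp h' [f, g]) xs (h (F xs) (G xs))" if "length xs = k" for xs
    by (rule rec_eval.comp[of _ _ "[F xs, G xs]"]) (use f[OF that] g[OF that] h[of "[F xs, G xs]"] in auto)
  then show ?thesis unfolding recursive_def by blast
qed

lemma recursive_add:
  assumes "recursive k F" "recursive k G"
  shows "recursive k (\<lambda>xs. F xs + G xs)"
proof (rule recursive_comp2[OF _ assms])
  have "rec_eval (PrimRec (Proj 0) (Comp Successor [Proj 1])) [x, y] (x + y)" for x y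
  proof (induction x)
    case 0
    have "rec_eval (Proj 0) [y] ([y] ! 0)" by (rule rec_eval.proj) simp
    then show ?case using rec_eval.primrec_0 by auto
  next
    case (Suc x)
    have "rec_eval (Proj 1) [x, x + y, y] ([x, x + y, y] ! 1)" by (rule rec_eval.proj) simp
    then have "rec_eval (Comp Successor [Proj 1]) [x, x + y, y] (Suc (x + y))"
      by (intro rec_eval.comp[of _ _ "[x + y]"]) (auto intro: rec_eval.successor)
    with Suc show ?case using rec_eval.primrec_Suc by auto
  qed
  then have "rec_eval (PrimRec (Proj 0) (Comp Successor [Proj 1])) xs (xs ! 0 + xs ! 1)" if "length xs = 2" for xs
    using that by (auto simp: length_Suc_conv numeral_2_eq_2)
  then show "recursive 2 (\<lambda>xs. xs ! 0 + xs ! 1)" unfolding recursive_def by blast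
qed

text \<open>Recursion without parameters suffices for all codes below, so the base value is a
  constant and a nullary function computes it.\<close>

lemma recursive_primrec:
  assumes G: "recursive 2 (\<lambda>xs. G (xs ! 0) (xs ! 1))" and h: "\<And>n. h (Suc n) = G n (h n)" and F: "recursive k F"
  shows "recursive k (\<lambda>xs. h (F xs))"
proof (rule recursive_comp1[OF _ F])
  obtain g where g: "\<And>xs. length xs = 2 \<Longrightarrow> rec_eval g xs (G (xs ! 0) (xs ! 1))"
    using G unfolding recursive_def by blast
  obtain f where f: "rec_eval f [] (h 0)"
    using recursive_const[of 0 "h 0"] unfolding recursive_def by auto
  have "rec_eval (PrimRec f g) [n] (h n)" for n
  proof (induction n)
    case 0
    show ?case using f by (rule rec_eval.primrec_0)
  next
    case (Suc n)
    then show ?case using g[of "[n, h n]"] h by (intro rec_eval.primrec_Suc) auto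
  qed
  then have "rec_eval (PrimRec f g) xs (h (xs ! 0))" if "length xs = 1" for xs
    using that by (auto simp: length_Suc_conv)
  then show "recursive 1 (\<lambda>xs. h (xs ! 0))" unfolding recursive_def by blast
qed

lemma recursive_triangle:
  assumes "recursive k F"
  shows "recursive k (\<lambda>xs. triangle (F xs))"
  by (rule recursive_primrec[where G = "\<lambda>n y. y + Suc n", OF _ _ assms])
    (auto intro!: recursive_add recursive_Suc recursive_nth)

lemma recursive_prod_encode:
  assumes "recursive k F" "recursive k G"
  shows "recursive k (\<lambda>xs. prod_encode (F xs, G xs))"
  unfolding prod_encode_def prod.case
  by (intro recursive_add recursive_triangle assms)

lemmas recursive_intros = recursive_Suc recursive_const recursive_nth recursive_add recursive_prod_encode

lemma recursive_attr_pairs: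
  assumes "recursive k F"
  shows "recursive k (\<lambda>xs. list_encode (map prod_encode (attr_pairs (F xs))))"
proof (rule recursive_primrec[OF _ _ assms])
  \<comment> \<open>\<open>list_encode\<close> adds an entry by \<open>Suc\<close> and pairing.
    Doubling appears as \<open>n + n\<close>, since addition is available as a closure rule and
    multiplication is not.\<close>
  show "list_encode (map prod_encode (attr_pairs (Suc n))) =
    (\<lambda>n y. Suc (prod_encode (prod_encode (n + n, n + n), Suc (prod_encode (prod_encode (n + n, Suc (n + n)),
      Suc (prod_encode (prod_encode (Suc (n + n), Suc (n + n)), y))))))) n (list_encode (map prod_encode (attr_pairs n)))" for n
    by (simp add: mult_2)
qed (intro recursive_intros; simp)

lemma recursive_load_form:
  assumes "recursive k F"
  shows "recursive k (\<lambda>xs. encode_pform (load_form (F xs)))"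
proof (rule recursive_primrec[OF _ _ assms])
  \<comment> \<open>The constants are the tags of \<open>Next\<close> and \<open>PAnd\<close> and
    the code of \<open>Prop 1\<close>.\<close>
  show "encode_pform (load_form (Suc n)) =
    (\<lambda>n y. prod_encode (3, prod_encode (1, prod_encode (prod_encode (0, 1), y)))) n (encode_pform (load_form n))" for n
    by simp
qed (intro recursive_intros; simp)

lemma recursive_input_form:
  assumes "recursive k F"
  shows "recursive k (\<lambda>xs. encode_pform (input_form (F xs)))"
  unfolding input_form_def Always_def PImp_def PTrue_def encode_pform.simps
  by (intro recursive_intros recursive_load_form assms)

text \<open>The instance that feeds \<open>\<phi>\<close> with the input \<open>e\<close>. In the diagonal argument \<open>e\<close> is the code
  of \<open>\<phi>\<close> itself, which bounds the propositions and attributes of \<open>\<phi>\<close>; so the whole instance is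
  recursive in \<open>e\<close>.\<close>

definition inst :: "(nat, nat) pform \<Rightarrow> nat \<Rightarrow> nd_instance" where
  "inst \<phi> e = (Suc (Suc e), 2 * Suc e, attr_pairs (Suc e), PAnd \<phi> (input_form e))"

text \<open>Here \<open>e\<close> stands both in the place of the code of the formula and as the
  input, so no decoding of \<open>e\<close> is necessary.\<close>

definition diag_code :: "nat \<Rightarrow> nat" where
  "diag_code e = prod_encode (Suc (Suc e), prod_encode (Suc e + Suc e,
     prod_encode (list_encode (map prod_encode (attr_pairs (Suc e))),
       prod_encode (1, prod_encode (e, encode_pform (input_form e))))))"

lemma encode_inst: "encode_instance (inst \<phi> (encode_pform \<phi>)) = diag_code (encode_pform \<phi>)"
  unfolding inst_def diag_code_def encode_instance.simps encode_pform.simps mult_2 ..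

lemma recursive_diag_code: "recursive 1 (\<lambda>xs. diag_code (xs ! 0))"
  unfolding diag_code_def by (intro recursive_intros recursive_attr_pairs recursive_input_form) simp_all

section \<open>Admissibility of the diagonal instance\<close>

lemma pform_over_mono: "pform_over P A \<phi> \<Longrightarrow> P \<subseteq> P' \<Longrightarrow> A \<subseteq> A' \<Longrightarrow> pform_over P' A' \<phi>"
  and cform_over_mono: "cform_over P A \<psi> \<Longrightarrow> P \<subseteq> P' \<Longrightarrow> A \<subseteq> A' \<Longrightarrow> cform_over P' A' \<psi>"
  by (induction \<phi> and \<psi>) auto

text \<open>Pairing is at least as large as each component, so the propositions, the attributes and
  the codes of subformulae stay below the code of the whole.\<close>

lemma pform_over_encode: "encode_pform \<phi> < n \<Longrightarrow> pform_over {..<n} {..<n} \<phi>"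
  and cform_over_encode: "encode_cform \<psi> < n \<Longrightarrow> cform_over {..<n} {..<n} \<psi>"
proof -
  have less: "a < n \<and> b < n" if "prod_encode (a, b) < n" for a b
    using that le_prod_encode_1[of a b] le_prod_encode_2[of b a] by simp
  show "encode_pform \<phi> < n \<Longrightarrow> pform_over {..<n} {..<n} \<phi>"
    and "encode_cform \<psi> < n \<Longrightarrow> cform_over {..<n} {..<n} \<psi>"
    by (induction \<phi> and \<psi>) (auto dest!: less)
qed

lemma pform_over_input_form: "{0, 1} \<subseteq> P \<Longrightarrow> pform_over P A (input_form n)"
proof -
  assume P: "{0, 1} \<subseteq> P"
  then have "pform_over P A (load_form n)" by (induction n) auto
  with P show ?thesis by (simp add: input_form_def Always_def PImp_def PTrue_def)
qed

lemma inst_pform_over: "pform_over {..<Suc (Suc (encode_pform \<phi>))} {..<2 * Suc (encode_pform \<phi>)} \<phi>"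
  by (rule pform_over_mono[OF pform_over_encode[OF lessI]]) auto

lemma inst_in_nd_ltl: "inst \<phi> (encode_pform \<phi>) \<in> nd_ltl"
  \<comment> \<open>The number of propositions in \<open>inst\<close> is at least 2 even for code 0,
    which accommodates the two propositions of \<open>input_form\<close>.\<close>
  using inst_pform_over pform_over_input_form[of "{..<Suc (Suc (encode_pform \<phi>))}"] tree_order_attr_order
  by (auto simp: nd_ltl_def inst_def simp del: attr_pairs.simps mult_Suc_right)

text \<open>The formula representing \<open>Comp d [s]\<close> makes \<open>Q\<close> true on its
  own instance exactly if \<open>d\<close> answers 0 there, which means no. The argument consults
  \<open>d\<close> on this single instance, which lies in \<open>I\<close>.\<close>

lemma diagonal:
  assumes repr: "\<And>f. \<exists>\<phi>. inst \<phi> (encode_pform \<phi>) \<in> I \<and>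
    (\<forall>m k n. pform_over {..<m} {..<2 * k} \<phi> \<longrightarrow>
      (Q (m, 2 * k, attr_pairs k, PAnd \<phi> (input_form n)) \<longleftrightarrow> rec_eval f [n] 0))"
  shows "\<not> decidable_on I Q"
proof
  assume "decidable_on I Q"
  then obtain d where d: "\<And>x. x \<in> I \<Longrightarrow> rec_eval d [encode_instance x] (if Q x then 1 else 0)"
    unfolding decidable_on_def by blast
  obtain s where "\<forall>xs. length xs = 1 \<longrightarrow> rec_eval s xs (diag_code (xs ! 0))"
    using recursive_diag_code unfolding recursive_def by blast
  then have s: "rec_eval s [e] (diag_code e)" for e by (auto dest: spec[of _ "[e]"])
  obtain \<phi> where \<phi>: "inst \<phi> (encode_pform \<phi>) \<in> I"
    "\<And>m k n. pform_over {..<m} {..<2 * k} \<phi> \<Longrightarrow>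
      Q (m, 2 * k, attr_pairs k, PAnd \<phi> (input_form n)) \<longleftrightarrow> rec_eval (Comp d [s]) [n] 0"
    using repr[of "Comp d [s]"] by blast
  let ?e = "encode_pform \<phi>" and ?x = "inst \<phi> (encode_pform \<phi>)"
  have "Q ?x \<longleftrightarrow> rec_eval (Comp d [s]) [?e] 0"
    unfolding inst_def using \<phi>(2)[OF inst_pform_over] .
  moreover have "rec_eval (Comp d [s]) [?e] (if Q ?x then 1 else 0)"
    by (rule rec_eval.comp[of _ _ "[diag_code ?e]"]) (use s d[OF \<phi>(1)] in \<open>auto simp: encode_inst\<close>)
  ultimately show False
    using rec_eval_deterministic[of "Comp d [s]" "[?e]" 0 1] by (auto split: if_splits)
qed

theorem theorem5:
  fixes \<Delta> :: "'d set"
  assumes "infinite \<Delta>"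
  shows "\<not> decidable_on nd_ltl (sat_finite \<Delta>) \<and>
         \<not> decidable_on nd_ltl (sat_infinite \<Delta>) \<and>
         \<not> decidable_on nd_ltl_minus (sat_infinite \<Delta>)"
proof -
  have "\<not> decidable_on nd_ltl (sat_finite \<Delta>)"
  proof (rule diagonal)
    fix f
    show "\<exists>\<phi>. inst \<phi> (encode_pform \<phi>) \<in> nd_ltl \<and> (\<forall>m k n. pform_over {..<m} {..<2 * k} \<phi> \<longrightarrow>
        (sat_finite \<Delta> (m, 2 * k, attr_pairs k, PAnd \<phi> (input_form n)) \<longleftrightarrow> rec_eval f [n] 0))"
      by (rule satisfiable_iff_rec_eval[OF assms, of f]) (blast intro: inst_in_nd_ltl)
  qed
  moreover have minus: "\<not> decidable_on nd_ltl_minus (sat_infinite \<Delta>)"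
  proof (rule diagonal)
    fix f
    have "inst \<psi> (encode_pform \<psi>) \<in> nd_ltl_minus" if "past_pform \<psi>" for \<psi>
      using inst_in_nd_ltl[of \<psi>] past_input_form that by (simp add: nd_ltl_minus_def inst_def)
    then show "\<exists>\<psi>. inst \<psi> (encode_pform \<psi>) \<in> nd_ltl_minus \<and> (\<forall>m k n. pform_over {..<m} {..<2 * k} \<psi> \<longrightarrow>
        (sat_infinite \<Delta> (m, 2 * k, attr_pairs k, PAnd \<psi> (input_form n)) \<longleftrightarrow> rec_eval f [n] 0))"
      by (rule_tac satisfiable_iff_rec_eval[OF assms, of f]) blast
  qed
  \<comment> \<open>A decision procedure for a larger set of inputs also serves a smaller one, so
    undecidability passes from the fragment to the full logic.\<close>
  moreover have "nd_ltl_minus \<subseteq> nd_ltl" by (auto simp: nd_ltl_minus_def)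
  then have "\<not> decidable_on nd_ltl (sat_infinite \<Delta>)"
    using minus unfolding decidable_on_def by blast
  ultimately show ?thesis by blast
qed

end
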